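(* Assume the standing assumptions below, $T$-periodicity of the coefficients and $\int_{\|x\|>1}\|x\|M(dx)<\infty$. Then for every $t\in\mathbb R$ the function $$\hat\nu_t(h):=\exp\Big\{i\Big\langle h,\int_{-\infty}^tU(t,r)f(r)\,dr\Big\rangle\Big\}\exp\Big\{\int_{-\infty}^t\lambda\big(B^*(r)U^*(t,r)h\big)\,dr\Big\},\qquad h\in H,$$ is well defined and is the characteristic functional of a (infinitely divisible) Borel probability measure $\nu_t$ on $H$. The family $(\nu_t)_{t\in\mathbb R}$ is an evolution system of measures, it is $T$-periodic ($\nu_{t+T}=\nu_t$ for all $t$), and every $T$-periodic evolution system of measures coincides with $(\nu_t)_{t\in\mathbb R}$.
   Context: $H$ is a real separable Hilbert space. $L$ is an $H$-valued Lévy process with characteristics $(b,R,M)$ ($b\in H$, $R$ symmetric nonnegative trace class, $M$ a Lévy measure) and Lévy symbol $\lambda(u)=i\langle b,u\rangle-\frac12\langle u,Ru\rangle+\int_{H\setminus\{0\}}(e^{i\langle u,x\rangle}-1-i\langle u,x\rangle1_{\{\|x\|\le1\}})M(dx)$. Coefficients: $f:\mathbb R\to H$ continuous, $B:\mathbb R\to\mathcal L(H)$ strongly continuous with $\sup_r\|B(r)\|<\infty$, $A(t)$ linear operators with a common domain; there is an evolution family $\{U(t,s)\}_{s\le t}$ ($U(s,s)=I$, $U(t,s)U(s,r)=U(t,r)$, strongly continuous, $\|U(t,s)\|\le ce^{-\omega(t-s)}$ with $c,\omega>0$, $\frac{d}{dt}U(t,s)x=A(t)U(t,s)x$) solving the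 deterministic problem $\dot X=A(t)X+f(t)$. There is $T>0$ such that $A$, $f$, $B$ are $T$-periodic (hence $U(t+T,s+T)=U(t,s)$). The mild solution is $X(t,s,x)=U(t,s)x+\int_s^tU(t,r)f(r)dr+\int_s^tU(t,r)B(r)dL_r$ and $P(s,t)\varphi(x):=\mathbb E\varphi(X(t,s,x))$, $s\le t$. An evolution system of measures is a family $(\nu_t)_{t\in\mathbb R}$ of Borel probability measures on $H$ with $\int_H P(s,t)\varphi\,d\nu_s=\int_H\varphi\,d\nu_t$ for all $s<t$ and all bounded measurable $\varphi:H\to\mathbb R$; it is $T$-periodic if $\nu_{t+T}=\nu_t$ for all $t$. *)

theory Defs
  imports "HOL-Probability.Probability"
begin

text \<open>Real separable Hilbert space: a type of class real_inner, complete_space and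
  second_countable_topology.\<close>

definition adj :: "('h::{real_inner,complete_space} \<Rightarrow>\<^sub>L 'h) \<Rightarrow> ('h \<Rightarrow>\<^sub>L 'h)" where
  "adj G = (THE G'. \<forall>x y. inner (G x) y = inner x (blinfun_apply G' y))"

definition orthonormal_basis :: "'h::{real_inner,complete_space} set \<Rightarrow> bool" where
  "orthonormal_basis E \<longleftrightarrow> (\<forall>e\<in>E. norm e = 1) \<and> (\<forall>e\<in>E. \<forall>e'\<in>E. e \<noteq> e' \<longrightarrow> inner e e' = 0)
     \<and> closure (span E) = UNIV"

definition sym_nonneg_trace_class :: "('h::{real_inner,complete_space} \<Rightarrow>\<^sub>L 'h) \<Rightarrow> bool" where
  "sym_nonneg_trace_class R \<longleftrightarrow> (\<forall>x y. inner (R x) y = inner x (R y)) \<and> (\<forall>x. 0 \<le> inner (R x) x)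
     \<and> (\<exists>E. orthonormal_basis E \<and> (\<lambda>e. inner (R e) e) summable_on E)"

definition levy_measure :: "'h::{real_inner,complete_space,second_countable_topology} measure \<Rightarrow> bool" where
  "levy_measure M \<longleftrightarrow> sets M = sets borel \<and> emeasure M {0} = 0
     \<and> (\<integral>\<^sup>+x. ennreal (min 1 ((norm x)\<^sup>2)) \<partial>M) < \<infinity>"

definition levy_symbol :: "'h::{real_inner,complete_space,second_countable_topology}
     \<Rightarrow> ('h \<Rightarrow>\<^sub>L 'h) \<Rightarrow> 'h measure \<Rightarrow> 'h \<Rightarrow> complex" where
  "levy_symbol b R M u = \<i> * complex_of_real (inner b u) - complex_of_real (inner u (R u) / 2)
     + (\<integral>x. cis (inner u x) - 1 - \<i> * complex_of_real (inner u x) * (if norm x \<le> 1 then 1 else 0)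
          \<partial>(restrict_space M (- {0})))"

definition levy_process :: "'w measure \<Rightarrow> (real \<Rightarrow> 'w \<Rightarrow> 'h::{real_inner,complete_space,second_countable_topology})
     \<Rightarrow> 'h \<Rightarrow> ('h \<Rightarrow>\<^sub>L 'h) \<Rightarrow> 'h measure \<Rightarrow> bool" where
  "levy_process \<Omega> L b R M \<longleftrightarrow>
     prob_space \<Omega> \<and> levy_measure M \<and> sym_nonneg_trace_class R
   \<and> (\<forall>t. L t \<in> borel_measurable \<Omega>)
   \<and> (\<forall>\<omega>\<in>space \<Omega>. L 0 \<omega> = 0)
   \<and> (\<forall>\<omega>\<in>space \<Omega>. \<forall>t. continuous (at_right t) (\<lambda>s. L s \<omega>)
                          \<and> (\<exists>l. ((\<lambda>s. L s \<omega>) \<longlongrightarrow> l) (at_left t)))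
   \<and> (\<forall>(ts::nat \<Rightarrow> real) n. (\<forall>i<n. ts i \<le> ts (Suc i)) \<longrightarrow>
        prob_space.indep_vars \<Omega> (\<lambda>_. borel) (\<lambda>i \<omega>. L (ts (Suc i)) \<omega> - L (ts i) \<omega>) {..<n})
   \<and> (\<forall>s t u. s \<le> t \<longrightarrow>
        (\<integral>\<omega>. cis (inner u (L t \<omega> - L s \<omega>)) \<partial>\<Omega>) = exp (complex_of_real (t - s) * levy_symbol b R M u))"

definition is_stoch_int :: "'w measure \<Rightarrow> (real \<Rightarrow> 'w \<Rightarrow> 'h::{real_inner,complete_space,second_countable_topology})
     \<Rightarrow> (real \<Rightarrow> 'h \<Rightarrow>\<^sub>L 'h) \<Rightarrow> real \<Rightarrow> real \<Rightarrow> ('w \<Rightarrow> 'h) \<Rightarrow> bool" where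
  "is_stoch_int \<Omega> L G s t Y \<longleftrightarrow> Y \<in> borel_measurable \<Omega> \<and>
     (\<forall>\<epsilon>>0. (\<lambda>n::nat. measure \<Omega> {\<omega>\<in>space \<Omega>.
         norm ((\<Sum>k<n. G (s + real k * (t - s) / real n)
                 (L (s + real (Suc k) * (t - s) / real n) \<omega> - L (s + real k * (t - s) / real n) \<omega>)) - Y \<omega>) > \<epsilon>})
       \<longlonglongrightarrow> 0)"

definition stoch_int where
  "stoch_int \<Omega> L G s t = (SOME Y. is_stoch_int \<Omega> L G s t Y)"

definition mild_sol :: "'w measure \<Rightarrow> (real \<Rightarrow> 'w \<Rightarrow> 'h::{real_inner,complete_space,second_countable_topology})
     \<Rightarrow> (real \<Rightarrow> real \<Rightarrow> 'h \<Rightarrow>\<^sub>L 'h) \<Rightarrow> (real \<Rightarrow> 'h) \<Rightarrow> (real \<Rightarrow> 'h \<Rightarrow>\<^sub>L 'h)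
     \<Rightarrow> real \<Rightarrow> real \<Rightarrow> 'h \<Rightarrow> 'w \<Rightarrow> 'h" where
  "mild_sol \<Omega> L U f B t s x \<omega> = U t s x + (\<integral>r\<in>{s..t}. U t r (f r) \<partial>lborel)
     + stoch_int \<Omega> L (\<lambda>r. U t r o\<^sub>L B r) s t \<omega>"

definition transition :: "'w measure \<Rightarrow> (real \<Rightarrow> 'w \<Rightarrow> 'h::{real_inner,complete_space,second_countable_topology})
     \<Rightarrow> (real \<Rightarrow> real \<Rightarrow> 'h \<Rightarrow>\<^sub>L 'h) \<Rightarrow> (real \<Rightarrow> 'h) \<Rightarrow> (real \<Rightarrow> 'h \<Rightarrow>\<^sub>L 'h)
     \<Rightarrow> real \<Rightarrow> real \<Rightarrow> ('h \<Rightarrow> real) \<Rightarrow> 'h \<Rightarrow> real" where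
  "transition \<Omega> L U f B s t \<phi> x = (\<integral>\<omega>. \<phi> (mild_sol \<Omega> L U f B t s x \<omega>) \<partial>\<Omega>)"

definition evolution_system_of_measures ::
  "(real \<Rightarrow> real \<Rightarrow> ('h::{real_inner,complete_space,second_countable_topology} \<Rightarrow> real) \<Rightarrow> 'h \<Rightarrow> real)
     \<Rightarrow> (real \<Rightarrow> 'h measure) \<Rightarrow> bool" where
  "evolution_system_of_measures P \<nu> \<longleftrightarrow>
     (\<forall>t. prob_space (\<nu> t) \<and> sets (\<nu> t) = sets borel)
   \<and> (\<forall>s t \<phi>. s < t \<longrightarrow> \<phi> \<in> borel_measurable borel \<longrightarrow> bounded (range \<phi>) \<longrightarrow>
        (\<integral>x. P s t \<phi> x \<partial>\<nu> s) = (\<integral>x. \<phi> x \<partial>\<nu> t))"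

definition char_functional :: "'h::{real_inner,complete_space,second_countable_topology} measure \<Rightarrow> 'h \<Rightarrow> complex" where
  "char_functional \<mu> h = (\<integral>x. cis (inner h x) \<partial>\<mu>)"

definition conv_meas :: "'h::{real_inner,complete_space,second_countable_topology} measure \<Rightarrow> 'h measure \<Rightarrow> 'h measure" where
  "conv_meas \<mu> \<nu> = distr (\<mu> \<Otimes>\<^sub>M \<nu>) borel (\<lambda>(x, y). x + y)"

fun conv_pow :: "'h::{real_inner,complete_space,second_countable_topology} measure \<Rightarrow> nat \<Rightarrow> 'h measure" where
  "conv_pow \<mu> 0 = return borel 0"
| "conv_pow \<mu> (Suc n) = conv_meas \<mu> (conv_pow \<mu> n)"

definition infinitely_divisible :: "'h::{real_inner,complete_space,second_countable_topology} measure \<Rightarrow> bool" where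
  "infinitely_divisible \<nu> \<longleftrightarrow> (\<forall>n>0. \<exists>\<mu>. prob_space \<mu> \<and> sets \<mu> = sets borel \<and> conv_pow \<mu> n = \<nu>)"

end

theory Submission
  imports Defs
begin

text \<open>Averaging \<open>1 - Re exp (\<psi> u)\<close> over a standard Gaussian \<open>u\<close> in the first \<open>n\<close> coordinates bounds the
  mean of \<open>1 - exp (- (norm Y)\<^sup>2 / 2)\<close> for any \<open>Y\<close> whose characteristic functional is \<open>exp \<circ> \<psi>\<close>, uniformly
  in \<open>n\<close>. Applied to differences of Riemann sums against the Levy process it shows that
  they are Cauchy in probability, so the stochastic integral exists and its characteristic functional is
  the expected one; no Levy-Ito decomposition is needed. Exponential decay of \<open>U\<close> and the
  first moment of the large jumps make the integrals over the intervals \<open>[t - n - 1, t - n]\<close> summable in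
  probability, and the law of the sum of independent copies is \<open>\<nu> t\<close>. Running the Levy process at
  speed \<open>1 / n\<close> yields an \<open>n\<close>-th convolution root. Evolution systems correspond to a functional equation
  for characteristic functionals; iterating it over \<open>n\<close> periods, the initial law disappears in the limit,
  which gives uniqueness.\<close>

section \<open>Characteristic functionals determine measures\<close>

lemma inner_measurable_borel [measurable]:
  "inner (h::'h::{real_inner,second_countable_topology}) \<in> borel_measurable borel"
  by (intro borel_measurable_continuous_onI continuous_intros)

lemma cis_measurable [measurable]: "cis \<in> borel_measurable borel"
  by (intro borel_measurable_continuous_onI continuous_intros)

lemma weighted_halfspace_eq:
  fixes \<mu> \<nu> :: "'h::{real_inner,complete_space,second_countable_topology} measure"
  assumes "prob_space \<mu>" "prob_space \<nu>" and s [measurable_cong]: "sets \<mu> = sets borel" "sets \<nu> = sets borel"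
    and w [measurable]: "w \<in> borel_measurable borel" and w01: "\<And>x. 0 \<le> w x \<and> w x \<le> (1::real)"
    and eq: "\<And>h. (\<integral>x. w x *\<^sub>R cis (inner h x) \<partial>\<mu>) = (\<integral>x. w x *\<^sub>R cis (inner h x) \<partial>\<nu>)"
  shows "(\<integral>x. w x * indicator {x. inner h x \<le> c} x \<partial>\<mu>) = (\<integral>x. w x * indicator {x. inner h x \<le> c} x \<partial>\<nu>)"
proof -
  interpret \<mu>: prob_space \<mu> by fact
  interpret \<nu>: prob_space \<nu> by fact
  have sp: "space \<mu> = UNIV" "space \<nu> = UNIV" using sets_eq_imp_space_eq[OF s(1)] sets_eq_imp_space_eq[OF s(2)] by auto
  have int: "integrable \<mu> w" "integrable \<nu> w"
    using w01 by (auto intro!: \<mu>.integrable_const_bound[where B=1] \<nu>.integrable_const_bound[where B=1] AE_I2 simp: abs_of_nonneg)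
  define m where "m = (\<integral>x. w x \<partial>\<mu>)"
  have m2: "m = (\<integral>x. w x \<partial>\<nu>)"
  proof -
    have "complex_of_real (\<integral>x. w x \<partial>\<mu>) = complex_of_real (\<integral>x. w x \<partial>\<nu>)"
      using eq[of 0] by (simp add: scaleR_conv_of_real flip: integral_of_real)
    then show ?thesis by (simp add: m_def)
  qed
  have m0: "m \<ge> 0" unfolding m_def using w01 by (intro integral_nonneg_AE AE_I2) auto
  show ?thesis
  proof (cases "m = 0")
    case True
    have "AE x in \<mu>. w x = 0" using integral_nonneg_eq_0_iff_AE[OF int(1)] w01 True m_def by auto
    moreover have "AE x in \<nu>. w x = 0" using integral_nonneg_eq_0_iff_AE[OF int(2)] w01 True m2 by auto
    ultimately have "(\<integral>x. w x * indicator {x. inner h x \<le> c} x \<partial>\<mu>) = 0"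
      "(\<integral>x. w x * indicator {x. inner h x \<le> c} x \<partial>\<nu>) = 0"
      by (auto intro!: integral_eq_zero_AE)
    then show ?thesis by simp
  next
    case False
    then have mp: "m > 0" using m0 by simp
    define N where "N \<kappa> = distr (density \<kappa> (\<lambda>x. ennreal (w x / m))) borel (inner h)" for \<kappa> :: "'h measure"
    have gen: "real_distribution (N \<kappa>) \<and> (\<forall>t. char (N \<kappa>) t = (1/m) *\<^sub>R (\<integral>x. w x *\<^sub>R cis (inner (t *\<^sub>R h) x) \<partial>\<kappa>))
        \<and> measure (N \<kappa>) {..c} = (1/m) * (\<integral>x. w x * indicator {x. inner h x \<le> c} x \<partial>\<kappa>)"
      if "prob_space \<kappa>" and [measurable_cong]: "sets \<kappa> = sets borel" and i: "integrable \<kappa> w" and mm: "m = (\<integral>x. w x \<partial>\<kappa>)" for \<kappa>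
    proof (intro conjI allI)
      interpret prob_space \<kappa> by fact
      have spk: "space \<kappa> = UNIV" using sets_eq_imp_space_eq[OF that(2)] by simp
      have "emeasure (density \<kappa> (\<lambda>x. ennreal (w x / m))) UNIV = (\<integral>\<^sup>+x. ennreal (w x / m) \<partial>\<kappa>)"
        by (subst emeasure_density) (auto simp: spk[symmetric])
      also have "\<dots> = ennreal (\<integral>x. w x / m \<partial>\<kappa>)"
        using w01 mp i by (intro nn_integral_eq_integral) auto
      also have "(\<integral>x. w x / m \<partial>\<kappa>) = 1" using mp mm by simp
      finally interpret K: prob_space "density \<kappa> (\<lambda>x. ennreal (w x / m))"
        by (intro prob_spaceI) (simp add: spk)
      show "real_distribution (N \<kappa>)"
        unfolding N_def by (intro K.real_distribution_distr) simp
      show "char (N \<kappa>) t = (1/m) *\<^sub>R (\<integral>x. w x *\<^sub>R cis (inner (t *\<^sub>R h) x) \<partial>\<kappa>)" for t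
      proof -
        have "char (N \<kappa>) t = (\<integral>x. iexp (t * inner h x) \<partial>density \<kappa> (\<lambda>x. ennreal (w x / m)))"
          unfolding char_def N_def by (subst integral_distr) auto
        also have "\<dots> = (\<integral>x. (w x / m) *\<^sub>R iexp (t * inner h x) \<partial>\<kappa>)"
          using w01 mp by (subst integral_density) auto
        also have "\<dots> = (\<integral>x. (1/m) *\<^sub>R (w x *\<^sub>R cis (inner (t *\<^sub>R h) x)) \<partial>\<kappa>)"
          by (simp add: cis_conv_exp)
        finally show ?thesis by (simp only: integral_scaleR_right)
      qed
      have "measure (N \<kappa>) {..c} = (\<integral>y. indicator {..c} y \<partial>N \<kappa>)"
        by (simp add: N_def)
      also have "\<dots> = (\<integral>x. indicator {..c} (inner h x) \<partial>density \<kappa> (\<lambda>x. ennreal (w x / m)))"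
        unfolding N_def by (subst integral_distr) auto
      also have "\<dots> = (\<integral>x. (w x / m) *\<^sub>R indicator {..c} (inner h x) \<partial>\<kappa>)"
        using w01 mp by (subst integral_density) auto
      also have "\<dots> = (\<integral>x. (1/m) * (w x * indicator {x. inner h x \<le> c} x) \<partial>\<kappa>)"
        by (intro Bochner_Integration.integral_cong) (auto simp: indicator_def)
      finally show "measure (N \<kappa>) {..c} = (1/m) * (\<integral>x. w x * indicator {x. inner h x \<le> c} x \<partial>\<kappa>)"
        by (simp only: integral_mult_right_zero)
    qed
    have g1: "real_distribution (N \<mu>)" "\<And>t. char (N \<mu>) t = (1/m) *\<^sub>R (\<integral>x. w x *\<^sub>R cis (inner (t *\<^sub>R h) x) \<partial>\<mu>)"
        "measure (N \<mu>) {..c} = (1/m) * (\<integral>x. w x * indicator {x. inner h x \<le> c} x \<partial>\<mu>)"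
      using gen[OF assms(1) s(1) int(1) m_def] by blast+
    have g2: "real_distribution (N \<nu>)" "\<And>t. char (N \<nu>) t = (1/m) *\<^sub>R (\<integral>x. w x *\<^sub>R cis (inner (t *\<^sub>R h) x) \<partial>\<nu>)"
        "measure (N \<nu>) {..c} = (1/m) * (\<integral>x. w x * indicator {x. inner h x \<le> c} x \<partial>\<nu>)"
      using gen[OF assms(2) s(2) int(2) m2] by blast+
    have "N \<mu> = N \<nu>"
      by (rule Levy_uniqueness[OF g1(1) g2(1)]) (simp only: fun_eq_iff g1(2) g2(2) eq simp_thms)
    then have "(1/m) * (\<integral>x. w x * indicator {x. inner h x \<le> c} x \<partial>\<mu>) = (1/m) * (\<integral>x. w x * indicator {x. inner h x \<le> c} x \<partial>\<nu>)"
      using g1(3) g2(3) by metis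
    then show ?thesis using mp by simp
  qed
qed

text \<open>The weights \<open>w (1 + cos)\<close> and \<open>w (1 + sin)\<close> are nonnegative, so the one-dimensional uniqueness
  theorem behind \<open>weighted_halfspace_eq\<close> applies to them as well.\<close>

lemma weighted_halfspace_cis_eq:
  fixes \<mu> \<nu> :: "'h::{real_inner,complete_space,second_countable_topology} measure"
  assumes pr: "prob_space \<mu>" "prob_space \<nu>" and s [measurable_cong]: "sets \<mu> = sets borel" "sets \<nu> = sets borel"
    and w [measurable]: "w \<in> borel_measurable borel" and w01: "\<And>x. 0 \<le> w x \<and> w x \<le> (1::real)"
    and eq: "\<And>h. (\<integral>x. w x *\<^sub>R cis (inner h x) \<partial>\<mu>) = (\<integral>x. w x *\<^sub>R cis (inner h x) \<partial>\<nu>)"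
  shows "(\<integral>x. (w x * indicator {x. inner h x \<le> c} x) *\<^sub>R cis (inner g x) \<partial>\<mu>)
       = (\<integral>x. (w x * indicator {x. inner h x \<le> c} x) *\<^sub>R cis (inner g x) \<partial>\<nu>)"
proof -
  interpret \<mu>: prob_space \<mu> by fact
  interpret \<nu>: prob_space \<nu> by fact
  define I where "I x = (indicator {x. inner h x \<le> c} x :: real)" for x
  have [measurable]: "I \<in> borel_measurable borel" unfolding I_def by measurable
  have I01: "0 \<le> I x \<and> I x \<le> 1" for x by (auto simp: I_def)
  have ab: "\<bar>w x\<bar> \<le> 1" for x using w01[of x] by auto
  have int0: "integrable \<mu> (\<lambda>x. v x *\<^sub>R z x)" "integrable \<nu> (\<lambda>x. v x *\<^sub>R z x)"
    if [measurable]: "v \<in> borel_measurable borel" "z \<in> borel_measurable borel" and "\<And>x. \<bar>v x\<bar> \<le> 1" "\<And>x. norm (z x) \<le> 1"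
    for v :: "'h \<Rightarrow> real" and z :: "'h \<Rightarrow> 'b::{banach,second_countable_topology}"
    using that(3,4) by (auto intro!: \<mu>.integrable_const_bound[where B=1] \<nu>.integrable_const_bound[where B=1] AE_I2 mult_le_one)
  have wc: "integrable \<mu> (\<lambda>x. w x *\<^sub>R cis (inner k x))" "integrable \<nu> (\<lambda>x. w x *\<^sub>R cis (inner k x))" for k
    by (rule int0; simp add: ab)+
  have base: "(\<integral>x. (w x * I x) \<partial>\<mu>) = (\<integral>x. (w x * I x) \<partial>\<nu>)"
    unfolding I_def by (rule weighted_halfspace_eq) (use assms in auto)
  have tr: "(\<integral>x. w x * I x * F x \<partial>\<mu>) = (\<integral>x. w x * I x * F x \<partial>\<nu>)"
    if [measurable]: "F \<in> borel_measurable borel" and F1: "\<And>x. \<bar>F x\<bar> \<le> 1"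
      and dec: "\<And>k x. F x *\<^sub>R cis (inner k x) = \<alpha> * cis (inner (k + g) x) + \<beta> * cis (inner (k - g) x)" for F \<alpha> \<beta>
  proof -
    define v where "v x = w x * ((1 + F x) / 2)" for x
    have F2: "0 \<le> 1 + F x" "1 + F x \<le> 2" for x using F1[of x] by auto
    have v01: "0 \<le> v x \<and> v x \<le> 1" for x
      unfolding v_def using w01[of x] F2[of x] mult_le_one[of "w x" "(1 + F x) / 2"] by auto
    have [measurable]: "v \<in> borel_measurable borel" unfolding v_def by measurable
    have e: "v x *\<^sub>R cis (inner k x) = (1/2) * (w x *\<^sub>R cis (inner k x)) + \<alpha>/2 * (w x *\<^sub>R cis (inner (k + g) x)) + \<beta>/2 * (w x *\<^sub>R cis (inner (k - g) x))" for k x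
    proof -
      have "v x *\<^sub>R cis (inner k x) = (1/2) * (w x *\<^sub>R cis (inner k x)) + (1/2) * (w x *\<^sub>R (F x *\<^sub>R cis (inner k x)))"
        by (simp add: v_def scaleR_conv_of_real algebra_simps add_divide_distrib)
      then show ?thesis unfolding dec by (simp add: scaleR_conv_of_real algebra_simps add_divide_distrib)
    qed
    have lin: "(\<integral>x. (1/2) * P x + \<alpha>/2 * Q x + \<beta>/2 * S x \<partial>\<kappa>) = (1/2) * (\<integral>x. P x \<partial>\<kappa>) + \<alpha>/2 * (\<integral>x. Q x \<partial>\<kappa>) + \<beta>/2 * (\<integral>x. S x \<partial>\<kappa>)"
      if "integrable \<kappa> P" "integrable \<kappa> Q" "integrable \<kappa> S" for \<kappa> :: "'h measure" and P Q S
      using that by simp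
    have "(\<integral>x. v x *\<^sub>R cis (inner k x) \<partial>\<mu>) = (\<integral>x. v x *\<^sub>R cis (inner k x) \<partial>\<nu>)" for k
      unfolding e lin[OF wc(1) wc(1) wc(1)] lin[OF wc(2) wc(2) wc(2)] by (simp only: eq)
    then have "(\<integral>x. v x * I x \<partial>\<mu>) = (\<integral>x. v x * I x \<partial>\<nu>)"
      unfolding I_def by (intro weighted_halfspace_eq[OF pr s]) (use v01 in auto)
    moreover have "v x * I x = (w x * I x) / 2 + (w x * I x * F x) / 2" for x
      by (simp add: v_def field_simps)
    moreover have "integrable \<mu> (\<lambda>x. w x * I x)" "integrable \<nu> (\<lambda>x. w x * I x)"
      using int0[of w I] I01 ab by auto
    moreover have "integrable \<mu> (\<lambda>x. w x * I x * F x)" "integrable \<nu> (\<lambda>x. w x * I x * F x)"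
      using int0[of "\<lambda>x. w x * I x" F] F1 ab I01 by (auto simp: abs_mult intro!: mult_le_one)
    ultimately show ?thesis using base by simp
  qed
  have C: "(\<integral>x. w x * I x * cos (inner g x) \<partial>\<mu>) = (\<integral>x. w x * I x * cos (inner g x) \<partial>\<nu>)"
  proof (rule tr)
    show "cos (inner g x) *\<^sub>R cis (inner k x) = (1/2) * cis (inner (k + g) x) + (1/2) * cis (inner (k - g) x)" for k x
      by (auto simp: complex_eq_iff inner_add_left inner_diff_left cos_add sin_add cos_diff sin_diff field_simps)
  qed auto
  have S: "(\<integral>x. w x * I x * sin (inner g x) \<partial>\<mu>) = (\<integral>x. w x * I x * sin (inner g x) \<partial>\<nu>)"
  proof (rule tr)
    show "sin (inner g x) *\<^sub>R cis (inner k x) = (-\<i>/2) * cis (inner (k + g) x) + (\<i>/2) * cis (inner (k - g) x)" for k x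
      by (auto simp: complex_eq_iff inner_add_left inner_diff_left cos_add sin_add cos_diff sin_diff field_simps)
  qed auto
  have e: "(w x * I x) *\<^sub>R cis (inner g x) = complex_of_real (w x * I x * cos (inner g x)) + \<i> * complex_of_real (w x * I x * sin (inner g x))" for x
    by (simp add: complex_eq_iff)
  have ii: "integrable \<kappa> (\<lambda>x. w x * I x * cos (inner g x))" "integrable \<kappa> (\<lambda>x. w x * I x * sin (inner g x))" if "\<kappa> = \<mu> \<or> \<kappa> = \<nu>" for \<kappa>
    using int0[of "\<lambda>x. w x * I x" "\<lambda>x. cos (inner g x)"] int0[of "\<lambda>x. w x * I x" "\<lambda>x. sin (inner g x)"] ab I01 that
    by (auto simp: abs_mult intro!: mult_le_one)
  show ?thesis unfolding I_def[symmetric] e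
    by (subst (1 2) Bochner_Integration.integral_add; (intro integrable_of_real integrable_mult_right ii)?;
        (simp only: integral_complex_of_real integral_mult_right_zero C S simp_thms)?)
qed

lemma borel_eq_sigma_halfspaces:
  "sets (borel :: 'h::{real_inner,second_countable_topology} measure)
     = sigma_sets UNIV (range (\<lambda>l. {x::'h. \<forall>(h,c)\<in>set l. inner h x \<le> (c::real)}))" (is "_ = sigma_sets UNIV (range ?S)")
proof
  interpret sigma_algebra UNIV "sigma_sets UNIV (range ?S)" by (rule sigma_algebra_sigma_sets) auto
  obtain D :: "'h set" where D: "countable D" "\<And>X. open X \<Longrightarrow> X \<noteq> {} \<Longrightarrow> \<exists>d\<in>D. d \<in> X"
    using countable_dense_exists by blast
  have hs: "{x::'h. inner h x \<le> c} \<in> sigma_sets UNIV (range ?S)" for h c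
  proof -
    have "{x::'h. inner h x \<le> c} = ?S [(h,c)]" by auto
    then show ?thesis by blast
  qed
  have cb: "cball d q \<in> sigma_sets UNIV (range ?S)" if "q \<ge> 0" for d :: 'h and q
  proof -
    have "cball d q = (\<Inter>e\<in>D. {x. inner e x \<le> q * norm e + inner e d})"
    proof (intro set_eqI iffI)
      fix x assume "x \<in> cball d q"
      then have "norm (x - d) \<le> q" by (simp add: dist_norm norm_minus_commute)
      then have "inner e (x - d) \<le> q * norm e" for e
        using norm_cauchy_schwarz[of e "x-d"] mult_right_mono[of "norm (x-d)" q "norm e"] by (auto simp: mult.commute)
      then show "x \<in> (\<Inter>e\<in>D. {x. inner e x \<le> q * norm e + inner e d})"
        by (auto simp: inner_diff_right algebra_simps)
    next
      fix x assume x: "x \<in> (\<Inter>e\<in>D. {x. inner e x \<le> q * norm e + inner e d})"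
      show "x \<in> cball d q"
      proof (rule ccontr)
        assume "x \<notin> cball d q"
        then have gt: "q < norm (x - d)" by (simp add: dist_norm norm_minus_commute)
        define X where "X = {e. q * norm e < inner e (x - d)}"
        have "open X" unfolding X_def by (intro open_Collect_less continuous_intros)
        moreover have "x - d \<in> X" 
        proof (cases "x = d")
          case True
          then show ?thesis using gt \<open>q \<ge> 0\<close> by simp
        next
          case False
          then show ?thesis using gt by (auto simp: X_def power2_norm_eq_inner[symmetric] power2_eq_square)
        qed
        ultimately obtain e where "e \<in> D" "e \<in> X" using D(2)[of X] by blast
        then show False using x by (auto simp: X_def inner_diff_right)
      qed
    qed
    moreover have "(\<Inter>e\<in>D. {x. inner e x \<le> q * norm e + inner e d}) \<in> sigma_sets UNIV (range ?S)"
      using D(1) D(2)[of UNIV] hs by (intro countable_INT'') auto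
    ultimately show ?thesis by simp
  qed
  show "sets borel \<subseteq> sigma_sets UNIV (range ?S)"
    unfolding borel_def
  proof (simp, intro sigma_sets_mono, safe)
    fix A :: "'h set" assume A: "open A"
    have "A = (\<Union>p\<in>{(d,q). d\<in>D \<and> q \<in> \<rat> \<and> q \<ge> 0 \<and> cball d q \<subseteq> A}. cball (fst p) (snd p))"
    proof (intro set_eqI iffI)
      fix x assume "x \<in> A"
      then obtain e where e: "e > 0" "cball x e \<subseteq> A" using A open_contains_cball by blast
      obtain q where q: "q \<in> \<rat>" "0 < q" "q < e/2" using Rats_dense_in_real[of 0 "e/2"] e by auto
      obtain d where d: "d \<in> D" "d \<in> ball x q" using D(2)[of "ball x q"] q by auto
      have "cball d q \<subseteq> cball x e"
      proof
        fix y assume "y \<in> cball d q"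
        then have "dist d y \<le> q" "dist x d < q" using d by auto
        then show "y \<in> cball x e" using dist_triangle[of x y d] q by simp
      qed
      then show "x \<in> (\<Union>p\<in>{(d,q). d\<in>D \<and> q \<in> \<rat> \<and> q \<ge> 0 \<and> cball d q \<subseteq> A}. cball (fst p) (snd p))"
        using d q e by (intro UN_I[of "(d,q)"]) (auto simp: dist_commute)
    qed auto
    moreover have "(\<Union>p\<in>{(d,q). d\<in>D \<and> q \<in> \<rat> \<and> q \<ge> 0 \<and> cball d q \<subseteq> A}. cball (fst p) (snd p)) \<in> sigma_sets UNIV (range ?S)"
    proof (intro countable_UN' image_subsetI)
      have "{(d,q). d\<in>D \<and> q \<in> \<rat> \<and> q \<ge> 0 \<and> cball d q \<subseteq> A} \<subseteq> D \<times> \<rat>" by auto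
      then show "countable {(d,q). d\<in>D \<and> q \<in> \<rat> \<and> q \<ge> 0 \<and> cball d q \<subseteq> A}"
        using D(1) countable_rat by (meson countable_SIGMA countable_subset)
    qed (use cb in auto)
    ultimately show "A \<in> sigma_sets UNIV (range ?S)" by simp
  qed
  show "sigma_sets UNIV (range ?S) \<subseteq> sets borel"
  proof (rule sets.sigma_sets_subset[of _ borel, simplified], safe)
    fix l
    have "?S l = (\<Inter>p\<in>set l. {x. inner (fst p) x \<le> snd p})" by (auto simp: split_beta)
    moreover have "closed (\<Inter>p\<in>set l. {x::'h. inner (fst p) x \<le> snd p})"
      by (intro closed_INT ballI closed_Collect_le continuous_intros)
    ultimately show "?S l \<in> sets borel" by simp
  qed
qed

theorem char_functional_unique:
  fixes \<mu> \<nu> :: "'h::{real_inner,complete_space,second_countable_topology} measure"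
  assumes pr: "prob_space \<mu>" "prob_space \<nu>" and s: "sets \<mu> = sets borel" "sets \<nu> = sets borel"
    and eq: "\<And>h. char_functional \<mu> h = char_functional \<nu> h"
  shows "\<mu> = \<nu>"
proof -
  interpret \<mu>: prob_space \<mu> by fact
  interpret \<nu>: prob_space \<nu> by fact
  note [measurable_cong] = s
  let ?S = "\<lambda>l. {x::'h. \<forall>(h,c)\<in>set l. inner h x \<le> (c::real)}"
  have meas: "?S l \<in> sets borel" for l
    unfolding borel_eq_sigma_halfspaces by blast
  have *: "(\<integral>x. indicator (?S l) x *\<^sub>R cis (inner g x) \<partial>\<mu>) = (\<integral>x. indicator (?S l) x *\<^sub>R cis (inner g x) \<partial>\<nu>)" for l g
  proof (induction l arbitrary: g)
    case Nil
    then show ?case using eq by (simp add: char_functional_def)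
  next
    case (Cons p l)
    have e: "indicator (?S (p # l)) x = indicator (?S l) x * (indicator {x. inner (fst p) x \<le> snd p} x :: real)" for x
      by (auto simp: indicator_def split_beta)
    show ?case unfolding e
      by (rule weighted_halfspace_cis_eq[OF pr s]) (use meas[of l] Cons.IH in auto)
  qed
  have sp: "space \<mu> = UNIV" "space \<nu> = UNIV" using sets_eq_imp_space_eq[OF s(1)] sets_eq_imp_space_eq[OF s(2)] by auto
  show ?thesis
  proof (rule measure_eqI_generator_eq[where E="range ?S" and \<Omega>=UNIV and A="\<lambda>_. UNIV"])
    show "Int_stable (range ?S)"
    proof (rule Int_stableI, safe)
      fix l k
      have "?S l \<inter> ?S k = ?S (l @ k)" by auto
      then show "?S l \<inter> ?S k \<in> range ?S" by blast
    qed
    fix X assume "X \<in> range ?S"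
    then obtain l where X: "X = ?S l" by blast
    have "complex_of_real (measure \<mu> X) = complex_of_real (measure \<nu> X)"
      using *[of l 0] meas[of l] by (simp add: X scaleR_conv_of_real s flip: integral_of_real)
    then show "emeasure \<mu> X = emeasure \<nu> X"
      by (simp add: \<mu>.emeasure_eq_measure \<nu>.emeasure_eq_measure)
  next
    have "UNIV = ?S []" by simp
    then show "range (\<lambda>_::nat. UNIV) \<subseteq> range ?S" by blast
  qed (use s borel_eq_sigma_halfspaces in auto)
qed

section \<open>Orthonormal bases and adjoints\<close>

text \<open>An orthonormal basis is enumerated with possible gaps filled by zeros, so that finite- and
  infinite-dimensional spaces are treated alike.\<close>

locale onb_seq =
  fixes e :: "nat \<Rightarrow> 'h::{real_inner,complete_space,second_countable_topology}"
  assumes inner_e: "\<And>i j. i \<noteq> j \<Longrightarrow> inner (e i) (e j) = 0"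
    and norm_e: "\<And>i. e i = 0 \<or> norm (e i) = 1"
    and dense_e: "closure (span (range e)) = UNIV"
begin

definition proj :: "nat \<Rightarrow> 'h \<Rightarrow> 'h" where "proj n x = (\<Sum>i<n. inner x (e i) *\<^sub>R e i)"

lemma inner_e_self: "inner x (e i) * inner (e i) (e i) = inner x (e i)"
  using norm_e[of i] by (auto simp: power2_norm_eq_inner[symmetric])

lemma inner_sum_e: "inner (\<Sum>i<n. a i *\<^sub>R e i) (e j) = (if j < n then a j * inner (e j) (e j) else 0)"
proof -
  have "inner (\<Sum>i<n. a i *\<^sub>R e i) (e j) = (\<Sum>i<n. if i = j then a j * inner (e j) (e j) else 0)"
    unfolding inner_sum_left by (intro sum.cong) (auto simp: inner_e)
  then show ?thesis by simp
qed

lemma inner_proj_e: "inner (proj n x) (e j) = (if j < n then inner x (e j) else 0)"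
  unfolding proj_def inner_sum_e by (simp add: inner_e_self)

lemma norm_proj: "(norm (proj n x))\<^sup>2 = (\<Sum>i<n. (inner x (e i))\<^sup>2)"
proof -
  have "(norm (proj n x))\<^sup>2 = inner (proj n x) (\<Sum>i<n. inner x (e i) *\<^sub>R e i)"
    by (simp add: power2_norm_eq_inner proj_def)
  also have "\<dots> = (\<Sum>i<n. (inner x (e i))\<^sup>2)"
    unfolding inner_sum_right by (intro sum.cong) (auto simp: inner_proj_e power2_eq_square)
  finally show ?thesis .
qed

lemma inner_proj_diff: "inner (x - proj n x) (proj n y) = 0"
proof -
  have "inner (x - proj n x) (proj n y) = (\<Sum>i<n. inner y (e i) * inner (x - proj n x) (e i))"
    by (simp add: proj_def[of n y] inner_sum_right)
  also have "\<dots> = 0" by (intro sum.neutral) (auto simp: inner_diff_left inner_proj_e)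
  finally show ?thesis .
qed

lemma norm_diff_proj: "(norm (x - proj n x))\<^sup>2 = (norm x)\<^sup>2 - (norm (proj n x))\<^sup>2"
proof -
  have pyth: "(norm (a + b))\<^sup>2 = (norm a)\<^sup>2 + (norm b)\<^sup>2" if "inner a b = 0" for a b :: 'h
    using that by (simp add: power2_norm_eq_inner inner_add_left inner_add_right inner_commute)
  show ?thesis using pyth[OF inner_proj_diff[of x n x]] by simp
qed

lemma norm_proj_le: "norm (proj n x) \<le> norm x"
proof (rule power2_le_imp_le)
  show "(norm (proj n x))\<^sup>2 \<le> (norm x)\<^sup>2"
    using norm_diff_proj[of x n] zero_le_power2[of "norm (x - proj n x)"] by linarith
qed simp

lemma proj_add: "proj n (x + y) = proj n x + proj n y"
  by (simp add: proj_def inner_add_left scaleR_add_left sum.distrib)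

lemma proj_diff: "proj n (x - y) = proj n x - proj n y"
  by (simp add: proj_def inner_diff_left scaleR_diff_left sum_subtractf)

lemma proj_scaleR: "proj n (c *\<^sub>R x) = c *\<^sub>R proj n x"
  by (simp add: proj_def scaleR_sum_right)

lemma proj_e: "j < n \<Longrightarrow> proj n (e j) = e j"
proof -
  assume "j < n"
  have "proj n (e j) = (\<Sum>i<n. if i = j then inner (e j) (e j) *\<^sub>R e j else 0)"
    unfolding proj_def by (intro sum.cong) (auto simp: inner_e)
  also have "\<dots> = e j" using \<open>j < n\<close> norm_e[of j] by (auto simp: power2_norm_eq_inner[symmetric])
  finally show ?thesis .
qed

lemma proj_span: "x \<in> span (range e) \<Longrightarrow> eventually (\<lambda>n. proj n x = x) sequentially"
proof (induction rule: span_induct_alt)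
  case base
  then show ?case by (simp add: proj_def)
next
  case (step c x y)
  from step(1) obtain j where j: "x = e j" by blast
  have "eventually (\<lambda>n. proj n x = x) sequentially"
    using eventually_gt_at_top[of j] by eventually_elim (simp only: j proj_e)
  then show ?case using step(2) by eventually_elim (simp only: proj_add proj_scaleR)
qed

lemma proj_tendsto: "(\<lambda>n. proj n x) \<longlonglongrightarrow> x"
proof (rule metric_LIMSEQ_I)
  fix r :: real assume "r > 0"
  have "x \<in> closure (span (range e))" using dense_e by simp
  then have "\<forall>d>0. \<exists>y\<in>span (range e). dist y x < d" by (simp only: closure_approachable)
  then obtain y where y: "y \<in> span (range e)" "dist y x < r / 2"
    using \<open>r > 0\<close> half_gt_zero by blast
  from proj_span[OF y(1)] obtain N where N: "\<And>n. n \<ge> N \<Longrightarrow> proj n y = y"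
    unfolding eventually_sequentially by blast
  have "dist (proj n x) x < r" if "n \<ge> N" for n
  proof -
    have "dist (proj n x) x \<le> dist (proj n x) y + dist y x" by (rule dist_triangle)
    also have "dist (proj n x) y = norm (proj n (x - y))" using N[OF that] by (simp add: proj_diff dist_norm)
    also have "\<dots> \<le> norm (x - y)" by (rule norm_proj_le)
    finally show ?thesis using y(2) by (simp add: dist_norm norm_minus_commute)
  qed
  then show "\<exists>no. \<forall>n\<ge>no. dist (proj n x) x < r" by blast
qed

lemma parseval: "(\<lambda>i. (inner x (e i))\<^sup>2) sums (norm x)\<^sup>2"
  unfolding sums_def norm_proj[symmetric] by (intro tendsto_intros proj_tendsto)

lemma eq_if_inner_e:
  fixes x y :: 'h
  assumes "\<And>i. inner x (e i) = inner y (e i)" shows "x = y"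
proof -
  have "proj n x = proj n y" for n by (simp add: proj_def assms)
  then show ?thesis using proj_tendsto[of x] proj_tendsto[of y] LIMSEQ_unique by simp
qed

lemma riesz:
  fixes f :: "'h \<Rightarrow> real"
  assumes "bounded_linear f" shows "\<exists>y. \<forall>x. f x = inner x y"
proof -
  interpret f: bounded_linear f by fact
  obtain K where K: "K > 0" "\<And>x. norm (f x) \<le> norm x * K" using f.pos_bounded by blast
  define y where "y n = (\<Sum>i<n. f (e i) *\<^sub>R e i)" for n
  have ny: "(norm (\<Sum>i=m..<n. f (e i) *\<^sub>R e i))\<^sup>2 = (\<Sum>i=m..<n. (f (e i))\<^sup>2)" for m n
  proof -
    have "(norm (\<Sum>i=m..<n. f (e i) *\<^sub>R e i))\<^sup>2 = (\<Sum>i=m..<n. \<Sum>j=m..<n. f (e i) * f (e j) * inner (e i) (e j))"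
      by (simp add: power2_norm_eq_inner inner_sum_left inner_sum_right sum_distrib_left inner_commute mult_ac)
    also have "\<dots> = (\<Sum>i=m..<n. \<Sum>j=m..<n. if i = j then f (e i) * f (e i) else 0)"
    proof (intro sum.cong refl)
      fix i j show "f (e i) * f (e j) * inner (e i) (e j) = (if i = j then f (e i) * f (e i) else 0)"
        using norm_e[of i] by (auto simp: inner_e f.zero power2_norm_eq_inner[symmetric])
    qed
    also have "\<dots> = (\<Sum>i=m..<n. (f (e i))\<^sup>2)" by (simp add: power2_eq_square)
    finally show ?thesis .
  qed
  have bd: "(\<Sum>i<n. (f (e i))\<^sup>2) \<le> K\<^sup>2" for n
  proof -
    let ?s = "\<Sum>i<n. (f (e i))\<^sup>2"
    have s0: "?s \<ge> 0" by (intro sum_nonneg) auto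
    have "?s = f (y n)" by (simp add: y_def f.sum f.scaleR power2_eq_square)
    also have "\<dots> \<le> norm (y n) * K" using K(2)[of "y n"] by auto
    finally have "?s\<^sup>2 \<le> (norm (y n) * K)\<^sup>2" using s0 by (intro power_mono)
    also have "\<dots> = ?s * K\<^sup>2" using ny[of 0 n] by (simp add: power_mult_distrib y_def atLeast0LessThan)
    finally have "?s * ?s \<le> ?s * K\<^sup>2" by (simp add: power2_eq_square)
    then show ?thesis using s0 by (cases "?s = 0") auto
  qed
  have sm: "summable (\<lambda>i. (f (e i))\<^sup>2)"
    by (rule summableI_nonneg_bounded[OF _ bd]) auto
  have "Cauchy y"
  proof (rule CauchyI')
    fix r :: real assume "r > 0"
    then have "r\<^sup>2 > 0" by simp
    then obtain N where N: "\<And>m n. m \<ge> N \<Longrightarrow> norm (\<Sum>i=m..<n. (f (e i))\<^sup>2) < r\<^sup>2"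
      using sm[unfolded summable_Cauchy] by blast
    have "norm (y m - y n) < r" if "m \<ge> N" "n > m" for m n
    proof -
      have "y n - y m = (\<Sum>i=0..<n. f (e i) *\<^sub>R e i) - (\<Sum>i=0..<m. f (e i) *\<^sub>R e i)"
        by (simp only: y_def atLeast0LessThan)
      also have "\<dots> = (\<Sum>i=m..<n. f (e i) *\<^sub>R e i)"
        by (rule sum_diff_nat_ivl) (use that(2) in simp_all)
      finally have "(norm (y m - y n))\<^sup>2 = (\<Sum>i=m..<n. (f (e i))\<^sup>2)"
        by (simp only: norm_minus_commute[of "y m" "y n"] ny)
      also have "\<dots> < r\<^sup>2" using N[OF that(1), of n] by (simp only: real_norm_def abs_less_iff)
      finally show ?thesis using \<open>r > 0\<close> power2_less_imp_less less_imp_le by blast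
    qed
    then show "\<exists>N. \<forall>m\<ge>N. \<forall>n>m. dist (y m) (y n) < r" unfolding dist_norm by blast
  qed
  then obtain z where z: "y \<longlonglongrightarrow> z" using Cauchy_convergent convergent_def by blast
  have "f x = inner x z" for x
  proof (rule LIMSEQ_unique)
    have "(\<lambda>n. inner x (y n)) = (\<lambda>n. f (proj n x))"
      by (simp add: y_def proj_def f.sum f.scaleR inner_sum_right mult.commute)
    moreover have "(\<lambda>n. f (proj n x)) \<longlonglongrightarrow> f x" by (intro f.tendsto proj_tendsto)
    ultimately show "(\<lambda>n. inner x (y n)) \<longlonglongrightarrow> f x" by simp
    show "(\<lambda>n. inner x (y n)) \<longlonglongrightarrow> inner x z" by (intro tendsto_intros z)
  qed
  then show ?thesis by blast
qed

lemma inner_adj: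
  fixes G :: "'h \<Rightarrow>\<^sub>L 'h"
  shows "inner (blinfun_apply G x) y = inner x (adj G y)"
proof -
  have "\<exists>z. \<forall>x. inner (G x) y = inner x z" for y
    by (rule riesz) (rule bounded_linear_compose[OF bounded_linear_inner_left blinfun.bounded_linear_right])
  then obtain g where g: "\<And>x y. inner (G x) y = inner x (g y)" by metis
  have eqI: "a = b" if "\<And>x. inner x a = inner x b" for a b :: 'h
    using that by (intro eq_if_inner_e) (metis inner_commute)
  have "bounded_linear g"
  proof (rule bounded_linear_intro[where K="norm G"])
    fix x y :: 'h and r :: real
    show "g (x + y) = g x + g y" by (rule eqI) (simp add: g[symmetric] inner_add_right)
    show "g (r *\<^sub>R x) = r *\<^sub>R g x" by (rule eqI) (simp add: g[symmetric])
    have "(norm (g x))\<^sup>2 = inner (G (g x)) x" by (simp add: g power2_norm_eq_inner)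
    also have "\<dots> \<le> norm (G (g x)) * norm x" by (rule norm_cauchy_schwarz)
    also have "\<dots> \<le> norm G * norm (g x) * norm x" by (intro mult_right_mono norm_blinfun) auto
    finally have "norm (g x) * norm (g x) \<le> norm (g x) * (norm x * norm G)" by (simp add: power2_eq_square mult_ac)
    then show "norm (g x) \<le> norm x * norm G" by (cases "g x = 0") auto
  qed
  then obtain G' where G': "blinfun_apply G' = g" using bounded_linear_Blinfun_apply by blast
  have "\<forall>x y. inner (G x) y = inner x (blinfun_apply (adj G) y)"
    unfolding adj_def
  proof (rule theI[where a=G'])
    show "\<forall>x y. inner (G x) y = inner x (blinfun_apply G' y)" by (simp add: G' g)
    fix H assume "\<forall>x y. inner (G x) y = inner x (blinfun_apply H y)"
    then have "inner x (H y) = inner x (G' y)" for x y using G' g by auto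
    then show "H = G'" by (intro blinfun_eqI eqI) auto
  qed
  then show ?thesis by blast
qed

lemma inner_adj':
  fixes G :: "'h \<Rightarrow>\<^sub>L 'h"
  shows "inner (adj G y) x = inner y (blinfun_apply G x)"
  using inner_adj[of G x y] by (simp add: inner_commute)

lemma norm_adj_le:
  fixes G :: "'h \<Rightarrow>\<^sub>L 'h"
  shows "norm (adj G y) \<le> norm G * norm y"
proof -
  have "(norm (adj G y))\<^sup>2 = inner (G (adj G y)) y" by (simp add: inner_adj power2_norm_eq_inner)
  also have "\<dots> \<le> norm (G (adj G y)) * norm y" by (rule norm_cauchy_schwarz)
  also have "\<dots> \<le> norm G * norm (adj G y) * norm y" by (intro mult_right_mono norm_blinfun) auto
  finally have "norm (adj G y) * norm (adj G y) \<le> norm (adj G y) * (norm G * norm y)" by (simp add: power2_eq_square mult_ac)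
  then show ?thesis by (cases "adj G y = 0") auto
qed

lemma adj_unique:
  fixes G :: "'h \<Rightarrow>\<^sub>L 'h"
  assumes "\<And>x. inner z x = inner y (blinfun_apply G x)" shows "adj G y = z"
  by (rule eq_if_inner_e) (simp add: inner_adj' assms)

lemma adj_compose:
  fixes G H :: "'h \<Rightarrow>\<^sub>L 'h"
  shows "adj (G o\<^sub>L H) y = adj H (adj G y)"
  by (rule adj_unique) (simp add: inner_adj')

text \<open>The sort of the Hilbert space does not entail class \<open>banach\<close>, so the library criteria for
  Bochner integrability do not apply; the coordinates do.\<close>

lemma integrableI_hilbert:
  fixes f :: "'a \<Rightarrow> 'h"
  assumes f [measurable]: "f \<in> borel_measurable M" and fin: "(\<integral>\<^sup>+x. norm (f x) \<partial>M) < \<infinity>"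
  shows "integrable M f"
proof -
  have proj_meas [measurable]: "(\<lambda>x. proj n (f x)) \<in> borel_measurable M" for n
    unfolding proj_def by measurable
  have "\<exists>s. Bochner_Integration.simple_bochner_integrable M s \<and> (\<integral>\<^sup>+x. norm (proj n (f x) - s x) \<partial>M) < ennreal (1 / Suc n)" for n
  proof -
    have "integrable M (\<lambda>x. inner (f x) (e i) *\<^sub>R e i)" for i
    proof (intro integrable_scaleR_left integrableI_bounded)
      have "(\<integral>\<^sup>+x. norm (inner (f x) (e i)) \<partial>M) \<le> (\<integral>\<^sup>+x. norm (f x) \<partial>M)"
      proof (intro nn_integral_mono ennreal_leI)
        fix x
        have "\<bar>inner (f x) (e i)\<bar> \<le> norm (f x) * norm (e i)" by (rule Cauchy_Schwarz_ineq2)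
        also have "\<dots> \<le> norm (f x)" using norm_e[of i] by auto
        finally show "norm (inner (f x) (e i)) \<le> norm (f x)" by simp
      qed
      then show "(\<integral>\<^sup>+x. norm (inner (f x) (e i)) \<partial>M) < \<infinity>" using fin by auto
    qed measurable
    then have "integrable M (\<lambda>x. proj n (f x))" unfolding proj_def by auto
    then obtain z where "has_bochner_integral M (\<lambda>x. proj n (f x)) z" by (auto simp: integrable.simps)
    then obtain s where s: "\<And>i. Bochner_Integration.simple_bochner_integrable M (s i)"
        "(\<lambda>i. \<integral>\<^sup>+x. norm (proj n (f x) - s i x) \<partial>M) \<longlonglongrightarrow> 0"
      by (cases rule: has_bochner_integral.cases) blast
    have "\<forall>\<^sub>F i in sequentially. (\<integral>\<^sup>+x. norm (proj n (f x) - s i x) \<partial>M) < ennreal (1 / Suc n)"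
      by (rule order_tendstoD(2)[OF s(2)]) simp
    then obtain i where "(\<integral>\<^sup>+x. norm (proj n (f x) - s i x) \<partial>M) < ennreal (1 / Suc n)"
      unfolding eventually_sequentially by blast
    then show ?thesis using s(1) by blast
  qed
  then obtain s where s: "\<And>n. Bochner_Integration.simple_bochner_integrable M (s n)"
    "\<And>n. (\<integral>\<^sup>+x. norm (proj n (f x) - s n x) \<partial>M) < ennreal (1 / Suc n)" by metis
  have [measurable]: "s n \<in> borel_measurable M" for n
    using s(1) by (auto elim!: simple_bochner_integrable.cases intro: borel_measurable_simple_function)
  let ?S = "\<lambda>n. \<integral>\<^sup>+x. norm (f x - s n x) \<partial>M"
  have l1: "(\<lambda>n. \<integral>\<^sup>+x. norm (f x - proj n (f x)) \<partial>M) \<longlonglongrightarrow> (\<integral>\<^sup>+x. 0 \<partial>M)"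
  proof (rule nn_integral_dominated_convergence[where w="\<lambda>x. ennreal (2 * norm (f x))"])
    show "(\<integral>\<^sup>+x. ennreal (2 * norm (f x)) \<partial>M) < \<infinity>"
      using fin by (simp add: ennreal_mult nn_integral_cmult ennreal_mult_less_top)
    show "AE x in M. (\<lambda>n. ennreal (norm (f x - proj n (f x)))) \<longlonglongrightarrow> 0"
    proof (intro AE_I2)
      fix x
      have "(\<lambda>n. norm (f x - proj n (f x))) \<longlonglongrightarrow> norm (f x - f x)" by (intro tendsto_intros proj_tendsto)
      then show "(\<lambda>n. ennreal (norm (f x - proj n (f x)))) \<longlonglongrightarrow> 0" using tendsto_ennrealI by fastforce
    qed
    show "AE x in M. ennreal (norm (f x - proj n (f x))) \<le> ennreal (2 * norm (f x))" for n
    proof (intro AE_I2 ennreal_leI)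
      fix x show "norm (f x - proj n (f x)) \<le> 2 * norm (f x)"
        using norm_triangle_ineq4[of "f x" "proj n (f x)"] norm_proj_le[of n "f x"] by simp
    qed
  qed measurable
  have "?S n \<le> (\<integral>\<^sup>+x. norm (f x - proj n (f x)) \<partial>M) + ennreal (1 / Suc n)" for n
  proof -
    have "?S n \<le> (\<integral>\<^sup>+x. ennreal (norm (f x - proj n (f x))) + ennreal (norm (proj n (f x) - s n x)) \<partial>M)"
    proof (intro nn_integral_mono)
      fix x show "ennreal (norm (f x - s n x)) \<le> ennreal (norm (f x - proj n (f x))) + ennreal (norm (proj n (f x) - s n x))"
        using norm_triangle_ineq[of "f x - proj n (f x)" "proj n (f x) - s n x"] by (simp flip: ennreal_plus)
    qed
    also have "\<dots> = (\<integral>\<^sup>+x. norm (f x - proj n (f x)) \<partial>M) + (\<integral>\<^sup>+x. norm (proj n (f x) - s n x) \<partial>M)"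
      by (intro nn_integral_add) measurable
    also have "\<dots> \<le> (\<integral>\<^sup>+x. norm (f x - proj n (f x)) \<partial>M) + ennreal (1 / Suc n)"
      using s(2)[of n] by (intro add_left_mono) simp
    finally show ?thesis .
  qed
  note upper = this
  have "(\<lambda>n. ennreal (inverse (real (Suc n)))) \<longlonglongrightarrow> ennreal 0"
    by (rule tendsto_ennrealI[OF LIMSEQ_inverse_real_of_nat])
  from tendsto_add[OF l1 this]
  have l2: "(\<lambda>n. (\<integral>\<^sup>+x. norm (f x - proj n (f x)) \<partial>M) + ennreal (1 / Suc n)) \<longlonglongrightarrow> 0"
    by (simp only: inverse_eq_divide ennreal_0 add_0_left nn_integral_const mult_zero_left)
  have lim: "?S \<longlonglongrightarrow> 0"
    by (rule tendsto_sandwich[OF always_eventually always_eventually tendsto_const l2]) (intro allI zero_le upper)+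
  have "Cauchy (\<lambda>n. Bochner_Integration.simple_bochner_integral M (s n))"
  proof (rule metric_CauchyI)
    fix r :: real assume "0 < r"
    then have "0 < ennreal (r / 2)" by auto
    from order_tendstoD(2)[OF lim this] obtain N where N: "\<And>n. N \<le> n \<Longrightarrow> ?S n < r / 2"
      by (auto simp: eventually_sequentially)
    have "dist (Bochner_Integration.simple_bochner_integral M (s m)) (Bochner_Integration.simple_bochner_integral M (s n)) < r" if "m \<ge> N" "n \<ge> N" for m n
    proof -
      have "norm (Bochner_Integration.simple_bochner_integral M (s m) - Bochner_Integration.simple_bochner_integral M (s n)) \<le> ?S m + ?S n"
        by (intro simple_bochner_integral_bounded s f)
      also have "\<dots> < ennreal (r / 2) + r / 2" by (intro add_strict_mono N that)
      also have "\<dots> = r" using \<open>0 < r\<close> by (simp flip: ennreal_plus)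
      finally show ?thesis using \<open>0 < r\<close> by (simp add: dist_norm ennreal_less_iff)
    qed
    then show "\<exists>N. \<forall>m\<ge>N. \<forall>n\<ge>N. dist (Bochner_Integration.simple_bochner_integral M (s m)) (Bochner_Integration.simple_bochner_integral M (s n)) < r" by blast
  qed
  then obtain z where "(\<lambda>n. Bochner_Integration.simple_bochner_integral M (s n)) \<longlonglongrightarrow> z" using Cauchy_convergent convergent_def by blast
  then have "has_bochner_integral M f z" using lim s(1) f by (intro has_bochner_integral.intros) auto
  then show ?thesis by (rule integrable.intros)
qed

end

lemma orthonormal_basis_seq:
  fixes E :: "'h::{real_inner,complete_space,second_countable_topology} set"
  assumes E: "orthonormal_basis E"
  obtains e where "onb_seq e" "\<And>i. e i \<in> insert 0 E" "\<And>i j. e i = e j \<Longrightarrow> e i \<noteq> 0 \<Longrightarrow> i = j"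
proof -
  have E1: "norm x = 1" if "x \<in> E" for x using E that by (auto simp: orthonormal_basis_def)
  have E2: "inner x y = 0" if "x \<in> E" "y \<in> E" "x \<noteq> y" for x y using E that by (auto simp: orthonormal_basis_def)
  have far: "dist x y > 1" if "x \<in> E" "y \<in> E" "x \<noteq> y" for x y
  proof -
    have "(dist x y)\<^sup>2 = 2"
      using E1[OF that(1)] E1[OF that(2)] E2[OF that]
      by (simp add: dist_norm power2_norm_eq_inner inner_diff_left inner_diff_right inner_commute norm_eq_1)
    then show ?thesis using power_mono[of "dist x y" 1 2] by (cases "dist x y \<le> 1") auto
  qed
  have "countable ((\<lambda>x. ball x (1/2)) ` E)"
  proof (rule countable_disjoint_open_subsets)
    show "disjoint ((\<lambda>x. ball x (1/2)) ` E)"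
    proof (rule disjointI)
      fix a b assume "a \<in> (\<lambda>x. ball x (1/2)) ` E" "b \<in> (\<lambda>x. ball x (1/2)) ` E" and ab: "a \<noteq> b"
      then obtain x y where xy: "x \<in> E" "y \<in> E" "a = ball x (1/2)" "b = ball y (1/2)" by blast
      then have "x \<noteq> y" using ab by auto
      have False if "z \<in> a" "z \<in> b" for z
        using far[OF xy(1,2) \<open>x \<noteq> y\<close>] that dist_triangle[of x y z] unfolding xy(3,4) by (auto simp: dist_commute)
      then show "a \<inter> b = {}" by blast
    qed
  qed auto
  moreover have "inj_on (\<lambda>x. ball x (1/2)) E"
  proof (rule inj_onI, rule ccontr)
    fix x y assume xy: "x \<in> E" "y \<in> E" "ball x (1/2) = ball y (1/2)" "x \<noteq> y"
    have "x \<in> ball x (1/2)" by simp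
    then have "x \<in> ball y (1/2)" using xy(3) by simp
    then show False using far[of x y] xy by (simp add: dist_commute)
  qed
  ultimately have cE: "countable E" by (rule countable_image_inj_on)
  define e where "e i = (if i \<in> to_nat_on E ` E then from_nat_into E i else 0)" for i
  have mem: "e i \<in> insert 0 E" for i using cE by (auto simp: e_def)
  have inj: "i = j" if "e i = e j" "e i \<noteq> 0" for i j
  proof -
    have "i \<in> to_nat_on E ` E" "j \<in> to_nat_on E ` E" using that by (auto simp: e_def split: if_splits)
    then show ?thesis using that cE by (auto simp: e_def split: if_splits)
  qed
  have "E \<subseteq> range e"
  proof
    fix x assume "x \<in> E"
    then have "e (to_nat_on E x) = x" using cE by (auto simp: e_def)
    then show "x \<in> range e" by (metis rangeI)
  qed
  then have "closure (span E) \<subseteq> closure (span (range e))" by (intro closure_mono span_mono)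
  then have d: "closure (span (range e)) = UNIV" using E by (auto simp: orthonormal_basis_def)
  have "onb_seq e"
  proof
    fix i j :: nat assume "i \<noteq> j"
    then show "inner (e i) (e j) = 0" using mem[of i] mem[of j] inj[of i j] E2 by (cases "e i = e j") auto
  qed (use mem E1 d in auto)
  then show ?thesis using that mem inj by blast
qed

section \<open>Gaussian averages and Cholesky factorisation\<close>

lemma integral_pair_prod:
  fixes X :: "'a \<Rightarrow> complex" and Y :: "'b \<Rightarrow> complex"
  assumes P: "prob_space P" and Q: "prob_space Q"
    and [measurable]: "X \<in> borel_measurable P" "Y \<in> borel_measurable Q"
    and X1: "\<And>x. norm (X x) \<le> 1" and Y1: "\<And>x. norm (Y x) \<le> 1"
  shows "(\<integral>p. X (fst p) * Y (snd p) \<partial>(P \<Otimes>\<^sub>M Q)) = (\<integral>x. X x \<partial>P) * (\<integral>y. Y y \<partial>Q)"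
proof -
  interpret P: prob_space P by fact
  interpret Q: prob_space Q by fact
  interpret PQ: pair_prob_space P Q ..
  have "(\<integral>p. X (fst p) * Y (snd p) \<partial>(P \<Otimes>\<^sub>M Q)) = (\<integral>x. (\<integral>y. X x * Y y \<partial>Q) \<partial>P)"
    by (subst PQ.integral_fst'[symmetric])
       (auto intro!: PQ.integrable_const_bound[where B=1] AE_I2 simp: norm_mult X1 Y1 mult_le_one)
  then show ?thesis by simp
qed

lemma has_bochner_integral_std_normal_square:
  "has_bochner_integral lborel (\<lambda>g. std_normal_density g * (a + g * b)\<^sup>2) (a\<^sup>2 + b\<^sup>2)"
proof -
  have "has_bochner_integral lborel (\<lambda>g. a\<^sup>2 * (std_normal_density g * g ^ (2 * 0))
      + ((2 * a * b) * (std_normal_density g * g ^ (2 * 0 + 1)) + b\<^sup>2 * (std_normal_density g * g ^ (2 * 1))))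
      (a\<^sup>2 * (fact (2 * 0) / (2 ^ 0 * fact 0)) + ((2 * a * b) * 0 + b\<^sup>2 * (fact (2 * 1) / (2 ^ 1 * fact 1))))"
    by (intro has_bochner_integral_add has_bochner_integral_mult_right std_normal_moment_even std_normal_moment_odd)
  moreover have "(\<lambda>g. a\<^sup>2 * (std_normal_density g * g ^ (2 * 0))
      + ((2 * a * b) * (std_normal_density g * g ^ (2 * 0 + 1)) + b\<^sup>2 * (std_normal_density g * g ^ (2 * 1))))
      = (\<lambda>g. std_normal_density g * (a + g * b)\<^sup>2)"
    by (simp add: fun_eq_iff power2_eq_square algebra_simps)
  ultimately show ?thesis by simp
qed

lemma nn_integral_std_normal_square:
  "(\<integral>\<^sup>+g. ennreal ((a + g * b)\<^sup>2) \<partial>std_normal_distribution) = ennreal (a\<^sup>2 + b\<^sup>2)"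
proof -
  have "(\<integral>\<^sup>+g. ennreal ((a + g * b)\<^sup>2) \<partial>std_normal_distribution)
      = (\<integral>\<^sup>+g. ennreal (std_normal_density g * (a + g * b)\<^sup>2) \<partial>lborel)"
    by (subst nn_integral_density) (auto simp: ennreal_mult)
  also have "\<dots> = ennreal (a\<^sup>2 + b\<^sup>2)"
    using has_bochner_integral_std_normal_square[of a b]
    by (subst nn_integral_eq_integral) (auto simp: has_bochner_integral_iff)
  finally show ?thesis .
qed

context onb_seq
begin

primrec gauss :: "nat \<Rightarrow> 'h measure" where
  "gauss 0 = return borel 0"
| "gauss (Suc n) = distr (gauss n \<Otimes>\<^sub>M std_normal_distribution) borel (\<lambda>p. fst p + snd p *\<^sub>R e n)"

lemma sets_gauss [measurable_cong, simp]: "sets (gauss n) = sets borel"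
  by (cases n) auto

lemma prob_space_gauss: "prob_space (gauss n)"
proof (induction n)
  case 0
  then show ?case by (simp add: prob_space_return)
next
  case (Suc n)
  interpret G: prob_space "gauss n" by fact
  interpret N: prob_space std_normal_distribution by (rule prob_space_normal_density) simp
  interpret GN: pair_prob_space "gauss n" std_normal_distribution ..
  show ?case unfolding gauss.simps by (rule GN.prob_space_distr) measurable
qed

lemma char_gauss: "(\<integral>z. cis (inner x z) \<partial>gauss n) = complex_of_real (exp (- (norm (proj n x))\<^sup>2 / 2))"
proof (induction n)
  case 0
  then show ?case by (simp add: integral_return proj_def)
next
  case (Suc n)
  interpret N: prob_space std_normal_distribution by (rule prob_space_normal_density) simp
  have "(\<integral>z. cis (inner x z) \<partial>gauss (Suc n))
      = (\<integral>p. cis (inner x (fst p)) * cis (inner x (e n) * snd p) \<partial>(gauss n \<Otimes>\<^sub>M std_normal_distribution))"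
    unfolding gauss.simps by (subst integral_distr) (auto simp: cis_mult inner_add_right mult.commute)
  also have "\<dots> = (\<integral>z. cis (inner x z) \<partial>gauss n) * (\<integral>g. cis (inner x (e n) * g) \<partial>std_normal_distribution)"
    by (rule integral_pair_prod[OF prob_space_gauss N.prob_space_axioms]) auto
  also have "(\<integral>g. cis (inner x (e n) * g) \<partial>std_normal_distribution) = char std_normal_distribution (inner x (e n))"
    by (simp add: char_def cis_conv_exp)
  also have "\<dots> = complex_of_real (exp (- (inner x (e n))\<^sup>2 / 2))"
    by (simp only: char_std_normal_distribution)
  finally show ?case
    by (simp add: Suc norm_proj exp_add[symmetric] add_divide_distrib flip: of_real_mult)
qed

lemma nn_integral_gauss_square: "(\<integral>\<^sup>+z. ennreal ((inner x z)\<^sup>2) \<partial>gauss n) = ennreal ((norm (proj n x))\<^sup>2)"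
proof (induction n)
  case 0
  then show ?case by (simp add: nn_integral_return proj_def)
next
  case (Suc n)
  interpret G: prob_space "gauss n" by (rule prob_space_gauss)
  interpret N: prob_space std_normal_distribution by (rule prob_space_normal_density) simp
  interpret GN: pair_prob_space "gauss n" std_normal_distribution ..
  have "(\<integral>\<^sup>+z. ennreal ((inner x z)\<^sup>2) \<partial>gauss (Suc n))
      = (\<integral>\<^sup>+p. ennreal ((inner x (fst p) + snd p * inner x (e n))\<^sup>2) \<partial>(gauss n \<Otimes>\<^sub>M std_normal_distribution))"
    unfolding gauss.simps by (subst nn_integral_distr) (auto simp: inner_add_right)
  also have "\<dots> = (\<integral>\<^sup>+z. (\<integral>\<^sup>+g. ennreal ((inner x z + g * inner x (e n))\<^sup>2) \<partial>std_normal_distribution) \<partial>gauss n)"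
    by (subst N.nn_integral_fst[symmetric]) auto
  also have "\<dots> = (\<integral>\<^sup>+z. ennreal ((inner x z)\<^sup>2) + ennreal ((inner x (e n))\<^sup>2) \<partial>gauss n)"
    by (simp only: nn_integral_std_normal_square) simp
  also have "\<dots> = ennreal ((norm (proj (Suc n) x))\<^sup>2)"
    by (subst nn_integral_add) (auto simp: Suc G.emeasure_space_1 norm_proj sum_nonneg simp flip: ennreal_plus)
  finally show ?case .
qed

lemma nn_integral_gauss_square_le: "(\<integral>\<^sup>+z. ennreal ((inner x z)\<^sup>2) \<partial>gauss n) \<le> ennreal ((norm x)\<^sup>2)"
  unfolding nn_integral_gauss_square by (intro ennreal_leI power_mono norm_proj_le) simp

lemma nn_integral_gauss_abs_le: "(\<integral>\<^sup>+z. ennreal \<bar>inner x z\<bar> \<partial>gauss n) \<le> ennreal (norm x)"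
proof (cases "x = 0")
  case False
  interpret G: prob_space "gauss n" by (rule prob_space_gauss)
  define a where "a = norm x"
  have a: "a > 0" using False by (simp add: a_def)
  have "(\<integral>\<^sup>+z. ennreal \<bar>inner x z\<bar> \<partial>gauss n)
      \<le> (\<integral>\<^sup>+z. ennreal (a / 2) + ennreal (1 / (2 * a)) * ennreal ((inner x z)\<^sup>2) \<partial>gauss n)"
  proof (intro nn_integral_mono)
    fix z
    have "0 \<le> (\<bar>inner x z\<bar> - a)\<^sup>2" by simp
    then have "2 * a * \<bar>inner x z\<bar> \<le> a * a + (inner x z)\<^sup>2" by (simp add: power2_eq_square algebra_simps)
    then have "\<bar>inner x z\<bar> \<le> a / 2 + 1 / (2 * a) * (inner x z)\<^sup>2"
      using a by (simp add: field_simps)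
    then show "ennreal \<bar>inner x z\<bar> \<le> ennreal (a / 2) + ennreal (1 / (2 * a)) * ennreal ((inner x z)\<^sup>2)"
      using a by (simp flip: ennreal_plus ennreal_mult)
  qed
  also have "\<dots> = ennreal (a / 2) + ennreal (1 / (2 * a)) * (\<integral>\<^sup>+z. ennreal ((inner x z)\<^sup>2) \<partial>gauss n)"
    by (subst nn_integral_add) (auto simp: nn_integral_cmult G.emeasure_space_1)
  also have "\<dots> \<le> ennreal (a / 2) + ennreal (1 / (2 * a)) * ennreal (a\<^sup>2)"
    unfolding a_def by (intro add_left_mono mult_left_mono nn_integral_gauss_square_le) auto
  also have "\<dots> = ennreal a"
    using a by (simp add: power2_eq_square field_simps flip: ennreal_plus ennreal_mult)
  finally show ?thesis by (simp add: a_def)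
qed simp

end

definition psd :: "('h::real_inner \<Rightarrow> 'h) \<Rightarrow> bool" where
  "psd S \<longleftrightarrow> linear S \<and> (\<forall>x y. inner (S x) y = inner x (S y)) \<and> (\<forall>x. 0 \<le> inner x (S x))"

lemma psd_Cauchy_Schwarz:
  assumes "psd S" shows "(inner x (S y))\<^sup>2 \<le> inner x (S x) * inner y (S y)"
proof -
  interpret linear S using assms by (simp add: psd_def)
  have sym: "inner (S x) y = inner x (S y)" for x y using assms by (simp add: psd_def)
  have nn: "0 \<le> inner x (S x)" for x using assms by (simp add: psd_def)
  have q: "0 \<le> inner x (S x) + 2 * t * inner x (S y) + t * t * inner y (S y)" for t
  proof -
    have "inner y (S x) = inner x (S y)" using sym[of y x] by (simp add: inner_commute)
    then show ?thesis using nn[of "x + t *\<^sub>R y"]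
      by (simp add: add scaleR inner_add_left inner_add_right algebra_simps)
  qed
  show ?thesis
  proof (cases "inner y (S y) = 0")
    case True
    have "inner x (S y) = 0"
    proof (rule ccontr)
      assume "inner x (S y) \<noteq> 0"
      then show False using q[of "- (inner x (S x) + 1) / (2 * inner x (S y))"] True by (simp add: field_simps)
    qed
    then show ?thesis using True by simp
  next
    case False
    then have "inner y (S y) > 0" using nn[of y] by simp
    then show ?thesis using q[of "- inner x (S y) / inner y (S y)"]
      by (simp add: power2_eq_square field_simps)
  qed
qed

lemma psd_zero: assumes "psd S" "inner x (S x) = 0" shows "S x = 0"
  using psd_Cauchy_Schwarz[OF assms(1), of "S x" x] assms(2) by simp

definition chol_vec :: "('h::real_inner \<Rightarrow> 'h) \<Rightarrow> 'h \<Rightarrow> 'h" where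
  "chol_vec S x = (1 / sqrt (inner x (S x))) *\<^sub>R S x"

definition chol_step :: "('h::real_inner \<Rightarrow> 'h) \<Rightarrow> 'h \<Rightarrow> 'h \<Rightarrow> 'h" where
  "chol_step S x y = S y - inner (chol_vec S x) y *\<^sub>R chol_vec S x"

lemma chol_step:
  assumes S: "psd S"
  shows "psd (chol_step S x)" "chol_step S x x = 0" "S y = 0 \<Longrightarrow> chol_step S x y = 0"
    "inner y (chol_step S x y) = inner y (S y) - (inner (chol_vec S x) y)\<^sup>2"
proof -
  interpret linear S using S by (simp add: psd_def)
  have sym: "inner (S x) y = inner x (S y)" for x y using S by (simp add: psd_def)
  have nn: "0 \<le> inner x (S x)" for x using S by (simp add: psd_def)
  show q: "inner y (chol_step S x y) = inner y (S y) - (inner (chol_vec S x) y)\<^sup>2" for y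
    by (simp add: chol_step_def inner_diff_right power2_eq_square inner_commute)
  have "0 \<le> inner y (chol_step S x y)" for y
  proof (cases "inner x (S x) = 0")
    case True
    then show ?thesis unfolding q using nn[of y] by (simp add: chol_vec_def)
  next
    case False
    then have p: "inner x (S x) > 0" using nn[of x] by simp
    have "(inner (chol_vec S x) y)\<^sup>2 = (inner x (S y))\<^sup>2 / inner x (S x)"
      using p by (simp add: chol_vec_def power_divide sym)
    also have "\<dots> \<le> inner y (S y)"
      using psd_Cauchy_Schwarz[OF S, of x y] p by (simp add: field_simps)
    finally show ?thesis unfolding q by simp
  qed
  moreover have "linear (chol_step S x)"
    unfolding chol_step_def by (intro linearI) (simp_all add: add scaleR inner_add_right algebra_simps)
  moreover have "inner (chol_step S x a) b = inner a (chol_step S x b)" for a b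
    by (simp add: chol_step_def inner_diff_left inner_diff_right sym inner_commute[of a "chol_vec S x"])
  ultimately show "psd (chol_step S x)" by (simp add: psd_def)
  show "chol_step S x x = 0"
  proof (cases "inner x (S x) = 0")
    case True
    then show ?thesis using psd_zero[OF S, of x] by (simp add: chol_step_def chol_vec_def)
  next
    case False
    then have p: "inner x (S x) > 0" using nn[of x] by simp
    have "inner (chol_vec S x) x *\<^sub>R chol_vec S x = (inner x (S x) / (sqrt (inner x (S x)) * sqrt (inner x (S x)))) *\<^sub>R S x"
      by (simp add: chol_vec_def sym)
    also have "\<dots> = S x" using p by simp
    finally show ?thesis by (simp add: chol_step_def)
  qed
  assume "S y = 0"
  moreover have "inner (chol_vec S x) y = (1 / sqrt (inner x (S x))) * inner x (S y)"
    by (simp add: chol_vec_def sym)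
  ultimately show "chol_step S x y = 0" by (simp add: chol_step_def)
qed

context onb_seq
begin

text \<open>Gaussian elimination along the basis: an infinite Cholesky factorisation replaces the
  spectral theorem for the covariance operator.\<close>

primrec chol :: "('h \<Rightarrow> 'h) \<Rightarrow> nat \<Rightarrow> 'h \<Rightarrow> 'h" where
  "chol S 0 = S"
| "chol S (Suc n) = chol_step (chol S n) (e n)"

lemma cholesky:
  fixes R :: "'h \<Rightarrow>\<^sub>L 'h"
  assumes sym: "\<And>x y. inner (R x) y = inner x (R y)" and nonneg: "\<And>x. 0 \<le> inner x (R x)"
    and tr: "summable (\<lambda>i. inner (e i) (R (e i)))"
  shows "\<exists>v::nat \<Rightarrow> 'h. (\<forall>u. (\<lambda>m. (inner (v m) u)\<^sup>2) sums inner u (R u)) \<and> summable (\<lambda>m. (norm (v m))\<^sup>2)"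
proof -
  let ?S = "chol (blinfun_apply R)"
  define v where "v n = chol_vec (?S n) (e n)" for n
  have psd: "psd (?S n)" for n
  proof (induction n)
    case 0
    show ?case using sym nonneg bounded_linear.linear[OF blinfun.bounded_linear_right] by (auto simp: psd_def)
  qed (simp add: chol_step)
  have kill: "i < n \<Longrightarrow> ?S n (e i) = 0" for i n
    by (induction n) (auto simp: less_Suc_eq chol_step(2,3)[OF psd])
  have dec: "inner u (R u) = inner u (?S n u) + (\<Sum>m<n. (inner (v m) u)\<^sup>2)" for n u
    by (induction n) (auto simp: chol_step(4)[OF psd] v_def)
  have le: "inner u (?S n u) \<le> norm R * (norm u)\<^sup>2" for n u
  proof -
    have "inner u (?S n u) \<le> inner u (R u)" unfolding dec[of u n] by (simp add: sum_nonneg)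
    also have "\<dots> \<le> norm u * norm (R u)" by (rule norm_cauchy_schwarz)
    also have "\<dots> \<le> norm u * (norm R * norm u)" by (intro mult_left_mono norm_blinfun) auto
    finally show ?thesis by (simp add: power2_eq_square mult_ac)
  qed
  have S0: "(\<lambda>n. inner u (?S n u)) \<longlonglongrightarrow> 0" for u
  proof (rule tendsto_sandwich[OF _ _ tendsto_const])
    show "\<forall>\<^sub>F n in sequentially. 0 \<le> inner u (?S n u)" using psd by (auto simp: psd_def)
    show "\<forall>\<^sub>F n in sequentially. inner u (?S n u) \<le> norm R * (norm (u - proj n u))\<^sup>2"
    proof (intro always_eventually allI)
      fix n
      interpret linear "?S n" using psd[of n] by (simp add: psd_def)
      have sn: "inner (?S n x) y = inner x (?S n y)" for x y using psd[of n] by (simp add: psd_def)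
      have z: "?S n (proj n u) = 0" unfolding proj_def by (simp add: sum scale kill)
      then have "inner u (?S n u) = inner u (?S n (u - proj n u))" by (simp add: diff)
      also have "\<dots> = inner (u - proj n u) (?S n (u - proj n u))"
        using sn[of "proj n u" "u - proj n u"] z by (simp add: inner_diff_left)
      finally show "inner u (?S n u) \<le> norm R * (norm (u - proj n u))\<^sup>2" using le[of "u - proj n u" n] by simp
    qed
    have "(\<lambda>n. norm R * (norm (u - proj n u))\<^sup>2) \<longlonglongrightarrow> norm R * (norm (u - u))\<^sup>2"
      by (intro tendsto_intros proj_tendsto)
    then show "(\<lambda>n. norm R * (norm (u - proj n u))\<^sup>2) \<longlonglongrightarrow> 0" by simp
  qed
  have "(\<lambda>m. (inner (v m) u)\<^sup>2) sums inner u (R u)" for u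
  proof -
    have "(\<lambda>n. inner u (R u) - inner u (?S n u)) \<longlonglongrightarrow> inner u (R u) - 0"
      by (intro tendsto_intros S0)
    moreover have "(\<lambda>n. inner u (R u) - inner u (?S n u)) = (\<lambda>n. \<Sum>m<n. (inner (v m) u)\<^sup>2)"
    proof
      show "inner u (R u) - inner u (?S n u) = (\<Sum>m<n. (inner (v m) u)\<^sup>2)" for n
        using dec[of u n] by linarith
    qed
    ultimately show ?thesis unfolding sums_def by (simp only: diff_zero)
  qed
  moreover have "summable (\<lambda>m. (norm (v m))\<^sup>2)"
  proof (rule summableI_nonneg_bounded)
    fix N
    have 1: "(\<lambda>i. \<Sum>m<N. (inner (v m) (e i))\<^sup>2) sums (\<Sum>m<N. (norm (v m))\<^sup>2)"
      by (intro sums_sum parseval)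
    have 2: "(\<Sum>m<N. (inner (v m) (e i))\<^sup>2) \<le> inner (e i) (R (e i))" for i
    proof -
      have "0 \<le> inner (e i) (?S N (e i))" using psd[of N] unfolding psd_def by blast
      then show ?thesis using dec[of "e i" N] by linarith
    qed
    show "(\<Sum>m<N. (norm (v m))\<^sup>2) \<le> (\<Sum>i. inner (e i) (R (e i)))"
      by (rule sums_le[OF 2 1 summable_sums[OF tr]])
  qed simp
  ultimately show ?thesis by blast
qed

end

lemma trace_class_factorisation:
  fixes R :: "'h::{real_inner,complete_space,second_countable_topology} \<Rightarrow>\<^sub>L 'h"
  assumes R: "sym_nonneg_trace_class R"
  obtains e v :: "nat \<Rightarrow> 'h" where "onb_seq e" "\<And>u. (\<lambda>m. (inner (v m) u)\<^sup>2) sums inner u (R u)" "summable (\<lambda>m. (norm (v m))\<^sup>2)"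
proof -
  obtain E where E: "orthonormal_basis E" "(\<lambda>e. inner (R e) e) summable_on E"
    using R unfolding sym_nonneg_trace_class_def by blast
  obtain e where e: "onb_seq e" "\<And>i. e i \<in> insert 0 E" "\<And>i j. e i = e j \<Longrightarrow> e i \<noteq> 0 \<Longrightarrow> i = j"
    using orthonormal_basis_seq[OF E(1)] by blast
  interpret onb_seq e by fact
  have sym: "inner (R x) y = inner x (R y)" and nn: "0 \<le> inner x (R x)" for x y
    using R unfolding sym_nonneg_trace_class_def by (auto simp: inner_commute)
  have "summable (\<lambda>i. inner (e i) (R (e i)))"
  proof (rule summableI_nonneg_bounded)
    fix n
    let ?I = "{i\<in>{..<n}. e i \<noteq> 0}"
    have inj: "inj_on e ?I" using e(3) by (auto simp: inj_on_def)
    have "(\<Sum>i<n. inner (e i) (R (e i))) = (\<Sum>i\<in>?I. inner (e i) (R (e i)))"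
      by (intro sum.mono_neutral_right) auto
    also have "\<dots> = (\<Sum>x\<in>e ` ?I. inner (R x) x)"
      by (subst sum.reindex[OF inj]) (simp add: inner_commute)
    also have "\<dots> \<le> infsum (\<lambda>e. inner (R e) e) E"
      using e(2) nn by (intro finite_sum_le_infsum E) (auto simp: inner_commute)
    finally show "(\<Sum>i<n. inner (e i) (R (e i))) \<le> infsum (\<lambda>e. inner (R e) e) E" .
  qed (rule nn)
  from cholesky[OF sym nn this] obtain v where
    "\<And>u. (\<lambda>m. (inner (v m) u)\<^sup>2) sums inner u (R u)" "summable (\<lambda>m::nat. (norm (v m))\<^sup>2)" by blast
  then show ?thesis by (rule that[OF e(1)])
qed

section \<open>The Levy symbol\<close>

lemma tendsto_cis_real: "(f \<longlongrightarrow> a) F \<Longrightarrow> ((\<lambda>x. cis (f x)) \<longlongrightarrow> cis a) F"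
  unfolding cis_conv_exp by (intro tendsto_intros)

lemma cis_sum: "cis (\<Sum>k\<in>K. x k) = (\<Prod>k\<in>K. cis (x k))"
  by (induction K rule: infinite_finite_induct) (auto simp: cis_mult[symmetric])

lemma norm_cis_minus_1_le: "norm (cis y - 1) \<le> \<bar>y\<bar>"
  using iexp_approx1[of y 0] by (simp add: cis_conv_exp)

lemma norm_cis_minus_1_minus_le: "norm (cis y - 1 - \<i> * complex_of_real y) \<le> y\<^sup>2"
proof -
  have "norm (cis y - 1 - \<i> * complex_of_real y) \<le> \<bar>y\<bar>\<^sup>2 / 2"
    using iexp_approx1[of y 1] by (simp add: cis_conv_exp algebra_simps power2_eq_square)
  also have "\<dots> \<le> y\<^sup>2" by simp
  finally show ?thesis .
qed

locale levy_triplet = onb_seq e for e :: "nat \<Rightarrow> 'h::{real_inner,complete_space,second_countable_topology}" +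
  fixes b :: 'h and R :: "'h \<Rightarrow>\<^sub>L 'h" and M :: "'h measure" and v :: "nat \<Rightarrow> 'h"
  assumes R_v: "\<And>u. (\<lambda>m. (inner (v m) u)\<^sup>2) sums inner u (R u)"
    and v_summable: "summable (\<lambda>m. (norm (v m))\<^sup>2)"
    and levy_M: "levy_measure M"
    and moment: "(\<integral>\<^sup>+x\<in>{x. norm x > 1}. ennreal (norm x) \<partial>M) < \<infinity>"
begin

abbreviation trunc :: "'h \<Rightarrow> real \<Rightarrow> real" where
  "trunc x a \<equiv> if norm x \<le> 1 then a\<^sup>2 else a"

abbreviation lint :: "real set \<Rightarrow> (real \<Rightarrow> 'h \<Rightarrow>\<^sub>L 'h) \<Rightarrow> 'h \<Rightarrow> complex" where
  "lint S G u \<equiv> (\<integral>r\<in>S. levy_symbol b R M (adj (G r) u) \<partial>lborel)"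

abbreviation lam :: "'h \<Rightarrow> complex" where "lam \<equiv> levy_symbol b R M"

lemma sets_M [measurable_cong, simp]: "sets M = sets borel"
  using levy_M by (simp add: levy_measure_def)

lemma space_M [simp]: "space M = UNIV"
  using sets_eq_imp_space_eq[OF sets_M] by simp

lemma moment_M: "(\<integral>\<^sup>+x. ennreal (trunc x (norm x)) \<partial>M) < \<infinity>"
proof -
  have "(\<integral>\<^sup>+x. ennreal (trunc x (norm x)) \<partial>M)
      \<le> (\<integral>\<^sup>+x. ennreal (min 1 ((norm x)\<^sup>2)) + ennreal (norm x) * indicator {x. norm x > 1} x \<partial>M)"
    by (intro nn_integral_mono) (auto simp: indicator_def power_le_one min_def)
  also have "\<dots> = (\<integral>\<^sup>+x. ennreal (min 1 ((norm x)\<^sup>2)) \<partial>M) + (\<integral>\<^sup>+x\<in>{x. norm x > 1}. ennreal (norm x) \<partial>M)"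
    by (rule nn_integral_add) measurable
  also have "\<dots> < \<infinity>" using levy_M moment by (auto simp: levy_measure_def)
  finally show ?thesis .
qed

sublocale M: sigma_finite_measure M
proof
  define A where "A n = (if n = 0 then {0} else {x::'h. 1 / real n \<le> norm x})" for n
  have "closed (A n)" for n unfolding A_def by (auto intro!: closed_Collect_le continuous_intros)
  then have A: "A n \<in> sets M" for n by simp
  have fin: "emeasure M (A n) \<noteq> \<infinity>" for n
  proof (cases "n = 0")
    case True
    then show ?thesis using levy_M by (simp add: A_def levy_measure_def)
  next
    case False
    let ?c = "ennreal (1 / (real n)\<^sup>2)"
    have "?c * emeasure M (A n) = (\<integral>\<^sup>+x. ?c * indicator (A n) x \<partial>M)"
      using A by (subst nn_integral_cmult_indicator) auto
    also have "\<dots> \<le> (\<integral>\<^sup>+x. ennreal (min 1 ((norm x)\<^sup>2)) \<partial>M)"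
    proof (intro nn_integral_mono)
      fix x :: 'h
      have "1 / (real n)\<^sup>2 \<le> 1" using False by simp
      moreover have "1 / (real n)\<^sup>2 \<le> (norm x)\<^sup>2" if "1 / real n \<le> norm x"
        using power_mono[OF that, of 2] by (simp add: power_divide)
      ultimately show "?c * indicator (A n) x \<le> ennreal (min 1 ((norm x)\<^sup>2))"
        using False by (auto simp: indicator_def A_def intro!: ennreal_leI)
    qed
    also have "\<dots> < \<infinity>" using levy_M by (auto simp: levy_measure_def)
    finally have "?c * emeasure M (A n) \<noteq> \<infinity>" by auto
    then show ?thesis using False by (auto simp: ennreal_mult_eq_top_iff)
  qed
  have "(\<Union>n. A n) = UNIV"
  proof (intro set_eqI iffI UNIV_I)
    fix x :: 'h
    show "x \<in> (\<Union>n. A n)"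
    proof (cases "x = 0")
      case True
      then show ?thesis by (intro UN_I[of 0]) (auto simp: A_def)
    next
      case False
      then obtain n where "inverse (real (Suc n)) < norm x" using reals_Archimedean[of "norm x"] by auto
      then show ?thesis by (intro UN_I[of "Suc n"]) (auto simp: A_def inverse_eq_divide)
    qed
  qed
  then show "\<exists>A. countable A \<and> A \<subseteq> sets M \<and> \<Union>A = space M \<and> (\<forall>a\<in>A. emeasure M a \<noteq> \<infinity>)"
    using A fin by (intro exI[of _ "range A"]) auto
qed

lemma trunc_le:
  assumes g: "0 \<le> g" and a: "0 \<le> a" "a \<le> g * norm x"
  shows "trunc x a \<le> (g + g\<^sup>2) * trunc x (norm x)"
proof -
  have "a\<^sup>2 \<le> g\<^sup>2 * (norm x)\<^sup>2" using power_mono[OF a(2,1), of 2] by (simp add: power_mult_distrib)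
  moreover have "g\<^sup>2 * (norm x)\<^sup>2 \<le> (g + g\<^sup>2) * (norm x)\<^sup>2" "g * norm x \<le> (g + g\<^sup>2) * norm x"
    using g by (auto intro!: mult_right_mono)
  ultimately show ?thesis using a(2) by auto
qed

text \<open>\<open>dom p\<close> majorises the symbol when \<open>p x\<close> is the absolute value of the inner product of \<open>x\<close> and \<open>u\<close>; for
  \<open>p x = norm (G x)\<close> it tends to zero as soon as \<open>G\<close> does so strongly and boundedly. Operator
  norm convergence, which is not available here, is never needed.\<close>

definition dom :: "('h \<Rightarrow> real) \<Rightarrow> ennreal" where
  "dom p = ennreal (p b) + (\<integral>\<^sup>+m. ennreal ((p (v m))\<^sup>2) \<partial>count_space UNIV)
     + (\<integral>\<^sup>+x. ennreal (trunc x (p x)) \<partial>M)"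

definition mom :: real where
  "mom = enn2real (\<integral>\<^sup>+x. ennreal (trunc x (norm x)) \<partial>M)"

definition C :: real where "C = norm b + (\<Sum>m. (norm (v m))\<^sup>2) + mom"

lemma C_nonneg: "0 \<le> C"
  unfolding C_def mom_def by (intro add_nonneg_nonneg suminf_nonneg v_summable) auto

lemma nn_integral_v: "(\<integral>\<^sup>+m. ennreal ((norm (v m))\<^sup>2) \<partial>count_space UNIV) = ennreal (\<Sum>m. (norm (v m))\<^sup>2)"
  unfolding nn_integral_count_space_nat by (rule suminf_ennreal2[OF _ v_summable]) simp

lemma dom_le:
  assumes p: "\<And>x. 0 \<le> p x" "\<And>x. p x \<le> g * norm x" and g: "0 \<le> g"
  shows "dom p \<le> ennreal (C * (g + g\<^sup>2))"
proof -
  have p2: "(p x)\<^sup>2 \<le> g\<^sup>2 * (norm x)\<^sup>2" for x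
    using power_mono[OF p(2) p(1), of x 2] by (simp add: power_mult_distrib)
  have 1: "ennreal (p b) \<le> ennreal (norm b * (g + g\<^sup>2))"
  proof (intro ennreal_leI)
    have "g * norm b \<le> norm b * (g + g\<^sup>2)" using mult_left_mono[of g "g + g\<^sup>2" "norm b"] by (simp add: mult.commute)
    then show "p b \<le> norm b * (g + g\<^sup>2)" using p(2)[of b] by linarith
  qed
  have "(\<integral>\<^sup>+m. ennreal ((p (v m))\<^sup>2) \<partial>count_space UNIV) \<le> (\<integral>\<^sup>+m. ennreal (g + g\<^sup>2) * ennreal ((norm (v m))\<^sup>2) \<partial>count_space UNIV)"
  proof (intro nn_integral_mono)
    fix m
    have "g\<^sup>2 * (norm (v m))\<^sup>2 \<le> (g + g\<^sup>2) * (norm (v m))\<^sup>2" using g by (intro mult_right_mono) auto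
    then show "ennreal ((p (v m))\<^sup>2) \<le> ennreal (g + g\<^sup>2) * ennreal ((norm (v m))\<^sup>2)"
      using p2[of "v m"] g by (subst ennreal_mult[symmetric]) (auto intro!: ennreal_leI)
  qed
  also have "\<dots> = ennreal (g + g\<^sup>2) * ennreal (\<Sum>m. (norm (v m))\<^sup>2)"
    by (subst nn_integral_cmult) (auto simp: nn_integral_v)
  finally have 2: "(\<integral>\<^sup>+m. ennreal ((p (v m))\<^sup>2) \<partial>count_space UNIV) \<le> ennreal ((\<Sum>m. (norm (v m))\<^sup>2) * (g + g\<^sup>2))"
    using g by (subst (asm) ennreal_mult[symmetric]) (auto simp: mult.commute suminf_nonneg[OF v_summable])
  have "(\<integral>\<^sup>+x. ennreal (trunc x (p x)) \<partial>M)
      \<le> (\<integral>\<^sup>+x. ennreal (g + g\<^sup>2) * ennreal (trunc x (norm x)) \<partial>M)"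
  proof (intro nn_integral_mono)
    fix x :: 'h
    from trunc_le[OF g p]
    show "ennreal (trunc x (p x)) \<le> ennreal (g + g\<^sup>2) * ennreal (trunc x (norm x))"
      using g by (subst ennreal_mult[symmetric]) (auto intro!: ennreal_leI)
  qed
  also have "\<dots> = ennreal (g + g\<^sup>2) * ennreal mom"
    using moment_M by (subst nn_integral_cmult) (auto simp: mom_def)
  finally have 3: "(\<integral>\<^sup>+x. ennreal (trunc x (p x)) \<partial>M) \<le> ennreal (mom * (g + g\<^sup>2))"
    using g by (subst (asm) ennreal_mult[symmetric]) (auto simp: mult.commute mom_def)
  have "dom p \<le> ennreal (norm b * (g + g\<^sup>2)) + ennreal ((\<Sum>m. (norm (v m))\<^sup>2) * (g + g\<^sup>2)) + ennreal (mom * (g + g\<^sup>2))"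
    unfolding dom_def by (intro add_mono 1 2 3)
  also have "\<dots> = ennreal (C * (g + g\<^sup>2))"
    using g by (simp add: C_def mom_def distrib_right suminf_nonneg[OF v_summable] flip: ennreal_plus)
  finally show ?thesis .
qed

lemma dom_tendsto:
  assumes m: "\<And>j. p j \<in> borel_measurable borel" and p: "\<And>j x. 0 \<le> p j x" "\<And>j x. p j x \<le> g * norm x" and g: "0 \<le> g"
    and lim: "\<And>x. (\<lambda>j. p j x) \<longlonglongrightarrow> 0"
  shows "(\<lambda>j. dom (p j)) \<longlonglongrightarrow> 0"
proof -
  note [measurable] = m
  have p2: "(p j x)\<^sup>2 \<le> g\<^sup>2 * (norm x)\<^sup>2" for x j
    using power_mono[OF p(2) p(1), of j x 2] by (simp add: power_mult_distrib)
  have l1: "(\<lambda>j. ennreal (p j b)) \<longlonglongrightarrow> 0" using tendsto_ennrealI[OF lim[of b]] by simp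
  have lim2: "(\<lambda>j. (p j x)\<^sup>2) \<longlonglongrightarrow> 0" for x using tendsto_power[OF lim[of x], of 2] by simp
  have "(\<lambda>j. \<integral>\<^sup>+m. ennreal ((p j (v m))\<^sup>2) \<partial>count_space UNIV) \<longlonglongrightarrow> (\<integral>\<^sup>+(m::nat). 0 \<partial>count_space UNIV)"
  proof (rule nn_integral_dominated_convergence[where w="\<lambda>m. ennreal (g\<^sup>2) * ennreal ((norm (v m))\<^sup>2)"])
    show "(\<integral>\<^sup>+m. ennreal (g\<^sup>2) * ennreal ((norm (v m))\<^sup>2) \<partial>count_space UNIV) < \<infinity>"
      by (subst nn_integral_cmult) (auto simp: nn_integral_v ennreal_mult_less_top)
    show "AE m in count_space UNIV. (\<lambda>j. ennreal ((p j (v m))\<^sup>2)) \<longlonglongrightarrow> 0"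
      using tendsto_ennrealI[OF lim2] by simp
    show "AE m in count_space UNIV. ennreal ((p j (v m))\<^sup>2) \<le> ennreal (g\<^sup>2) * ennreal ((norm (v m))\<^sup>2)" for j
      using p2 by (auto simp: intro!: AE_I2 ennreal_leI simp flip: ennreal_mult)
  qed simp_all
  then have l2: "(\<lambda>j. \<integral>\<^sup>+m. ennreal ((p j (v m))\<^sup>2) \<partial>count_space UNIV) \<longlonglongrightarrow> 0" by simp
  have "(\<lambda>j. \<integral>\<^sup>+x. ennreal (trunc x (p j x)) \<partial>M) \<longlonglongrightarrow> (\<integral>\<^sup>+x. 0 \<partial>M)"
  proof (rule nn_integral_dominated_convergence[where w="\<lambda>x. ennreal (g + g\<^sup>2) * ennreal (trunc x (norm x))"])
    show "(\<integral>\<^sup>+x. ennreal (g + g\<^sup>2) * ennreal (trunc x (norm x)) \<partial>M) < \<infinity>"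
      using moment_M by (subst nn_integral_cmult) (auto simp: ennreal_mult_less_top)
    show "AE x in M. (\<lambda>j. ennreal (trunc x (p j x))) \<longlonglongrightarrow> 0"
    proof (intro AE_I2)
      fix x :: 'h show "(\<lambda>j. ennreal (trunc x (p j x))) \<longlonglongrightarrow> 0"
        using tendsto_ennrealI[OF lim2[of x]] tendsto_ennrealI[OF lim[of x]] by (cases "norm x \<le> 1") auto
    qed
    show "AE x in M. ennreal (trunc x (p j x)) \<le> ennreal (g + g\<^sup>2) * ennreal (trunc x (norm x))" for j
    proof (intro AE_I2)
      fix x :: 'h
      from trunc_le[OF g p]
      show "ennreal (trunc x (p j x)) \<le> ennreal (g + g\<^sup>2) * ennreal (trunc x (norm x))"
        using g by (subst ennreal_mult[symmetric]) (auto intro!: ennreal_leI)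
    qed
  qed measurable
  then have l3: "(\<lambda>j. \<integral>\<^sup>+x. ennreal (trunc x (p j x)) \<partial>M) \<longlonglongrightarrow> 0" by simp
  show ?thesis unfolding dom_def using tendsto_add[OF tendsto_add[OF l1 l2] l3] by simp
qed

lemma dom_inner_measurable:
  fixes G :: "'h \<Rightarrow> 'h"
  assumes [measurable]: "G \<in> borel_measurable borel"
  shows "(\<lambda>z. dom (\<lambda>x. \<bar>inner (G x) z\<bar>)) \<in> borel_measurable borel"
proof -
  have [measurable]: "(\<lambda>z. \<integral>\<^sup>+x. ennreal (trunc x \<bar>inner (G x) z\<bar>) \<partial>M) \<in> borel_measurable borel"
    by (rule M.borel_measurable_nn_integral) measurable
  show ?thesis unfolding dom_def nn_integral_count_space_nat by measurable
qed

lemma dom_gauss_le: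
  assumes [measurable]: "G \<in> borel_measurable borel"
  shows "(\<integral>\<^sup>+z. dom (\<lambda>x. \<bar>inner (G x) z\<bar>) \<partial>gauss n) \<le> dom (\<lambda>x. norm (G x))"
proof -
  interpret G: prob_space "gauss n" by (rule prob_space_gauss)
  interpret GM: pair_sigma_finite M "gauss n" ..
  have s: "(\<integral>\<^sup>+m. ennreal ((inner (G (v m)) z)\<^sup>2) \<partial>count_space UNIV) = (\<Sum>m. ennreal ((inner (G (v m)) z)\<^sup>2))" for z
    by (simp add: nn_integral_count_space_nat)
  define f1 where "f1 z = ennreal \<bar>inner (G b) z\<bar>" for z
  define f2 where "f2 z = (\<Sum>m. ennreal ((inner (G (v m)) z)\<^sup>2))" for z
  define f3 where "f3 z = (\<integral>\<^sup>+x. ennreal (if norm x \<le> 1 then (inner (G x) z)\<^sup>2 else \<bar>inner (G x) z\<bar>) \<partial>M)" for z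
  have m1 [measurable]: "f1 \<in> borel_measurable (gauss n)" unfolding f1_def by measurable
  have m2 [measurable]: "f2 \<in> borel_measurable (gauss n)" unfolding f2_def by measurable
  have m3 [measurable]: "f3 \<in> borel_measurable (gauss n)" unfolding f3_def
    by (rule M.borel_measurable_nn_integral) measurable
  have "dom (\<lambda>x. \<bar>inner (G x) z\<bar>) = (f1 z + f2 z) + f3 z" for z
    unfolding dom_def f1_def f2_def f3_def power2_abs s by (rule refl)
  then have "(\<integral>\<^sup>+z. dom (\<lambda>x. \<bar>inner (G x) z\<bar>) \<partial>gauss n) = (\<integral>\<^sup>+z. (f1 z + f2 z) + f3 z \<partial>gauss n)" by simp
  also have "\<dots> = (\<integral>\<^sup>+z. f1 z + f2 z \<partial>gauss n) + (\<integral>\<^sup>+z. f3 z \<partial>gauss n)"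
    by (rule nn_integral_add) measurable
  also have "(\<integral>\<^sup>+z. f1 z + f2 z \<partial>gauss n) = (\<integral>\<^sup>+z. f1 z \<partial>gauss n) + (\<integral>\<^sup>+z. f2 z \<partial>gauss n)"
    by (rule nn_integral_add) measurable
  finally have "(\<integral>\<^sup>+z. dom (\<lambda>x. \<bar>inner (G x) z\<bar>) \<partial>gauss n)
     = (\<integral>\<^sup>+z. ennreal \<bar>inner (G b) z\<bar> \<partial>gauss n) + (\<integral>\<^sup>+z. (\<Sum>m. ennreal ((inner (G (v m)) z)\<^sup>2)) \<partial>gauss n)
     + (\<integral>\<^sup>+z. (\<integral>\<^sup>+x. ennreal (if norm x \<le> 1 then (inner (G x) z)\<^sup>2 else \<bar>inner (G x) z\<bar>) \<partial>M) \<partial>gauss n)"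
    by (simp only: f1_def f2_def f3_def)
  also have "(\<integral>\<^sup>+z. (\<Sum>m. ennreal ((inner (G (v m)) z)\<^sup>2)) \<partial>gauss n) = (\<Sum>m. \<integral>\<^sup>+z. ennreal ((inner (G (v m)) z)\<^sup>2) \<partial>gauss n)"
    by (rule nn_integral_suminf) measurable
  also have "(\<integral>\<^sup>+z. (\<integral>\<^sup>+x. ennreal (if norm x \<le> 1 then (inner (G x) z)\<^sup>2 else \<bar>inner (G x) z\<bar>) \<partial>M) \<partial>gauss n)
      = (\<integral>\<^sup>+x. (\<integral>\<^sup>+z. ennreal (if norm x \<le> 1 then (inner (G x) z)\<^sup>2 else \<bar>inner (G x) z\<bar>) \<partial>gauss n) \<partial>M)"
    by (rule GM.Fubini') measurable
  also have "(\<integral>\<^sup>+z. ennreal \<bar>inner (G b) z\<bar> \<partial>gauss n) + (\<Sum>m. \<integral>\<^sup>+z. ennreal ((inner (G (v m)) z)\<^sup>2) \<partial>gauss n)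
     + (\<integral>\<^sup>+x. (\<integral>\<^sup>+z. ennreal (if norm x \<le> 1 then (inner (G x) z)\<^sup>2 else \<bar>inner (G x) z\<bar>) \<partial>gauss n) \<partial>M) \<le> dom (\<lambda>x. norm (G x))"
    unfolding dom_def nn_integral_count_space_nat
  proof (intro add_mono suminf_le summableI nn_integral_mono nn_integral_gauss_abs_le nn_integral_gauss_square_le)
    fix x :: 'h
    show "(\<integral>\<^sup>+z. ennreal (if norm x \<le> 1 then (inner (G x) z)\<^sup>2 else \<bar>inner (G x) z\<bar>) \<partial>gauss n)
        \<le> ennreal (if norm x \<le> 1 then (norm (G x))\<^sup>2 else norm (G x))"
      using nn_integral_gauss_abs_le nn_integral_gauss_square_le by (cases "norm x \<le> 1") simp_all
  qed
  finally show ?thesis .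
qed

definition kern :: "'h \<Rightarrow> 'h \<Rightarrow> complex" where
  "kern u x = cis (inner u x) - 1 - \<i> * complex_of_real (inner u x) * (if norm x \<le> 1 then 1 else 0)"

lemma kern_measurable [measurable]: "kern u \<in> borel_measurable borel"
  unfolding kern_def by measurable

lemma norm_kern_le: "norm (kern u x) \<le> (if norm x \<le> 1 then (inner x u)\<^sup>2 else \<bar>inner x u\<bar>)"
  unfolding kern_def using norm_cis_minus_1_minus_le[of "inner u x"] norm_cis_minus_1_le[of "inner u x"]
  by (auto simp: inner_commute)

lemma abs_inner_le: "\<bar>inner x u\<bar> \<le> norm u * norm x" for x u :: 'h
  using Cauchy_Schwarz_ineq2[of x u] by (simp add: mult.commute)

lemma norm_kern_le': "norm u \<le> K \<Longrightarrow> norm (kern u x) \<le> (K + K\<^sup>2) * (trunc x (norm x))"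
proof -
  assume K: "norm u \<le> K"
  have a: "\<bar>inner x u\<bar> \<le> K * norm x" using abs_inner_le[of x u] mult_right_mono[OF K, of "norm x"] by simp
  have "0 \<le> K" using K norm_ge_zero[of u] by linarith
  from trunc_le[OF this abs_ge_zero a] show ?thesis using norm_kern_le[of u x] by (simp split: if_splits)
qed

lemma integrable_moment: "integrable M (\<lambda>x. trunc x (norm x))"
proof (rule integrableI_bounded)
  have "(\<integral>\<^sup>+x. ennreal (norm (trunc x (norm x))) \<partial>M)
     = (\<integral>\<^sup>+x. ennreal (trunc x (norm x)) \<partial>M)"
    by (intro nn_integral_cong) auto
  then show "(\<integral>\<^sup>+x. ennreal (norm (trunc x (norm x))) \<partial>M) < \<infinity>" using moment_M by simp
qed measurable

lemma integrable_kern: "integrable M (kern u)"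
  by (rule Bochner_Integration.integrable_bound[OF integrable_mult_right[OF integrable_moment, of "norm u + (norm u)\<^sup>2"]])
     (use norm_kern_le'[OF order_refl, of u] in \<open>auto intro!: AE_I2 intro: order_trans[OF _ abs_ge_self]\<close>)

lemma lam_eq: "lam u = \<i> * complex_of_real (inner b u) - complex_of_real (inner u (R u) / 2) + (\<integral>x. kern u x \<partial>M)"
proof -
  have "(\<integral>x. kern u x \<partial>(restrict_space M (- {0}))) = (\<integral>x. indicator (- {0}) x *\<^sub>R kern u x \<partial>M)"
    by (rule integral_restrict_space) simp
  also have "\<dots> = (\<integral>x. kern u x \<partial>M)"
    by (intro Bochner_Integration.integral_cong) (auto simp: indicator_def kern_def)
  finally show ?thesis by (simp add: levy_symbol_def kern_def)
qed

lemma Re_lam_le: "Re (lam u) \<le> 0"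
proof -
  have "0 \<le> inner u (R u)" using R_v[of u] by (rule sums_le[OF _ sums_zero, rotated]) simp
  moreover have "Re (\<integral>x. kern u x \<partial>M) = (\<integral>x. Re (kern u x) \<partial>M)"
    using integrable_kern by (rule integral_Re[symmetric])
  moreover have "(\<integral>x. Re (kern u x) \<partial>M) \<le> (\<integral>x. 0 \<partial>M)"
  proof (rule integral_mono)
    show "integrable M (\<lambda>x. Re (kern u x))" using integrable_kern by (rule integrable_Re)
    show "Re (kern u x) \<le> 0" for x by (simp add: kern_def)
  qed simp
  ultimately show ?thesis by (simp add: lam_eq)
qed

lemma norm_lam_dom: "ennreal (norm (lam u)) \<le> dom (\<lambda>x. \<bar>inner x u\<bar>)"
proof -
  have R: "(\<integral>\<^sup>+m. ennreal (\<bar>inner (v m) u\<bar>\<^sup>2) \<partial>count_space UNIV) = ennreal (inner u (R u))"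
    unfolding nn_integral_count_space_nat using R_v[of u]
    by (subst suminf_ennreal2) (auto simp: sums_iff)
  have R0: "0 \<le> inner u (R u)" using R_v[of u] by (rule sums_le[OF _ sums_zero, rotated]) simp
  have k: "ennreal (norm (\<integral>x. kern u x \<partial>M)) \<le> (\<integral>\<^sup>+x. ennreal (trunc x \<bar>inner x u\<bar>) \<partial>M)"
    by (rule order_trans[OF integral_norm_bound_ennreal[OF integrable_kern]])
       (intro nn_integral_mono ennreal_leI, unfold power2_abs, rule norm_kern_le)
  have "norm (lam u) \<le> \<bar>inner b u\<bar> + inner u (R u) + norm (\<integral>x. kern u x \<partial>M)"
  proof -
    have "norm (lam u) \<le> norm (\<i> * complex_of_real (inner b u)) + norm (complex_of_real (inner u (R u) / 2)) + norm (\<integral>x. kern u x \<partial>M)"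
      unfolding lam_eq by (rule order_trans[OF norm_triangle_ineq]) (intro add_right_mono norm_triangle_ineq4)
    then show ?thesis using R0 by (simp add: norm_mult del: of_real_divide)
  qed
  then have "ennreal (norm (lam u)) \<le> ennreal \<bar>inner b u\<bar> + ennreal (inner u (R u)) + ennreal (norm (\<integral>x. kern u x \<partial>M))"
    using R0 by (simp flip: ennreal_plus)
  also have "\<dots> \<le> dom (\<lambda>x. \<bar>inner x u\<bar>)"
    unfolding dom_def R by (intro add_mono k order_refl)
  finally show ?thesis .
qed

lemma norm_lam_le: "norm (lam u) \<le> C * (norm u + (norm u)\<^sup>2)"
proof -
  have "ennreal (norm (lam u)) \<le> ennreal (C * (norm u + (norm u)\<^sup>2))"
    using norm_lam_dom[of u] dom_le[of "\<lambda>x. \<bar>inner x u\<bar>" "norm u"] abs_inner_le by fastforce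
  then show ?thesis using C_nonneg by (simp add: ennreal_le_iff)
qed

lemma lam_tendsto:
  assumes w: "\<And>x. (\<lambda>j. inner (w j) x) \<longlonglongrightarrow> inner u x" and K: "\<And>j. norm (w j) \<le> K"
  shows "(\<lambda>j. lam (w j)) \<longlonglongrightarrow> lam u"
proof -
  have 1: "(\<lambda>j. inner b (w j)) \<longlonglongrightarrow> inner b u" using w[of b] by (simp add: inner_commute)
  have RR: "inner u (R u) = (\<Sum>m. (inner (v m) u)\<^sup>2)" for u using R_v[of u] by (simp add: sums_iff)
  have "(\<lambda>j. \<Sum>m. (inner (v m) (w j))\<^sup>2) \<longlonglongrightarrow> (\<Sum>m. (inner (v m) u)\<^sup>2)"
  proof (rule tannerys_theorem[where M="\<lambda>m. K\<^sup>2 * (norm (v m))\<^sup>2", THEN conjunct2, THEN conjunct2])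
    show "(\<lambda>j. (inner (v m) (w j))\<^sup>2) \<longlonglongrightarrow> (inner (v m) u)\<^sup>2" for m
      using w[of "v m"] by (intro tendsto_power) (simp add: inner_commute)
    have "norm ((inner (v m) (w j))\<^sup>2) \<le> K\<^sup>2 * (norm (v m))\<^sup>2" for m j
    proof -
      have "\<bar>inner (v m) (w j)\<bar> \<le> K * norm (v m)"
        using abs_inner_le[of "v m" "w j"] mult_right_mono[OF K[of j], of "norm (v m)"] by simp
      from power_mono[OF this, of 2] show ?thesis by (simp add: power_mult_distrib)
    qed
    then show "\<forall>\<^sub>F (m, j) in at_top \<times>\<^sub>F sequentially. norm ((inner (v m) (w j))\<^sup>2) \<le> K\<^sup>2 * (norm (v m))\<^sup>2"
      by (intro always_eventually) auto
    show "summable (\<lambda>m. K\<^sup>2 * (norm (v m))\<^sup>2)" by (intro summable_mult v_summable)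
  qed simp
  then have 2: "(\<lambda>j. inner (w j) (R (w j))) \<longlonglongrightarrow> inner u (R u)" by (simp only: RR)
  have 3: "(\<lambda>j. \<integral>x. kern (w j) x \<partial>M) \<longlonglongrightarrow> (\<integral>x. kern u x \<partial>M)"
  proof (rule integral_dominated_convergence[where w="\<lambda>x. (K + K\<^sup>2) * (trunc x (norm x))"])
    show "integrable M (\<lambda>x. (K + K\<^sup>2) * (trunc x (norm x)))"
      by (intro integrable_mult_right integrable_moment)
    show "AE x in M. (\<lambda>j. kern (w j) x) \<longlonglongrightarrow> kern u x"
    proof (intro AE_I2)
      fix x :: 'h
      have "(\<lambda>j. cis (inner (w j) x)) \<longlonglongrightarrow> cis (inner u x)"
        by (rule tendsto_cis_real[OF w])
      then show "(\<lambda>j. kern (w j) x) \<longlonglongrightarrow> kern u x"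
        unfolding kern_def by (intro tendsto_intros w)
    qed
    show "AE x in M. norm (kern (w j) x) \<le> (K + K\<^sup>2) * (trunc x (norm x))" for j
      by (intro AE_I2 norm_kern_le' K)
  qed measurable
  show ?thesis unfolding lam_eq
    by (intro tendsto_add tendsto_diff tendsto_mult_left tendsto_of_real tendsto_divide[OF _ tendsto_const] 1 2 3) simp
qed

end

section \<open>Convergence in probability\<close>

lemma ennreal_le_plusI: "a \<le> b + c \<Longrightarrow> 0 \<le> b \<Longrightarrow> 0 \<le> c \<Longrightarrow> ennreal a \<le> ennreal b + ennreal c"
  using ennreal_leI[of a "b + c"] by simp

lemma one_minus_Re_exp_le:
  assumes "Re z \<le> 0" shows "1 - Re (exp z) \<le> 2 * norm z"
proof -
  have "exp (Re z) \<ge> 1 + Re z" by (rule exp_ge_add_one_self)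
  moreover have "1 - cos (Im z) \<le> \<bar>Im z\<bar>"
  proof -
    have "norm (cis (Im z) - 1) \<le> \<bar>Im z\<bar>" by (rule norm_cis_minus_1_le)
    moreover have "\<bar>Re (cis (Im z) - 1)\<bar> \<le> norm (cis (Im z) - 1)" by (rule abs_Re_le_cmod)
    ultimately show ?thesis by simp
  qed
  moreover have "exp (Re z) * (1 - cos (Im z)) \<le> 1 * (1 - cos (Im z))"
    using assms by (intro mult_right_mono) auto
  moreover
  have "Re (exp z) = exp (Re z) * cos (Im z)" by (simp add: Re_exp)
  then have "1 - Re (exp z) = (1 - exp (Re z)) + exp (Re z) * (1 - cos (Im z))" by (simp add: algebra_simps)
  moreover have "\<bar>Re z\<bar> = - Re z" using assms by simp
  ultimately have "1 - Re (exp z) \<le> \<bar>Re z\<bar> + \<bar>Im z\<bar>" unfolding mult_1 by linarith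
  then show ?thesis using abs_Re_le_cmod[of z] abs_Im_le_cmod[of z] by linarith
qed

lemma min_square_le_exp: "min 1 (y\<^sup>2) \<le> 3 * (1 - exp (- y\<^sup>2 / 2 :: real))"
proof -
  define s where "s = y\<^sup>2 / 2"
  have s: "0 \<le> s" "y\<^sup>2 = 2 * s" by (auto simp: s_def)
  have "1 + s \<le> exp s" by (rule exp_ge_add_one_self)
  then have "exp (- s) \<le> 1 / (1 + s)" using s(1) by (simp add: exp_minus inverse_eq_divide frac_le)
  then have "s / (1 + s) \<le> 1 - exp (- s)" using s(1) by (simp add: field_simps)
  moreover have "min 1 (2 * s) \<le> 3 * (s / (1 + s))"
  proof (cases "2 * s \<le> 1")
    case True
    have "2 * s * (1 + s) \<le> 2 * s * (3 / 2)" using True s(1) by (intro mult_left_mono) auto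
    then show ?thesis using True s(1) by (simp add: field_simps)
  next
    case False
    then show ?thesis by (simp add: field_simps)
  qed
  ultimately show ?thesis unfolding s(2) by simp
qed

definition mean1 :: "'a measure \<Rightarrow> ('a \<Rightarrow> 'h::real_normed_vector) \<Rightarrow> ennreal" where
  "mean1 P X = (\<integral>\<^sup>+w. ennreal (min 1 (norm (X w))) \<partial>P)"

lemma mean1_triangle:
  fixes X Y Z :: "'a \<Rightarrow> 'h::{real_inner,second_countable_topology}"
  assumes [measurable]: "X \<in> borel_measurable P" "Y \<in> borel_measurable P" "Z \<in> borel_measurable P"
  shows "mean1 P (\<lambda>w. X w - Z w) \<le> mean1 P (\<lambda>w. X w - Y w) + mean1 P (\<lambda>w. Y w - Z w)"
proof -
  have "mean1 P (\<lambda>w. X w - Z w) \<le> (\<integral>\<^sup>+w. ennreal (min 1 (norm (X w - Y w))) + ennreal (min 1 (norm (Y w - Z w))) \<partial>P)"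
    unfolding mean1_def
  proof (intro nn_integral_mono)
    fix w
    have "norm (X w - Z w) \<le> norm (X w - Y w) + norm (Y w - Z w)"
      using norm_triangle_ineq[of "X w - Y w" "Y w - Z w"] by simp
    moreover have "min 1 a \<le> min 1 b + min 1 c" if "a \<le> b + c" "0 \<le> b" "0 \<le> c" for a b c :: real
      using that by (auto simp: min_def)
    ultimately have "min 1 (norm (X w - Z w)) \<le> min 1 (norm (X w - Y w)) + min 1 (norm (Y w - Z w))"
      by simp
    then show "ennreal (min 1 (norm (X w - Z w))) \<le> ennreal (min 1 (norm (X w - Y w))) + ennreal (min 1 (norm (Y w - Z w)))"
      by (intro ennreal_le_plusI) auto
  qed
  also have "\<dots> = mean1 P (\<lambda>w. X w - Y w) + mean1 P (\<lambda>w. Y w - Z w)"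
    unfolding mean1_def by (rule nn_integral_add) measurable
  finally show ?thesis .
qed

lemma mean1_commute: "mean1 P (\<lambda>w. X w - Y w) = mean1 P (\<lambda>w. Y w - X w)"
  unfolding mean1_def by (simp add: norm_minus_commute)

context prob_space
begin

lemma prob_le_mean1:
  fixes X :: "'a \<Rightarrow> 'h::{real_inner,second_countable_topology}"
  assumes [measurable]: "X \<in> borel_measurable M" and "\<epsilon> > 0"
  shows "ennreal (prob {w\<in>space M. norm (X w) > \<epsilon>}) \<le> ennreal (1 / min 1 \<epsilon>) * mean1 M X"
proof -
  have "ennreal (prob {w\<in>space M. norm (X w) > \<epsilon>}) = (\<integral>\<^sup>+w. indicator {w\<in>space M. norm (X w) > \<epsilon>} w \<partial>M)"
    by (simp add: emeasure_eq_measure)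
  also have "\<dots> \<le> (\<integral>\<^sup>+w. ennreal (1 / min 1 \<epsilon>) * ennreal (min 1 (norm (X w))) \<partial>M)"
  proof (intro nn_integral_mono)
    fix w
    have "1 \<le> 1 / min 1 \<epsilon> * min 1 (norm (X w))" if "norm (X w) > \<epsilon>"
      using that \<open>\<epsilon> > 0\<close> by (auto simp: min_def field_simps)
    then show "indicator {w\<in>space M. norm (X w) > \<epsilon>} w \<le> ennreal (1 / min 1 \<epsilon>) * ennreal (min 1 (norm (X w)))"
      using \<open>\<epsilon> > 0\<close> by (subst ennreal_mult[symmetric]) (auto simp: indicator_def)
  qed
  also have "\<dots> = ennreal (1 / min 1 \<epsilon>) * mean1 M X"
    unfolding mean1_def by (rule nn_integral_cmult) measurable
  finally show ?thesis .
qed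

lemma mean1_le_prob:
  fixes X :: "'a \<Rightarrow> 'h::{real_inner,second_countable_topology}"
  assumes [measurable]: "X \<in> borel_measurable M" and "\<epsilon> > 0"
  shows "mean1 M X \<le> ennreal (\<epsilon> + prob {w\<in>space M. norm (X w) > \<epsilon>})"
proof -
  have "mean1 M X \<le> (\<integral>\<^sup>+w. ennreal \<epsilon> + indicator {w\<in>space M. norm (X w) > \<epsilon>} w \<partial>M)"
    unfolding mean1_def
  proof (intro nn_integral_mono)
    fix w assume "w \<in> space M"
    show "ennreal (min 1 (norm (X w))) \<le> ennreal \<epsilon> + indicator {w\<in>space M. norm (X w) > \<epsilon>} w"
    proof (cases "norm (X w) > \<epsilon>")
      case True
      have "ennreal (min 1 (norm (X w))) \<le> ennreal \<epsilon> + ennreal 1"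
        using \<open>\<epsilon> > 0\<close> by (intro ennreal_le_plusI) auto
      then show ?thesis using True \<open>w \<in> space M\<close> by simp
    next
      case False
      then have "ennreal (min 1 (norm (X w))) \<le> ennreal \<epsilon>" by (intro ennreal_leI) simp
      then show ?thesis using False by simp
    qed
  qed
  also have "\<dots> = ennreal \<epsilon> + ennreal (prob {w\<in>space M. norm (X w) > \<epsilon>})"
    by (subst nn_integral_add) (auto simp: emeasure_eq_measure prob_space)
  also have "\<dots> = ennreal (\<epsilon> + prob {w\<in>space M. norm (X w) > \<epsilon>})"
    using \<open>\<epsilon> > 0\<close> by (simp flip: ennreal_plus)
  finally show ?thesis .
qed

lemma mean1_tendsto_0_iff:
  fixes X :: "nat \<Rightarrow> 'a \<Rightarrow> 'h::{real_inner,second_countable_topology}"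
  assumes [measurable]: "\<And>n. X n \<in> borel_measurable M"
  shows "(\<lambda>n. mean1 M (X n)) \<longlonglongrightarrow> 0 \<longleftrightarrow> (\<forall>\<epsilon>>0. (\<lambda>n. prob {w\<in>space M. norm (X n w) > \<epsilon>}) \<longlonglongrightarrow> 0)" (is "?l \<longleftrightarrow> ?r")
proof (intro iffI allI impI)
  fix \<epsilon> :: real assume l: ?l and e: "\<epsilon> > 0"
  have "(\<lambda>n. ennreal (1 / min 1 \<epsilon>) * mean1 M (X n)) \<longlonglongrightarrow> ennreal (1 / min 1 \<epsilon>) * 0"
    by (intro ennreal_tendsto_cmult l) simp
  then have up: "(\<lambda>n. ennreal (1 / min 1 \<epsilon>) * mean1 M (X n)) \<longlonglongrightarrow> 0" by simp
  have "(\<lambda>n. ennreal (prob {w\<in>space M. norm (X n w) > \<epsilon>})) \<longlonglongrightarrow> 0"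
    by (rule tendsto_sandwich[OF always_eventually always_eventually tendsto_const up])
       (intro allI zero_le prob_le_mean1 assms e)+
  then show "(\<lambda>n. prob {w\<in>space M. norm (X n w) > \<epsilon>}) \<longlonglongrightarrow> 0"
    by (subst (asm) ennreal_0[symmetric], subst (asm) tendsto_ennreal_iff) auto
next
  assume r: ?r
  show ?l
  proof (rule order_tendstoI)
    fix a :: ennreal assume "0 < a"
    then obtain r where r': "0 < r" "r < a" using dense by blast
    then obtain d :: real where "r = ennreal d" "0 \<le> d" by (cases r) auto
    then have d: "0 < d" "ennreal d < a" using r' by (auto simp: less_le)
    have "\<forall>\<^sub>F n in sequentially. prob {w\<in>space M. norm (X n w) > d / 2} < d / 2"
      using order_tendstoD(2)[OF r[rule_format, of "d / 2"], of "d / 2"] d(1) by simp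
    then show "\<forall>\<^sub>F n in sequentially. mean1 M (X n) < a"
    proof eventually_elim
      case (elim n)
      have "mean1 M (X n) \<le> ennreal (d / 2 + prob {w\<in>space M. norm (X n w) > d / 2})"
        using d(1) by (intro mean1_le_prob) auto
      also have "\<dots> \<le> ennreal d" using elim by (intro ennreal_leI) simp
      finally show ?case using d(2) by simp
    qed
  qed auto
qed

lemma cf_diff_le_mean1:
  fixes X Y :: "'a \<Rightarrow> 'h::{real_inner,second_countable_topology}"
  assumes [measurable]: "X \<in> borel_measurable M" "Y \<in> borel_measurable M"
  shows "ennreal (norm ((\<integral>w. cis (inner u (X w)) \<partial>M) - (\<integral>w. cis (inner u (Y w)) \<partial>M)))
    \<le> ennreal (2 + norm u) * mean1 M (\<lambda>w. X w - Y w)"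
proof -
  have i: "integrable M (\<lambda>w. cis (inner u (Z w)))" if [measurable]: "Z \<in> borel_measurable M" for Z
    by (rule integrable_const_bound[where B=1]) (auto)
  have "(\<integral>w. cis (inner u (X w)) \<partial>M) - (\<integral>w. cis (inner u (Y w)) \<partial>M) = (\<integral>w. cis (inner u (X w)) - cis (inner u (Y w)) \<partial>M)"
    by (simp add: i)
  then have "ennreal (norm ((\<integral>w. cis (inner u (X w)) \<partial>M) - (\<integral>w. cis (inner u (Y w)) \<partial>M)))
      \<le> (\<integral>\<^sup>+w. ennreal (norm (cis (inner u (X w)) - cis (inner u (Y w)))) \<partial>M)"
    by (simp only:) (rule integral_norm_bound_ennreal, intro Bochner_Integration.integrable_diff i assms)
  also have "\<dots> \<le> (\<integral>\<^sup>+w. ennreal (2 + norm u) * ennreal (min 1 (norm (X w - Y w))) \<partial>M)"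
  proof (intro nn_integral_mono)
    fix w
    let ?x = "inner u (X w)" and ?y = "inner u (Y w)"
    have "cis ?x - cis ?y = cis ?y * (cis (?x - ?y) - 1)" by (simp add: algebra_simps cis_mult)
    then have "norm (cis ?x - cis ?y) = norm (cis (?x - ?y) - 1)" by (simp add: norm_mult)
    also have "\<dots> \<le> \<bar>?x - ?y\<bar>" by (rule norm_cis_minus_1_le)
    also have "\<dots> \<le> norm u * norm (X w - Y w)"
      using Cauchy_Schwarz_ineq2[of u "X w - Y w"] by (simp add: inner_diff_right)
    finally have 1: "norm (cis ?x - cis ?y) \<le> norm u * norm (X w - Y w)" .
    have 2: "norm (cis ?x - cis ?y) \<le> 2" using norm_triangle_ineq4[of "cis ?x" "cis ?y"] by simp
    have "norm (cis ?x - cis ?y) \<le> (2 + norm u) * min 1 (norm (X w - Y w))"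
    proof (cases "norm (X w - Y w) \<le> 1")
      case True
      have "norm u * norm (X w - Y w) \<le> (2 + norm u) * norm (X w - Y w)" by (intro mult_right_mono) auto
      then show ?thesis using 1 True by simp
    next
      case False
      then show ?thesis using 2 by simp (metis add_increasing2 norm_ge_zero)
    qed
    then show "ennreal (norm (cis ?x - cis ?y)) \<le> ennreal (2 + norm u) * ennreal (min 1 (norm (X w - Y w)))"
      by (subst ennreal_mult[symmetric]) (auto intro!: ennreal_leI)
  qed
  also have "\<dots> = ennreal (2 + norm u) * mean1 M (\<lambda>w. X w - Y w)"
    unfolding mean1_def by (rule nn_integral_cmult) measurable
  finally show ?thesis .
qed

lemma cf_tendsto_mean1:
  fixes X :: "nat \<Rightarrow> 'a \<Rightarrow> 'h::{real_inner,second_countable_topology}"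
  assumes [measurable]: "\<And>n. X n \<in> borel_measurable M" "Y \<in> borel_measurable M"
    and lim: "(\<lambda>n. mean1 M (\<lambda>w. X n w - Y w)) \<longlonglongrightarrow> 0"
  shows "(\<lambda>n. \<integral>w. cis (inner u (X n w)) \<partial>M) \<longlonglongrightarrow> (\<integral>w. cis (inner u (Y w)) \<partial>M)"
proof -
  have "(\<lambda>n. ennreal (2 + norm u) * mean1 M (\<lambda>w. X n w - Y w)) \<longlonglongrightarrow> ennreal (2 + norm u) * 0"
    by (intro ennreal_tendsto_cmult lim) simp
  then have up: "(\<lambda>n. ennreal (2 + norm u) * mean1 M (\<lambda>w. X n w - Y w)) \<longlonglongrightarrow> 0" by simp
  have "(\<lambda>n. ennreal (norm ((\<integral>w. cis (inner u (X n w)) \<partial>M) - (\<integral>w. cis (inner u (Y w)) \<partial>M)))) \<longlonglongrightarrow> 0"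
    by (rule tendsto_sandwich[OF always_eventually always_eventually tendsto_const up])
       (intro allI zero_le cf_diff_le_mean1 assms)+
  then have "(\<lambda>n. norm ((\<integral>w. cis (inner u (X n w)) \<partial>M) - (\<integral>w. cis (inner u (Y w)) \<partial>M))) \<longlonglongrightarrow> 0"
    by (subst (asm) ennreal_0[symmetric], subst (asm) tendsto_ennreal_iff) auto
  then show ?thesis by (simp only: tendsto_norm_zero_iff LIM_zero_iff)
qed

lemma AE_convergent_if_mean1_summable:
  fixes S :: "nat \<Rightarrow> 'a \<Rightarrow> 'h::{real_inner,complete_space,second_countable_topology}"
  assumes [measurable]: "\<And>n. S n \<in> borel_measurable M"
    and fin: "(\<Sum>j. mean1 M (\<lambda>w. S (Suc j) w - S j w)) < \<infinity>"
  obtains Y where "Y \<in> borel_measurable M" "AE w in M. (\<lambda>n. S n w) \<longlonglongrightarrow> Y w"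
proof -
  have "(\<integral>\<^sup>+w. (\<Sum>j. ennreal (min 1 (norm (S (Suc j) w - S j w)))) \<partial>M) = (\<Sum>j. mean1 M (\<lambda>w. S (Suc j) w - S j w))"
    unfolding mean1_def by (rule nn_integral_suminf) measurable
  then have "AE w in M. (\<Sum>j. ennreal (min 1 (norm (S (Suc j) w - S j w)))) \<noteq> \<infinity>"
    using fin by (intro nn_integral_noteq_infinite) auto
  then have C: "AE w in M. Cauchy (\<lambda>n. S n w)"
  proof eventually_elim
    case (elim w)
    define a where "a j = norm (S (Suc j) w - S j w)" for j
    have s1: "summable (\<lambda>j. min 1 (a j))"
      using elim unfolding a_def by (intro summable_suminf_not_top) auto
    then have "(\<lambda>j. min 1 (a j)) \<longlonglongrightarrow> 0" by (rule summable_LIMSEQ_zero)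
    then have "\<forall>\<^sub>F j in sequentially. min 1 (a j) < 1" by (rule order_tendstoD(2)) simp
    then have "\<forall>\<^sub>F j in sequentially. min 1 (a j) = a j" by eventually_elim (auto simp: min_def split: if_splits)
    from summable_cong[OF this] have "summable a" using s1 by simp
    then have A: "Cauchy (\<lambda>n. \<Sum>j<n. a j)"
      unfolding summable_def sums_def by (meson LIMSEQ_imp_Cauchy)
    have le: "norm (S n w - S m w) \<le> (\<Sum>j<n. a j) - (\<Sum>j<m. a j)" if "m \<le> n" for m n
      using that
    proof (induction n rule: dec_induct)
      case (step n)
      have "norm (S (Suc n) w - S m w) \<le> a n + norm (S n w - S m w)"
        unfolding a_def using norm_triangle_ineq[of "S (Suc n) w - S n w" "S n w - S m w"] by simp
      then show ?case using step by simp
    qed simp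
    show ?case
    proof (rule metric_CauchyI)
      fix r :: real assume "r > 0"
      from metric_CauchyD[OF A this] obtain N where N: "\<And>m n. m \<ge> N \<Longrightarrow> n \<ge> N \<Longrightarrow> dist (\<Sum>j<m. a j) (\<Sum>j<n. a j) < r" by blast
      have "dist (S m w) (S n w) < r" if "m \<ge> N" "n \<ge> N" for m n
      proof (cases "m \<le> n")
        case True
        then show ?thesis using le[of m n] N[OF that] by (simp add: dist_norm norm_minus_commute)
      next
        case False
        then show ?thesis using le[of n m] N[OF that] by (simp add: dist_norm)
      qed
      then show "\<exists>N. \<forall>m\<ge>N. \<forall>n\<ge>N. dist (S m w) (S n w) < r" by blast
    qed
  qed
  define S' where "S' n w = (if Cauchy (\<lambda>n. S n w) then S n w else 0)" for n w
  have [measurable]: "S' n \<in> borel_measurable M" for n unfolding S'_def by measurable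
  define Y where "Y w = lim (\<lambda>n. S' n w)" for w
  have "(\<lambda>n. S' n w) \<longlonglongrightarrow> Y w" for w
  proof -
    have "convergent (\<lambda>n. S' n w)"
      by (cases "Cauchy (\<lambda>n. S n w)") (simp_all add: S'_def Cauchy_convergent convergent_const)
    then show ?thesis by (simp add: Y_def convergent_LIMSEQ_iff)
  qed
  then have lim: "\<And>w. w \<in> space M \<Longrightarrow> (\<lambda>n. S' n w) \<longlonglongrightarrow> Y w" by blast
  then have "Y \<in> borel_measurable M" by (intro borel_measurable_LIMSEQ_metric[of S' M Y]) auto
  moreover have "AE w in M. (\<lambda>n. S n w) \<longlonglongrightarrow> Y w"
    using C AE_space
  proof eventually_elim
    case (elim w)
    then show ?case using lim[of w] by (simp add: S'_def)
  qed
  ultimately show ?thesis using that by blast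
qed

lemma mean1_tendsto_if_AE:
  fixes X :: "nat \<Rightarrow> 'a \<Rightarrow> 'h::{real_inner,second_countable_topology}"
  assumes [measurable]: "\<And>n. X n \<in> borel_measurable M" "Y \<in> borel_measurable M"
    and lim: "AE w in M. (\<lambda>n. X n w) \<longlonglongrightarrow> Y w"
  shows "(\<lambda>n. mean1 M (\<lambda>w. X n w - Y w)) \<longlonglongrightarrow> 0"
proof -
  have "(\<lambda>n. mean1 M (\<lambda>w. X n w - Y w)) \<longlonglongrightarrow> (\<integral>\<^sup>+w. 0 \<partial>M)"
    unfolding mean1_def
  proof (rule nn_integral_dominated_convergence[where w="\<lambda>_. 1"])
    show "AE w in M. (\<lambda>n. ennreal (min 1 (norm (X n w - Y w)))) \<longlonglongrightarrow> 0"
      using lim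
    proof eventually_elim
      case (elim w)
      have "(\<lambda>n. min 1 (norm (X n w - Y w))) \<longlonglongrightarrow> min 1 (norm (Y w - Y w))"
        by (intro tendsto_min tendsto_intros elim)
      then show ?case using tendsto_ennrealI by fastforce
    qed
    show "AE w in M. ennreal (min 1 (norm (X n w - Y w))) \<le> 1" for n
      by (intro AE_I2) (simp add: ennreal_le_1)
  qed (simp_all add: emeasure_space_1)
  then show ?thesis by simp
qed

lemma mean1_complete:
  fixes X :: "nat \<Rightarrow> 'a \<Rightarrow> 'h::{real_inner,complete_space,second_countable_topology}"
  assumes m [measurable]: "\<And>n. X n \<in> borel_measurable M"
    and Cau: "\<And>\<epsilon>::real. \<epsilon> > 0 \<Longrightarrow> \<exists>N. \<forall>m\<ge>N. \<forall>n\<ge>N. mean1 M (\<lambda>w. X m w - X n w) \<le> ennreal \<epsilon>"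
  obtains Y where "Y \<in> borel_measurable M" "(\<lambda>n. mean1 M (\<lambda>w. X n w - Y w)) \<longlonglongrightarrow> 0"
proof -
  have "\<exists>N. \<forall>m\<ge>N. \<forall>n\<ge>N. mean1 M (\<lambda>w. X m w - X n w) \<le> ennreal ((1/2) ^ j)" for j :: nat
    by (rule Cau) simp
  then obtain N where N: "\<And>j m n. m \<ge> N j \<Longrightarrow> n \<ge> N j \<Longrightarrow> mean1 M (\<lambda>w. X m w - X n w) \<le> ennreal ((1/2) ^ j)"
    by metis
  define r where "r j = j + (\<Sum>i\<le>j. N i)" for j
  have rN: "N j \<le> r j" "N j \<le> r (Suc j)" "j \<le> r j" for j
    unfolding r_def by (auto intro: trans_le_add2 member_le_sum sum_mono2 order_trans[OF member_le_sum[of j "{..j}" N]])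
  have "(\<Sum>j. mean1 M (\<lambda>w. X (r (Suc j)) w - X (r j) w)) \<le> (\<Sum>j. ennreal ((1/2) ^ j))"
    by (intro suminf_le summableI N rN)
  also have "\<dots> < \<infinity>" by (subst suminf_ennreal2) auto
  finally obtain Y where Y [measurable]: "Y \<in> borel_measurable M" and lim: "AE w in M. (\<lambda>n. X (r n) w) \<longlonglongrightarrow> Y w"
    using AE_convergent_if_mean1_summable[of "\<lambda>j. X (r j)"] m by blast
  have l1: "(\<lambda>n. mean1 M (\<lambda>w. X (r n) w - Y w)) \<longlonglongrightarrow> 0"
    by (rule mean1_tendsto_if_AE[OF _ Y lim]) simp
  have "(\<lambda>n. mean1 M (\<lambda>w. X n w - X (r n) w)) \<longlonglongrightarrow> 0"
  proof (rule order_tendstoI)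
    fix a :: ennreal assume "0 < a"
    have "(\<lambda>j. ennreal ((1/2) ^ j)) \<longlonglongrightarrow> ennreal 0" by (intro tendsto_ennrealI LIMSEQ_realpow_zero) auto
    then have "\<forall>\<^sub>F j in sequentially. ennreal ((1/2) ^ j) < a"
      using \<open>0 < a\<close> by (intro order_tendstoD(2)) auto
    then obtain j where j: "ennreal ((1/2) ^ j) < a" by (auto simp: eventually_sequentially)
    show "\<forall>\<^sub>F n in sequentially. mean1 M (\<lambda>w. X n w - X (r n) w) < a"
      using eventually_ge_at_top[of "N j"]
    proof eventually_elim
      case (elim n)
      have "mean1 M (\<lambda>w. X n w - X (r n) w) \<le> ennreal ((1/2) ^ j)"
        using elim rN(3)[of n] by (intro N) auto
      then show ?case using j by simp
    qed
  qed auto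
  from tendsto_add[OF this l1]
  have up: "(\<lambda>n. mean1 M (\<lambda>w. X n w - X (r n) w) + mean1 M (\<lambda>w. X (r n) w - Y w)) \<longlonglongrightarrow> 0" by simp
  have "(\<lambda>n. mean1 M (\<lambda>w. X n w - Y w)) \<longlonglongrightarrow> 0"
    by (rule tendsto_sandwich[OF always_eventually always_eventually tendsto_const up])
       (intro allI zero_le mean1_triangle m Y)+
  then show ?thesis using that Y by blast
qed

lemma mean1_le_if_exp:
  fixes Y :: "'a \<Rightarrow> 'h::{real_inner,second_countable_topology}"
  assumes [measurable]: "Y \<in> borel_measurable M" and \<epsilon>: "\<epsilon> > 0"
    and le: "(\<integral>\<^sup>+w. ennreal (1 - exp (- (norm (Y w))\<^sup>2 / 2)) \<partial>M) \<le> ennreal (\<epsilon>\<^sup>2)"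
  shows "mean1 M Y \<le> ennreal (2 * \<epsilon>)"
proof -
  have "mean1 M Y \<le> (\<integral>\<^sup>+w. ennreal \<epsilon> + ennreal (3 / (4 * \<epsilon>)) * ennreal (1 - exp (- (norm (Y w))\<^sup>2 / 2)) \<partial>M)"
    unfolding mean1_def
  proof (intro nn_integral_mono)
    fix w
    define y where "y = norm (Y w)"
    define q where "q = min 1 y"
    have "0 \<le> y" by (simp add: y_def)
    then have q2: "q\<^sup>2 \<le> min 1 (y\<^sup>2)" by (auto simp: q_def min_def power_le_one)
    have "0 \<le> (2 * \<epsilon> - q)\<^sup>2" by simp
    then have "4 * \<epsilon> * q \<le> 4 * \<epsilon> * \<epsilon> + q\<^sup>2" by (simp add: power2_eq_square algebra_simps)
    then have "q \<le> \<epsilon> + q\<^sup>2 / (4 * \<epsilon>)" using \<epsilon> by (simp add: field_simps)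
    also have "\<dots> \<le> \<epsilon> + 3 * (1 - exp (- y\<^sup>2 / 2)) / (4 * \<epsilon>)"
      using q2 min_square_le_exp[of y] \<epsilon> by (intro add_left_mono divide_right_mono) auto
    finally have "q \<le> \<epsilon> + 3 / (4 * \<epsilon>) * (1 - exp (- y\<^sup>2 / 2))" by simp
    then show "ennreal (min 1 (norm (Y w))) \<le> ennreal \<epsilon> + ennreal (3 / (4 * \<epsilon>)) * ennreal (1 - exp (- (norm (Y w))\<^sup>2 / 2))"
      unfolding y_def q_def using \<epsilon> by (subst ennreal_mult[symmetric]) (auto intro!: ennreal_le_plusI)
  qed
  also have "\<dots> = ennreal \<epsilon> + ennreal (3 / (4 * \<epsilon>)) * (\<integral>\<^sup>+w. ennreal (1 - exp (- (norm (Y w))\<^sup>2 / 2)) \<partial>M)"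
    by (subst nn_integral_add) (auto simp: nn_integral_cmult emeasure_space_1)
  also have "\<dots> \<le> ennreal \<epsilon> + ennreal (3 / (4 * \<epsilon>)) * ennreal (\<epsilon>\<^sup>2)"
    by (intro add_left_mono mult_left_mono le) simp
  also have "\<dots> = ennreal (\<epsilon> + 3 / (4 * \<epsilon>) * \<epsilon>\<^sup>2)"
    using \<epsilon> by (subst ennreal_mult[symmetric], simp, simp, subst ennreal_plus[symmetric]) auto
  also have "\<dots> \<le> ennreal (2 * \<epsilon>)" using \<epsilon> by (intro ennreal_leI) (simp add: power2_eq_square)
  finally show ?thesis .
qed

end

context levy_triplet
begin

text \<open>Averaging the characteristic functional over the Gaussians \<open>gauss n\<close> turns the exponent into
  a bound for the size of \<open>Y\<close> that is uniform in the dimension.\<close>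

lemma exp_bound_if_cf:
  fixes Y :: "'w \<Rightarrow> 'h"
  assumes P: "prob_space P" and [measurable]: "Y \<in> borel_measurable P"
    and cf: "\<And>u. (\<integral>w. cis (inner u (Y w)) \<partial>P) = exp (\<psi> u)" and Re: "\<And>u. Re (\<psi> u) \<le> 0"
    and \<psi>: "\<And>u. ennreal (norm (\<psi> u)) \<le> (\<Sum>k\<in>K. ennreal (d k) * dom (\<lambda>x. \<bar>inner (G k x) u\<bar>))"
    and G [measurable]: "\<And>k. G k \<in> borel_measurable borel"
  shows "(\<integral>\<^sup>+w. ennreal (1 - exp (- (norm (Y w))\<^sup>2 / 2)) \<partial>P) \<le> 2 * (\<Sum>k\<in>K. ennreal (d k) * dom (\<lambda>x. norm (G k x)))"
proof -
  interpret P: prob_space P by fact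
  have [measurable]: "(\<lambda>w. norm (proj n (Y w))) \<in> borel_measurable P" for n
    unfolding proj_def by measurable
  have fin: "(\<integral>\<^sup>+w. ennreal (1 - exp (- (norm (proj n (Y w)))\<^sup>2 / 2)) \<partial>P) \<le> 2 * (\<Sum>k\<in>K. ennreal (d k) * dom (\<lambda>x. norm (G k x)))" for n
  proof -
    interpret G: prob_space "gauss n" by (rule prob_space_gauss)
    interpret PG: pair_sigma_finite "gauss n" P ..
    have [measurable]: "(\<lambda>z. dom (\<lambda>x. \<bar>inner (G k x) z\<bar>)) \<in> borel_measurable borel" for k
      by (rule dom_inner_measurable[OF G])
    have one: "ennreal (1 - exp (- (norm (proj n x))\<^sup>2 / 2)) = (\<integral>\<^sup>+z. ennreal (1 - cos (inner x z)) \<partial>gauss n)" for x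
    proof -
      have ic: "integrable (gauss n) (\<lambda>z. cis (inner x z))"
        by (rule G.integrable_const_bound[where B=1]) auto
      have i: "integrable (gauss n) (\<lambda>z. cos (inner x z))"
        using integrable_Re[OF ic] by simp
      have "(\<integral>z. cos (inner x z) \<partial>gauss n) = Re (\<integral>z. cis (inner x z) \<partial>gauss n)"
        using integral_Re[OF ic] by simp
      also have "\<dots> = exp (- (norm (proj n x))\<^sup>2 / 2)" by (simp add: char_gauss)
      finally have "(\<integral>z. 1 - cos (inner x z) \<partial>gauss n) = 1 - exp (- (norm (proj n x))\<^sup>2 / 2)"
        using i G.prob_space by simp
      then show ?thesis using i by (subst nn_integral_eq_integral) auto
    qed
    have two: "(\<integral>\<^sup>+w. ennreal (1 - cos (inner (Y w) z)) \<partial>P) = ennreal (1 - Re (exp (\<psi> z)))" for z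
    proof -
      have ic: "integrable P (\<lambda>w. cis (inner z (Y w)))"
        by (rule P.integrable_const_bound[where B=1]) auto
      have i: "integrable P (\<lambda>w. cos (inner z (Y w)))"
        using integrable_Re[OF ic] by simp
      have "(\<integral>w. cos (inner z (Y w)) \<partial>P) = Re (exp (\<psi> z))"
        using integral_Re[OF ic] by (simp add: cf)
      then have "(\<integral>w. 1 - cos (inner z (Y w)) \<partial>P) = 1 - Re (exp (\<psi> z))"
        using i P.prob_space by simp
      then show ?thesis using i by (subst nn_integral_eq_integral) (auto simp: inner_commute)
    qed
    have "(\<integral>\<^sup>+w. ennreal (1 - exp (- (norm (proj n (Y w)))\<^sup>2 / 2)) \<partial>P)
        = (\<integral>\<^sup>+w. (\<integral>\<^sup>+z. ennreal (1 - cos (inner (Y w) z)) \<partial>gauss n) \<partial>P)"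
      by (simp only: one)
    also have "\<dots> = (\<integral>\<^sup>+z. (\<integral>\<^sup>+w. ennreal (1 - cos (inner (Y w) z)) \<partial>P) \<partial>gauss n)"
      by (rule PG.Fubini') measurable
    also have "\<dots> = (\<integral>\<^sup>+z. ennreal (1 - Re (exp (\<psi> z))) \<partial>gauss n)" by (simp only: two)
    also have "\<dots> \<le> (\<integral>\<^sup>+z. 2 * (\<Sum>k\<in>K. ennreal (d k) * dom (\<lambda>x. \<bar>inner (G k x) z\<bar>)) \<partial>gauss n)"
    proof (intro nn_integral_mono)
      fix z
      have "ennreal (1 - Re (exp (\<psi> z))) \<le> ennreal (2 * norm (\<psi> z))"
        by (intro ennreal_leI one_minus_Re_exp_le Re)
      also have "\<dots> = 2 * ennreal (norm (\<psi> z))" by (simp add: ennreal_mult)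
      also have "\<dots> \<le> 2 * (\<Sum>k\<in>K. ennreal (d k) * dom (\<lambda>x. \<bar>inner (G k x) z\<bar>))"
        by (intro mult_left_mono \<psi>) simp
      finally show "ennreal (1 - Re (exp (\<psi> z))) \<le> 2 * (\<Sum>k\<in>K. ennreal (d k) * dom (\<lambda>x. \<bar>inner (G k x) z\<bar>))" .
    qed
    also have "\<dots> = 2 * (\<Sum>k\<in>K. ennreal (d k) * (\<integral>\<^sup>+z. dom (\<lambda>x. \<bar>inner (G k x) z\<bar>) \<partial>gauss n))"
      by (simp add: nn_integral_cmult nn_integral_sum)
    also have "\<dots> \<le> 2 * (\<Sum>k\<in>K. ennreal (d k) * dom (\<lambda>x. norm (G k x)))"
      by (intro mult_left_mono sum_mono dom_gauss_le) auto
    finally show ?thesis .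
  qed
  have "(\<integral>\<^sup>+w. ennreal (1 - exp (- (norm (Y w))\<^sup>2 / 2)) \<partial>P)
      = (\<integral>\<^sup>+w. liminf (\<lambda>n. ennreal (1 - exp (- (norm (proj n (Y w)))\<^sup>2 / 2))) \<partial>P)"
  proof (intro nn_integral_cong)
    fix w
    have "(\<lambda>n. 1 - exp (- (norm (proj n (Y w)))\<^sup>2 / 2)) \<longlonglongrightarrow> 1 - exp (- (norm (Y w))\<^sup>2 / 2)"
      by (intro tendsto_intros proj_tendsto) auto
    from lim_imp_Liminf[OF sequentially_bot tendsto_ennrealI[OF this]]
    show "ennreal (1 - exp (- (norm (Y w))\<^sup>2 / 2)) = liminf (\<lambda>n. ennreal (1 - exp (- (norm (proj n (Y w)))\<^sup>2 / 2)))" by simp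
  qed
  also have "\<dots> \<le> liminf (\<lambda>n. \<integral>\<^sup>+w. ennreal (1 - exp (- (norm (proj n (Y w)))\<^sup>2 / 2)) \<partial>P)"
    by (rule nn_integral_liminf) measurable
  also have "\<dots> \<le> limsup (\<lambda>n. \<integral>\<^sup>+w. ennreal (1 - exp (- (norm (proj n (Y w)))\<^sup>2 / 2)) \<partial>P)"
    by (rule Liminf_le_Limsup) simp
  also have "\<dots> \<le> 2 * (\<Sum>k\<in>K. ennreal (d k) * dom (\<lambda>x. norm (G k x)))"
    by (rule Limsup_bounded) (intro always_eventually allI fin)
  finally show ?thesis .
qed

end

section \<open>Stochastic integrals\<close>

lemma riemann_sum_tendsto:
  fixes g :: "real \<Rightarrow> complex"
  assumes st: "s \<le> t" and g: "continuous_on {s..t} g"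
  shows "(\<lambda>n. \<Sum>k<n. complex_of_real ((t - s) / real n) * g (s + real k * (t - s) / real n)) \<longlonglongrightarrow> (\<integral>r\<in>{s..t}. g r \<partial>lborel)"
proof -
  have eq: "(\<integral>r\<in>{s..t}. g r \<partial>lborel) = integral {s..t} g"
    by (rule set_borel_integral_eq_integral(2)[OF borel_integrable_atLeastAtMost'[OF g]])
  have uc: "uniformly_continuous_on {s..t} g" using g by (intro compact_uniformly_continuous) auto
  show ?thesis unfolding eq
  proof (rule metric_LIMSEQ_I)
    fix \<epsilon> :: real assume "\<epsilon> > 0"
    define \<eta> where "\<eta> = \<epsilon> / (2 * (t - s + 1))"
    have \<eta>: "\<eta> > 0" "\<eta> * (t - s) < \<epsilon>"
    proof -
      show "\<eta> > 0" using \<open>\<epsilon> > 0\<close> st by (simp add: \<eta>_def)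
      have "\<eta> * (t - s) < \<eta> * (2 * (t - s + 1))" using \<open>\<eta> > 0\<close> st by (intro mult_strict_left_mono) auto
      also have "\<dots> = \<epsilon>" using st by (simp add: \<eta>_def)
      finally show "\<eta> * (t - s) < \<epsilon>" .
    qed
    obtain \<delta> where \<delta>: "\<delta> > 0" "\<And>x y. x \<in> {s..t} \<Longrightarrow> y \<in> {s..t} \<Longrightarrow> dist y x < \<delta> \<Longrightarrow> dist (g y) (g x) < \<eta>"
      using uc \<eta>(1) unfolding uniformly_continuous_on_def by metis
    obtain N where N: "(t - s) / \<delta> < real N" using reals_Archimedean2 by blast
    have "dist (\<Sum>k<n. complex_of_real ((t - s) / real n) * g (s + real k * (t - s) / real n)) (integral {s..t} g) < \<epsilon>" if n: "n \<ge> Suc N" for n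
    proof -
      define h where "h = (t - s) / real n"
      have n0: "real n > 0" using n by simp
      have h: "0 \<le> h" "h < \<delta>" "real n * h = t - s"
      proof -
        show "0 \<le> h" using st n0 by (simp add: h_def)
        have "(t - s) / \<delta> < real n" using N n by simp
        then show "h < \<delta>" using \<delta>(1) n0 by (simp add: h_def field_simps)
        show "real n * h = t - s" using n0 by (simp add: h_def)
      qed
      have kh: "s + real k * h \<le> t" if "k \<le> n" for k
        using mult_right_mono[of "real k" "real n" h] that h by simp
      have step: "norm (complex_of_real h * g (s + real k * h) - integral {s + real k * h..s + real (Suc k) * h} g) \<le> \<eta> * h" if "k < n" for k
      proof -
        let ?a = "s + real k * h" and ?b = "s + real (Suc k) * h"
        have ab: "?a \<le> ?b" "{?a..?b} \<subseteq> {s..t}" using kh[of "Suc k"] that h(1) by (auto simp: algebra_simps intro: order_trans[of s "s + real k * h"])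
        have gc: "continuous_on {?a..?b} g" using g ab(2) continuous_on_subset by blast
        have e1: "integral {?a..?b} (\<lambda>r. g ?a - g r) = complex_of_real h * g ?a - integral {?a..?b} g"
          using ab(1) gc by (subst integral_diff) (auto intro: integrable_continuous_interval simp: algebra_simps scaleR_conv_of_real)
        have e2: "norm (integral {?a..?b} (\<lambda>r. g ?a - g r)) \<le> \<eta> * (?b - ?a)"
        proof (rule integral_bound[OF ab(1)])
          show "continuous_on {?a..?b} (\<lambda>r. g ?a - g r)" by (intro continuous_intros gc)
          fix r assume r: "r \<in> {?a..?b}"
          then have "dist ?a r < \<delta>" using h by (auto simp: dist_real_def algebra_simps)
          moreover have "?a \<in> {s..t}" "r \<in> {s..t}" using ab r by auto
          ultimately show "norm (g ?a - g r) \<le> \<eta>" using \<delta>(2)[of r ?a] by (simp add: dist_norm)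
        qed
        have "?b - ?a = h" by (simp add: algebra_simps)
        then show ?thesis using e2 unfolding e1 by (simp only:)
      qed
      have "norm ((\<Sum>j<k. complex_of_real h * g (s + real j * h)) - integral {s..s + real k * h} g) \<le> real k * (\<eta> * h)" if "k \<le> n" for k
        using that
      proof (induction k)
        case (Suc k)
        have "integral {s..s + real k * h} g + integral {s + real k * h..s + real (Suc k) * h} g = integral {s..s + real (Suc k) * h} g"
        proof (rule Henstock_Kurzweil_Integration.integral_combine)
          show "s \<le> s + real k * h" "s + real k * h \<le> s + real (Suc k) * h" using h(1) by (simp_all add: algebra_simps)
          show "g integrable_on {s..s + real (Suc k) * h}"
            using kh[of "Suc k"] Suc.prems g by (intro integrable_continuous_interval continuous_on_subset[OF g]) auto
        qed
        then have "(\<Sum>j<Suc k. complex_of_real h * g (s + real j * h)) - integral {s..s + real (Suc k) * h} g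
           = ((\<Sum>j<k. complex_of_real h * g (s + real j * h)) - integral {s..s + real k * h} g)
           + (complex_of_real h * g (s + real k * h) - integral {s + real k * h..s + real (Suc k) * h} g)"
          by (simp add: algebra_simps)
        also have "norm \<dots> \<le> real k * (\<eta> * h) + \<eta> * h"
          using Suc by (intro order_trans[OF norm_triangle_ineq] add_mono step) auto
        finally show ?case by (simp add: algebra_simps)
      qed simp
      from this[of n] have "norm ((\<Sum>j<n. complex_of_real h * g (s + real j * h)) - integral {s..t} g) \<le> \<eta> * (t - s)"
        using h(3) by (simp add: mult.left_commute)
      then show ?thesis using \<eta>(2) by (simp add: dist_norm h_def)
    qed
    then show "\<exists>N. \<forall>n\<ge>N. dist (\<Sum>k<n. complex_of_real ((t - s) / real n) * g (s + real k * (t - s) / real n)) (integral {s..t} g) < \<epsilon>" by blast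
  qed
qed

context levy_triplet
begin

lemma continuous_lam_adj:
  fixes G :: "real \<Rightarrow> 'h \<Rightarrow>\<^sub>L 'h"
  assumes G: "\<And>x. continuous_on S (\<lambda>r. G r x)" and K: "\<And>r. r \<in> S \<Longrightarrow> norm (G r) \<le> K"
  shows "continuous_on S (\<lambda>r. lam (adj (G r) u))"
  unfolding continuous_on_sequentially
proof (intro allI ballI impI, elim conjE)
  fix x a assume a: "a \<in> S" and x: "\<forall>n. x n \<in> S" and lim: "x \<longlonglongrightarrow> a"
  have "(\<lambda>n. lam (adj (G (x n)) u)) \<longlonglongrightarrow> lam (adj (G a) u)"
  proof (rule lam_tendsto)
    fix y
    have "((\<lambda>r. G r y) \<circ> x) \<longlonglongrightarrow> G a y"
      using G[of y] a x lim unfolding continuous_on_sequentially by blast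
    then have "(\<lambda>n. inner u (G (x n) y)) \<longlonglongrightarrow> inner u (G a y)"
      by (intro tendsto_inner tendsto_const) (simp add: o_def)
    then show "(\<lambda>n. inner (adj (G (x n)) u) y) \<longlonglongrightarrow> inner (adj (G a) u) y" by (simp only: inner_adj')
    show "norm (adj (G (x n)) u) \<le> K * norm u" for n
      by (rule order_trans[OF norm_adj_le mult_right_mono[OF K[OF x[rule_format]] norm_ge_zero]])
  qed
  then show "((\<lambda>r. lam (adj (G r) u)) \<circ> x) \<longlonglongrightarrow> lam (adj (G a) u)" by (simp add: o_def)
qed

end

locale levy_increments = levy_triplet e b R M v + prob_space \<Omega>
  for e :: "nat \<Rightarrow> 'h::{real_inner,complete_space,second_countable_topology}" and b R M v and \<Omega> :: "'w measure" +
  fixes L :: "real \<Rightarrow> 'w \<Rightarrow> 'h" and \<theta> :: real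
  assumes L_measurable [measurable]: "\<And>t. L t \<in> borel_measurable \<Omega>"
    and L_indep: "\<And>(ts::nat \<Rightarrow> real) n. (\<And>i. i < n \<Longrightarrow> ts i \<le> ts (Suc i)) \<Longrightarrow>
        indep_vars (\<lambda>_. borel) (\<lambda>i w. L (ts (Suc i)) w - L (ts i) w) {..<n}"
    and L_cf: "\<And>s t u. s \<le> t \<Longrightarrow>
        (\<integral>w. cis (inner u (L t w - L s w)) \<partial>\<Omega>) = exp (complex_of_real (\<theta> * (t - s)) * lam u)"
    and \<theta>_nonneg: "0 \<le> \<theta>"
begin

definition isum :: "(nat \<Rightarrow> 'h \<Rightarrow>\<^sub>L 'h) \<Rightarrow> (nat \<Rightarrow> real) \<Rightarrow> nat \<Rightarrow> 'w \<Rightarrow> 'h" where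
  "isum H ts n w = (\<Sum>k<n. H k (L (ts (Suc k)) w - L (ts k) w))"

lemma blinfun_measurable [measurable]: "blinfun_apply (F :: 'h \<Rightarrow>\<^sub>L 'h) \<in> borel_measurable borel"
  by (intro borel_measurable_continuous_onI blinfun.continuous_on continuous_on_const continuous_on_id)

lemma isum_measurable [measurable]: "isum H ts n \<in> borel_measurable \<Omega>"
  unfolding isum_def by measurable

lemma isum_cf:
  fixes H :: "nat \<Rightarrow> 'h \<Rightarrow>\<^sub>L 'h"
  assumes ts: "\<And>i. i < n \<Longrightarrow> ts i \<le> ts (Suc i)"
  shows "(\<integral>w. cis (inner u (isum H ts n w)) \<partial>\<Omega>)
    = exp (\<Sum>k<n. complex_of_real (\<theta> * (ts (Suc k) - ts k)) * lam (adj (H k) u))"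
proof -
  let ?D = "\<lambda>k w. L (ts (Suc k)) w - L (ts k) w"
  have "inner u (isum H ts n w) = (\<Sum>k<n. inner (adj (H k) u) (?D k w))" for w
    by (simp only: isum_def inner_sum_right inner_adj')
  then have "(\<integral>w. cis (inner u (isum H ts n w)) \<partial>\<Omega>) = (\<integral>w. (\<Prod>k<n. cis (inner (adj (H k) u) (?D k w))) \<partial>\<Omega>)"
    by (simp only: cis_sum)
  also have "\<dots> = (\<Prod>k<n. \<integral>w. cis (inner (adj (H k) u) (?D k w)) \<partial>\<Omega>)"
  proof (rule indep_vars_lebesgue_integral)
    show "indep_vars (\<lambda>_. borel) (\<lambda>k w. cis (inner (adj (H k) u) (?D k w))) {..<n}"
    proof (rule indep_vars_compose2[where Y="\<lambda>k x. cis (inner (adj (H k) u) x)" and X="?D" and M'="\<lambda>_. borel"])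
      show "indep_vars (\<lambda>_. borel) ?D {..<n}" using ts by (rule L_indep)
    qed auto
    show "integrable \<Omega> (\<lambda>w. cis (inner (adj (H k) u) (?D k w)))" for k
      by (rule integrable_const_bound[where B=1]) auto
  qed simp
  also have "\<dots> = (\<Prod>k<n. exp (complex_of_real (\<theta> * (ts (Suc k) - ts k)) * lam (adj (H k) u)))"
    using ts by (intro prod.cong refl L_cf) auto
  finally show ?thesis by (simp only: exp_sum finite_lessThan)
qed

lemma isum_mean1:
  fixes H :: "nat \<Rightarrow> 'h \<Rightarrow>\<^sub>L 'h"
  assumes ts: "\<And>i. i < n \<Longrightarrow> ts i \<le> ts (Suc i)" and \<eta>: "0 \<le> \<eta>"
    and H: "\<And>k. k < n \<Longrightarrow> dom (\<lambda>x. norm (H k x)) \<le> ennreal \<eta>"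
    and \<epsilon>: "\<epsilon> > 0" "2 * (\<theta> * (ts n - ts 0) * \<eta>) \<le> \<epsilon>\<^sup>2"
  shows "mean1 \<Omega> (isum H ts n) \<le> ennreal (2 * \<epsilon>)"
proof (rule mean1_le_if_exp[OF isum_measurable \<epsilon>(1)])
  let ?d = "\<lambda>k. \<theta> * (ts (Suc k) - ts k)"
  have d0: "0 \<le> ?d k" if "k < n" for k using ts[OF that] \<theta>_nonneg by simp
  have cf: "(\<integral>w. cis (inner u (isum H ts n w)) \<partial>\<Omega>) = exp (\<Sum>k<n. complex_of_real (?d k) * lam (adj (H k) u))" for u
    using ts by (rule isum_cf)
  have "(\<integral>\<^sup>+w. ennreal (1 - exp (- (norm (isum H ts n w))\<^sup>2 / 2)) \<partial>\<Omega>) \<le> 2 * (\<Sum>k<n. ennreal (?d k) * dom (\<lambda>x. norm (H k x)))"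
  proof (rule exp_bound_if_cf[OF prob_space_axioms isum_measurable cf])
    fix u
    show "Re (\<Sum>k<n. complex_of_real (?d k) * lam (adj (H k) u)) \<le> 0"
      unfolding Re_sum using d0 Re_lam_le by (intro sum_nonpos) (auto simp: mult_nonneg_nonpos)
    have "norm (\<Sum>k<n. complex_of_real (?d k) * lam (adj (H k) u)) \<le> (\<Sum>k<n. ?d k * norm (lam (adj (H k) u)))"
      using d0 by (intro sum_norm_le) (auto simp: norm_mult simp flip: of_real_mult of_real_diff)
    then have "ennreal (norm (\<Sum>k<n. complex_of_real (?d k) * lam (adj (H k) u))) \<le> ennreal (\<Sum>k<n. ?d k * norm (lam (adj (H k) u)))"
      by (rule ennreal_leI)
    also have "\<dots> = (\<Sum>k<n. ennreal (?d k * norm (lam (adj (H k) u))))"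
      using d0 by (intro sum_ennreal[symmetric]) auto
    also have "\<dots> = (\<Sum>k<n. ennreal (?d k) * ennreal (norm (lam (adj (H k) u))))"
      using d0 by (intro sum.cong refl ennreal_mult) auto
    also have "\<dots> \<le> (\<Sum>k<n. ennreal (?d k) * dom (\<lambda>x. \<bar>inner x (adj (H k) u)\<bar>))"
      by (intro sum_mono mult_left_mono norm_lam_dom) auto
    finally show "ennreal (norm (\<Sum>k<n. complex_of_real (?d k) * lam (adj (H k) u))) \<le> (\<Sum>k<n. ennreal (?d k) * dom (\<lambda>x. \<bar>inner (H k x) u\<bar>))"
      by (simp only: inner_adj)
  qed (auto)
  also have "\<dots> \<le> 2 * (\<Sum>k<n. ennreal (?d k) * ennreal \<eta>)"
    by (intro mult_left_mono sum_mono H) auto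
  also have "\<dots> = 2 * (\<Sum>k<n. ennreal (?d k * \<eta>))"
    using d0 \<eta> by (intro arg_cong[where f="\<lambda>x. 2 * x"] sum.cong refl ennreal_mult[symmetric]) auto
  also have "\<dots> = 2 * ennreal (\<Sum>k<n. ?d k * \<eta>)"
    using d0 \<eta> by (subst sum_ennreal) auto
  also have "(\<Sum>k<n. ?d k * \<eta>) = \<theta> * (ts n - ts 0) * \<eta>"
    by (simp only: sum_distrib_right[symmetric] sum_distrib_left[symmetric] sum_lessThan_telescope)
  also have "2 * ennreal (\<theta> * (ts n - ts 0) * \<eta>) = ennreal (2 * (\<theta> * (ts n - ts 0) * \<eta>))"
    by (subst ennreal_mult') auto
  also have "\<dots> \<le> ennreal (\<epsilon>\<^sup>2)" by (intro ennreal_leI \<epsilon>)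
  finally show "(\<integral>\<^sup>+w. ennreal (1 - exp (- (norm (isum H ts n w))\<^sup>2 / 2)) \<partial>\<Omega>) \<le> ennreal (\<epsilon>\<^sup>2)" .
qed

definition grid :: "real \<Rightarrow> real \<Rightarrow> nat \<Rightarrow> nat \<Rightarrow> real" where
  "grid s t n k = s + real k * (t - s) / real n"

definition rsum :: "(real \<Rightarrow> 'h \<Rightarrow>\<^sub>L 'h) \<Rightarrow> real \<Rightarrow> real \<Rightarrow> nat \<Rightarrow> 'w \<Rightarrow> 'h" where
  "rsum G s t n = isum (\<lambda>k. G (grid s t n k)) (grid s t n) n"

lemma grid_step: "grid s t n (Suc k) - grid s t n k = (t - s) / real n"
  by (simp add: grid_def algebra_simps add_divide_distrib diff_divide_distrib)

lemma grid_mono: "s \<le> t \<Longrightarrow> grid s t n k \<le> grid s t n (Suc k)"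
proof -
  assume "s \<le> t"
  then have "0 \<le> (t - s) / real n" by simp
  then show ?thesis using grid_step[of s t n k] by linarith
qed

lemma grid_in: "s \<le> t \<Longrightarrow> k \<le> n \<Longrightarrow> grid s t n k \<in> {s..t}"
proof -
  assume a: "s \<le> t" "k \<le> n"
  have "real k * (t - s) / real n \<le> t - s"
    using mult_right_mono[of "real k" "real n" "t - s"] a by (cases "n = 0") (auto simp: field_simps)
  then show ?thesis using a by (simp add: grid_def)
qed

lemma grid_0: "grid s t n 0 = s" by (simp add: grid_def)

lemma grid_n: "0 < n \<Longrightarrow> grid s t n n = t" by (simp add: grid_def)

lemma rsum_refine:
  fixes G :: "real \<Rightarrow> 'h \<Rightarrow>\<^sub>L 'h"
  assumes n: "n > 0" and m: "m > 0"
  shows "rsum G s t n w - rsum G s t (n * m) w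
    = isum (\<lambda>k. G (grid s t n (k div m)) - G (grid s t (n * m) k)) (grid s t (n * m)) (n * m) w"
proof -
  let ?g = "grid s t (n * m)"
  let ?D = "\<lambda>k. L (?g (Suc k)) w - L (?g k) w"
  have gm: "?g (i * m) = grid s t n i" for i using n m by (simp add: grid_def)
  have tele: "L (grid s t n (Suc i)) w - L (grid s t n i) w = (\<Sum>k=i*m..<i*m+m. ?D k)" for i
    using sum_Suc_diff'[of "i * m" "i * m + m" "\<lambda>k. L (?g k) w"] gm[of i] gm[of "Suc i"] by (simp add: add.commute)
  have "rsum G s t n w = (\<Sum>i<n. \<Sum>k=i*m..<i*m+m. G (grid s t n (k div m)) (?D k))"
    unfolding rsum_def isum_def
  proof (intro sum.cong refl)
    fix i
    have "(\<Sum>k=i*m..<i*m+m. G (grid s t n (k div m)) (?D k)) = (\<Sum>k=i*m..<i*m+m. G (grid s t n i) (?D k))"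
    proof (intro sum.cong refl)
      fix k assume "k \<in> {i*m..<i*m+m}"
      then have "k div m = i" using m by (intro div_nat_eqI) (auto simp: mult.commute)
      then show "G (grid s t n (k div m)) (?D k) = G (grid s t n i) (?D k)" by simp
    qed
    then show "G (grid s t n i) (L (grid s t n (Suc i)) w - L (grid s t n i) w) = (\<Sum>k=i*m..<i*m+m. G (grid s t n (k div m)) (?D k))"
      unfolding tele by (simp only: blinfun.sum_right)
  qed
  also have "\<dots> = (\<Sum>k<n*m. G (grid s t n (k div m)) (?D k))" by (rule sum.nat_group)
  finally show ?thesis unfolding rsum_def isum_def by (simp only: blinfun.diff_left sum_subtractf)
qed

lemma dom_modulus:
  fixes G :: "real \<Rightarrow> 'h \<Rightarrow>\<^sub>L 'h"
  assumes G: "\<And>x. continuous_on {s..t} (\<lambda>r. G r x)" and K: "\<And>r. r \<in> {s..t} \<Longrightarrow> norm (G r) \<le> K" and \<eta>: "\<eta> > 0"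
  shows "\<exists>\<delta>>0. \<forall>r\<in>{s..t}. \<forall>r'\<in>{s..t}. \<bar>r - r'\<bar> \<le> \<delta> \<longrightarrow> dom (\<lambda>x. norm (G r x - G r' x)) \<le> ennreal \<eta>"
proof (rule ccontr)
  assume neg: "\<not> ?thesis"
  have "\<exists>r r'. r \<in> {s..t} \<and> r' \<in> {s..t} \<and> \<bar>r - r'\<bar> \<le> \<delta> \<and> \<not> dom (\<lambda>x. norm (G r x - G r' x)) \<le> ennreal \<eta>" if "\<delta> > 0" for \<delta>
    using neg that by blast
  from this[of "inverse (real (Suc _))"]
  have "\<exists>r r'. r \<in> {s..t} \<and> r' \<in> {s..t} \<and> \<bar>r - r'\<bar> \<le> inverse (real (Suc j)) \<and> \<not> dom (\<lambda>x. norm (G r x - G r' x)) \<le> ennreal \<eta>" for j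
    by simp
  then obtain r r' where r: "\<And>j. r j \<in> {s..t}" "\<And>j. r' j \<in> {s..t}" "\<And>j. \<bar>r j - r' j\<bar> \<le> inverse (real (Suc j))"
    and gt: "\<And>j. \<not> dom (\<lambda>x. norm (G (r j) x - G (r' j) x)) \<le> ennreal \<eta>" by metis
  have "(\<lambda>j. dom (\<lambda>x. norm (G (r j) x - G (r' j) x))) \<longlonglongrightarrow> 0"
  proof (rule dom_tendsto)
    show "norm (G (r j) x - G (r' j) x) \<le> (2 * \<bar>K\<bar>) * norm x" for j x
    proof -
      have "norm (G q x) \<le> \<bar>K\<bar> * norm x" if "q \<in> {s..t}" for q
        by (rule order_trans[OF norm_blinfun mult_right_mono]) (use K[OF that] in auto)
      from this[OF r(1)[of j]] this[OF r(2)[of j]] show ?thesis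
        using norm_triangle_ineq4[of "G (r j) x" "G (r' j) x"] by linarith
    qed
    fix x
    have d0: "(\<lambda>j. dist (r j) (r' j)) \<longlonglongrightarrow> 0"
      by (rule tendsto_sandwich[OF _ _ tendsto_const LIMSEQ_inverse_real_of_nat])
         (use r(3) in \<open>auto simp: dist_real_def\<close>)
    have "uniformly_continuous_on {s..t} (\<lambda>r. G r x)" by (intro compact_uniformly_continuous G) simp
    then have "(\<lambda>j. dist (G (r j) x) (G (r' j) x)) \<longlonglongrightarrow> 0"
      unfolding uniformly_continuous_on_sequentially using r(1,2) d0 by blast
    then show "(\<lambda>j. norm (G (r j) x - G (r' j) x)) \<longlonglongrightarrow> 0" by (simp only: dist_norm)
  qed auto
  then have "\<forall>\<^sub>F j in sequentially. dom (\<lambda>x. norm (G (r j) x - G (r' j) x)) < ennreal \<eta>"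
    using \<eta> by (intro order_tendstoD(2)) auto
  then obtain j where "dom (\<lambda>x. norm (G (r j) x - G (r' j) x)) < ennreal \<eta>" by (auto simp: eventually_sequentially)
  then show False using gt[of j] by simp
qed

lemma ex_stoch_int:
  fixes G :: "real \<Rightarrow> 'h \<Rightarrow>\<^sub>L 'h"
  assumes st: "s \<le> t" and G: "\<And>x. continuous_on {s..t} (\<lambda>r. G r x)" and K: "\<And>r. r \<in> {s..t} \<Longrightarrow> norm (G r) \<le> K"
  shows "\<exists>Y. is_stoch_int \<Omega> L G s t Y"
proof -
  have rm [measurable]: "rsum G s t n \<in> borel_measurable \<Omega>" for n unfolding rsum_def by measurable
  have "\<exists>N. \<forall>m\<ge>N. \<forall>n\<ge>N. mean1 \<Omega> (\<lambda>w. rsum G s t m w - rsum G s t n w) \<le> ennreal \<epsilon>" if "\<epsilon> > 0" for \<epsilon>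
  proof -
    define q where "q = \<theta> * (t - s) + 1"
    define \<eta> where "\<eta> = (\<epsilon> / 4)\<^sup>2 / (2 * q)"
    have p: "q > 0" using \<theta>_nonneg st by (simp add: q_def add_nonneg_pos)
    have \<eta>: "\<eta> > 0" "2 * (\<theta> * (t - s) * \<eta>) \<le> (\<epsilon> / 4)\<^sup>2"
    proof -
      show "\<eta> > 0" using that p by (simp add: \<eta>_def)
      then have "\<theta> * (t - s) * \<eta> \<le> q * \<eta>" by (intro mult_right_mono) (auto simp: q_def)
      also have "\<dots> = (\<epsilon> / 4)\<^sup>2 / 2" using p by (simp add: \<eta>_def)
      finally show "2 * (\<theta> * (t - s) * \<eta>) \<le> (\<epsilon> / 4)\<^sup>2" by simp
    qed
    obtain \<delta> where \<delta>: "\<delta> > 0" "\<And>r r'. r \<in> {s..t} \<Longrightarrow> r' \<in> {s..t} \<Longrightarrow> \<bar>r - r'\<bar> \<le> \<delta> \<Longrightarrow> dom (\<lambda>x. norm (G r x - G r' x)) \<le> ennreal \<eta>"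
      using dom_modulus[OF G K \<eta>(1)] by blast
    obtain N where N: "(t - s) / \<delta> < real N" using reals_Archimedean2 by blast
    have ref: "mean1 \<Omega> (\<lambda>w. rsum G s t n w - rsum G s t (n * m) w) \<le> ennreal (\<epsilon> / 2)" if n: "n \<ge> Suc N" and m: "m > 0" for n m
    proof -
      let ?H = "\<lambda>k. G (grid s t n (k div m)) - G (grid s t (n * m) k)"
      have n0: "n > 0" using n by simp
      have "mean1 \<Omega> (isum ?H (grid s t (n * m)) (n * m)) \<le> ennreal (2 * (\<epsilon> / 4))"
      proof (rule isum_mean1)
        show "2 * (\<theta> * (grid s t (n * m) (n * m) - grid s t (n * m) 0) * \<eta>) \<le> (\<epsilon> / 4)\<^sup>2"
          using \<eta>(2) n0 m by (simp add: grid_0 grid_n)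
        fix k assume k: "k < n * m"
        have kd: "k div m < n" using k by (simp add: less_mult_imp_div_less)
        have in1: "grid s t n (k div m) \<in> {s..t}" "grid s t (n * m) k \<in> {s..t}"
          using kd k by (intro grid_in st; simp)+
        have e: "grid s t (n * m) k = grid s t n (k div m) + real (k mod m) * (t - s) / real (n * m)"
        proof -
          have "real k = real (k div m) * real m + real (k mod m)"
            by (metis div_mult_mod_eq of_nat_add of_nat_mult)
          then show ?thesis using n0 m by (simp add: grid_def add_divide_distrib distrib_right)
        qed
        have "real (k mod m) * (t - s) / real (n * m) \<le> (t - s) / real n"
        proof -
          have "real (k mod m) * (t - s) \<le> real m * (t - s)" using m st by (intro mult_right_mono) auto
          then have "real (k mod m) * (t - s) / real m \<le> t - s" using m by (simp add: pos_divide_le_eq mult.commute)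
          from divide_right_mono[OF this, of "real n"] show ?thesis by (simp add: mult.commute)
        qed
        also have "\<dots> \<le> \<delta>"
        proof -
          have "(t - s) / \<delta> < real n" using N n by simp
          then show ?thesis using \<delta>(1) n0 by (simp add: field_simps)
        qed
        finally have "\<bar>grid s t n (k div m) - grid s t (n * m) k\<bar> \<le> \<delta>"
          unfolding e using st by (simp add: abs_of_nonneg)
        then show "dom (\<lambda>x. norm (?H k x)) \<le> ennreal \<eta>"
          using \<delta>(2)[OF in1] by (simp only: blinfun.diff_left)
      qed (use \<eta> \<open>\<epsilon> > 0\<close> grid_mono[OF st] in auto)
      then show ?thesis unfolding mean1_def rsum_refine[OF n0 m] by simp
    qed
    have "mean1 \<Omega> (\<lambda>w. rsum G s t m w - rsum G s t n w) \<le> ennreal \<epsilon>" if "m \<ge> Suc N" "n \<ge> Suc N" for m n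
    proof -
      have "mean1 \<Omega> (\<lambda>w. rsum G s t m w - rsum G s t n w)
        \<le> mean1 \<Omega> (\<lambda>w. rsum G s t m w - rsum G s t (m * n) w) + mean1 \<Omega> (\<lambda>w. rsum G s t (m * n) w - rsum G s t n w)"
        by (rule mean1_triangle) measurable
      also have "\<dots> \<le> ennreal (\<epsilon> / 2) + ennreal (\<epsilon> / 2)"
        using ref[of m n] ref[of n m] that mean1_commute[of \<Omega> "rsum G s t (m * n)" "rsum G s t n"]
        by (intro add_mono) (auto simp: mult.commute)
      also have "\<dots> = ennreal \<epsilon>" using \<open>\<epsilon> > 0\<close> by (simp flip: ennreal_plus)
      finally show ?thesis .
    qed
    then show ?thesis by blast
  qed
  from mean1_complete[OF rm this] obtain Y where Y [measurable]: "Y \<in> borel_measurable \<Omega>"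
    and lim: "(\<lambda>n. mean1 \<Omega> (\<lambda>w. rsum G s t n w - Y w)) \<longlonglongrightarrow> 0" by blast
  then show ?thesis
    using mean1_tendsto_0_iff[of "\<lambda>n w. rsum G s t n w - Y w"] Y
    by (intro exI[of _ Y]) (simp add: is_stoch_int_def rsum_def isum_def grid_def)
qed

context
  fixes G :: "real \<Rightarrow> 'h \<Rightarrow>\<^sub>L 'h" and s t K :: real
  assumes st: "s \<le> t" and G: "\<And>x. continuous_on {s..t} (\<lambda>r. G r x)" and K: "\<And>r. r \<in> {s..t} \<Longrightarrow> norm (G r) \<le> K"
begin

lemma stoch_int: "is_stoch_int \<Omega> L G s t (stoch_int \<Omega> L G s t)"
  unfolding stoch_int_def by (rule someI_ex[OF ex_stoch_int[OF st G K]])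

lemma stoch_int_measurable: "stoch_int \<Omega> L G s t \<in> borel_measurable \<Omega>"
  using stoch_int by (simp add: is_stoch_int_def)

lemma stoch_int_lim: "(\<lambda>n. mean1 \<Omega> (\<lambda>w. rsum G s t n w - stoch_int \<Omega> L G s t w)) \<longlonglongrightarrow> 0"
proof -
  note [measurable] = stoch_int_measurable
  have [measurable]: "rsum G s t n \<in> borel_measurable \<Omega>" for n unfolding rsum_def by measurable
  show ?thesis
    using stoch_int by (subst mean1_tendsto_0_iff) (auto simp: is_stoch_int_def rsum_def isum_def grid_def)
qed

lemma stoch_int_cf: "(\<integral>w. cis (inner u (stoch_int \<Omega> L G s t w)) \<partial>\<Omega>) = exp (complex_of_real \<theta> * (lint {s..t} G u))"
proof (rule LIMSEQ_unique)
  have rm: "rsum G s t n \<in> borel_measurable \<Omega>" for n unfolding rsum_def by measurable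
  show "(\<lambda>n. \<integral>w. cis (inner u (rsum G s t n w)) \<partial>\<Omega>) \<longlonglongrightarrow> (\<integral>w. cis (inner u (stoch_int \<Omega> L G s t w)) \<partial>\<Omega>)"
    by (rule cf_tendsto_mean1[OF rm stoch_int_measurable stoch_int_lim])
  have "(\<integral>w. cis (inner u (rsum G s t n w)) \<partial>\<Omega>)
     = exp (complex_of_real \<theta> * (\<Sum>k<n. complex_of_real ((t - s) / real n) * lam (adj (G (s + real k * (t - s) / real n)) u)))" for n
    unfolding rsum_def by (subst isum_cf) (auto simp: grid_step grid_mono[OF st] sum_distrib_left mult.assoc grid_def[symmetric])
  then show "(\<lambda>n. \<integral>w. cis (inner u (rsum G s t n w)) \<partial>\<Omega>) \<longlonglongrightarrow> exp (complex_of_real \<theta> * (lint {s..t} G u))"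
    by (simp only:) (intro tendsto_intros riemann_sum_tendsto st continuous_lam_adj[OF G K])
qed

lemma stoch_int_mean1:
  assumes g: "0 \<le> g" "\<And>r. r \<in> {s..t} \<Longrightarrow> norm (G r) \<le> g" and \<epsilon>: "\<epsilon> > 0" "2 * (\<theta> * (t - s) * (C * (g + g\<^sup>2))) \<le> \<epsilon>\<^sup>2"
  shows "mean1 \<Omega> (stoch_int \<Omega> L G s t) \<le> ennreal (2 * \<epsilon>)"
proof (rule LIMSEQ_le_const)
  note [measurable] = stoch_int_measurable
  have rm [measurable]: "rsum G s t n \<in> borel_measurable \<Omega>" for n unfolding rsum_def by measurable
  show "(\<lambda>n. ennreal (2 * \<epsilon>) + mean1 \<Omega> (\<lambda>w. rsum G s t n w - stoch_int \<Omega> L G s t w)) \<longlonglongrightarrow> ennreal (2 * \<epsilon>)"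
    using tendsto_add[OF tendsto_const stoch_int_lim] by simp
  have "mean1 \<Omega> (stoch_int \<Omega> L G s t) \<le> ennreal (2 * \<epsilon>) + mean1 \<Omega> (\<lambda>w. rsum G s t n w - stoch_int \<Omega> L G s t w)" if n: "n \<ge> 1" for n
  proof -
    have r: "mean1 \<Omega> (rsum G s t n) \<le> ennreal (2 * \<epsilon>)"
      unfolding rsum_def
    proof (rule isum_mean1)
      show "0 \<le> C * (g + g\<^sup>2)" using C_nonneg g(1) by simp
      show "2 * (\<theta> * (grid s t n n - grid s t n 0) * (C * (g + g\<^sup>2))) \<le> \<epsilon>\<^sup>2"
        using \<epsilon>(2) n by (simp add: grid_0 grid_n)
      fix k assume "k < n"
      then have "norm (G (grid s t n k)) \<le> g" by (intro g grid_in st) simp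
      then show "dom (\<lambda>x. norm (G (grid s t n k) x)) \<le> ennreal (C * (g + g\<^sup>2))"
        by (intro dom_le g(1) norm_ge_zero order_trans[OF norm_blinfun mult_right_mono])
    qed (use \<epsilon> grid_mono[OF st] in auto)
    have "mean1 \<Omega> (\<lambda>w. stoch_int \<Omega> L G s t w - 0) \<le> mean1 \<Omega> (\<lambda>w. stoch_int \<Omega> L G s t w - rsum G s t n w) + mean1 \<Omega> (\<lambda>w. rsum G s t n w - 0)"
      by (rule mean1_triangle) measurable
    also have "\<dots> \<le> mean1 \<Omega> (\<lambda>w. rsum G s t n w - stoch_int \<Omega> L G s t w) + ennreal (2 * \<epsilon>)"
      using r mean1_commute[of \<Omega> "stoch_int \<Omega> L G s t" "rsum G s t n"] by (intro add_mono) auto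
    finally show ?thesis by (simp add: add.commute)
  qed
  then show "\<exists>N. \<forall>n\<ge>N. mean1 \<Omega> (stoch_int \<Omega> L G s t) \<le> ennreal (2 * \<epsilon>) + mean1 \<Omega> (\<lambda>w. rsum G s t n w - stoch_int \<Omega> L G s t w)" by blast
qed

end

end

section \<open>Stationary laws\<close>

lemma set_integrable_exp_atMost:
  fixes \<omega> t :: real assumes \<omega>: "\<omega> > 0"
  shows "set_integrable lborel {..t} (\<lambda>r. exp (- \<omega> * (t - r)))"
proof -
  interpret E: prob_space "density lborel (exponential_density \<omega>)" using \<omega> by (rule prob_space_exponential_density)
  have "(\<integral>\<^sup>+x. ennreal (exponential_density \<omega> x) \<partial>lborel) = 1"
    using E.emeasure_space_1 by (simp add: emeasure_density)
  then have "integrable lborel (exponential_density \<omega>)"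
    using \<omega> by (intro integrableI_nonneg) (auto simp: exponential_density_def)
  then have "integrable lborel (\<lambda>r. (1 / \<omega>) * exponential_density \<omega> (t + (-1) * r))"
    by (intro integrable_mult_right lborel_integrable_real_affine) auto
  also have "(\<lambda>r. (1 / \<omega>) * exponential_density \<omega> (t + (-1) * r)) = (\<lambda>r. indicator {..t} r *\<^sub>R exp (- \<omega> * (t - r)))"
    using \<omega> by (auto simp: fun_eq_iff exponential_density_def indicator_def algebra_simps)
  finally show ?thesis by (simp add: set_integrable_def)
qed

lemma char_functional_conv:
  assumes P: "prob_space \<mu>" "prob_space \<nu>" and s [measurable_cong]: "sets \<mu> = sets borel" "sets \<nu> = sets borel"
  shows "char_functional (conv_meas \<mu> \<nu>) h = char_functional \<mu> h * char_functional \<nu> h"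
proof -
  have "char_functional (conv_meas \<mu> \<nu>) h = (\<integral>p. cis (inner h (fst p)) * cis (inner h (snd p)) \<partial>(\<mu> \<Otimes>\<^sub>M \<nu>))"
    unfolding char_functional_def conv_meas_def
    by (subst integral_distr) (auto simp: split_beta inner_add_right cis_mult)
  also have "\<dots> = char_functional \<mu> h * char_functional \<nu> h"
    unfolding char_functional_def by (rule integral_pair_prod[OF P]) auto
  finally show ?thesis .
qed

lemma conv_pow_props:
  fixes \<mu> :: "'h::{real_inner,complete_space,second_countable_topology} measure"
  assumes P: "prob_space \<mu>" and s [measurable_cong]: "sets \<mu> = sets borel"
  shows "prob_space (conv_pow \<mu> n)" "sets (conv_pow \<mu> n) = sets borel" "char_functional (conv_pow \<mu> n) h = char_functional \<mu> h ^ n"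
proof -
  have "prob_space (conv_pow \<mu> n) \<and> sets (conv_pow \<mu> n) = sets borel \<and> char_functional (conv_pow \<mu> n) h = char_functional \<mu> h ^ n"
  proof (induction n)
    case 0
    then show ?case by (simp add: prob_space_return char_functional_def integral_return)
  next
    case (Suc n)
    then have [measurable_cong]: "sets (conv_pow \<mu> n) = sets borel" by simp
    interpret A: prob_space \<mu> by fact
    interpret B: prob_space "conv_pow \<mu> n" using Suc by simp
    interpret AB: pair_prob_space \<mu> "conv_pow \<mu> n" ..
    have "prob_space (conv_meas \<mu> (conv_pow \<mu> n))"
      unfolding conv_meas_def by (rule AB.prob_space_distr) measurable
    then show ?case using Suc P s by (simp add: char_functional_conv) (simp add: conv_meas_def)
  qed
  then show "prob_space (conv_pow \<mu> n)" "sets (conv_pow \<mu> n) = sets borel" "char_functional (conv_pow \<mu> n) h = char_functional \<mu> h ^ n"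
    by auto
qed

context levy_triplet
begin

lemma set_integrable_lam_adj:
  fixes G :: "real \<Rightarrow> 'h \<Rightarrow>\<^sub>L 'h"
  assumes G: "\<And>x. continuous_on {..t} (\<lambda>r. G r x)" and K: "\<And>r. r \<le> t \<Longrightarrow> norm (G r) \<le> K * exp (- \<omega> * (t - r))"
    and K0: "0 \<le> K" and \<omega>: "\<omega> > 0"
  shows "set_integrable lborel {..t} (\<lambda>r. lam (adj (G r) u))"
proof (rule set_integrable_bound[where f="\<lambda>r. C * (K * norm u + (K * norm u)\<^sup>2) * exp (- \<omega> * (t - r))"])
  show "set_integrable lborel {..t} (\<lambda>r. C * (K * norm u + (K * norm u)\<^sup>2) * exp (- \<omega> * (t - r)))"
    by (intro set_integrable_mult_right set_integrable_exp_atMost \<omega>)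
  have e1: "exp (- \<omega> * (t - r)) \<le> 1" if "r \<le> t" for r using that \<omega> by (simp add: mult_nonneg_nonneg)
  have K': "norm (G r) \<le> K" if "r \<in> {..t}" for r
    using K[of r] mult_left_mono[OF e1[of r] K0] that by simp
  have "continuous_on {..t} (\<lambda>r. lam (adj (G r) u))" by (rule continuous_lam_adj[OF G K'])
  then show "set_borel_measurable lborel {..t} (\<lambda>r. lam (adj (G r) u))"
    unfolding set_borel_measurable_def using borel_measurable_continuous_on_indicator[of "{..t}"] by simp
  have "norm (lam (adj (G r) u)) \<le> norm (C * (K * norm u + (K * norm u)\<^sup>2) * exp (- \<omega> * (t - r)))" if r: "r \<le> t" for r
  proof -
    let ?E = "exp (- \<omega> * (t - r))"
    have n: "norm (adj (G r) u) \<le> K * norm u * ?E"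
      using order_trans[OF norm_adj_le mult_right_mono[OF K[OF r] norm_ge_zero]] by (simp add: mult_ac)
    have "(norm (adj (G r) u))\<^sup>2 \<le> (K * norm u * ?E)\<^sup>2" by (intro power_mono n) simp
    also have "\<dots> = (K * norm u)\<^sup>2 * (?E * ?E)" by (simp add: power2_eq_square)
    also have "\<dots> \<le> (K * norm u)\<^sup>2 * (?E * 1)" by (intro mult_left_mono e1[OF r]) auto
    finally have n2: "(norm (adj (G r) u))\<^sup>2 \<le> (K * norm u)\<^sup>2 * ?E" by simp
    have "norm (lam (adj (G r) u)) \<le> C * (norm (adj (G r) u) + (norm (adj (G r) u))\<^sup>2)" by (rule norm_lam_le)
    also have "\<dots> \<le> C * (K * norm u * ?E + (K * norm u)\<^sup>2 * ?E)"
      by (intro mult_left_mono add_mono n n2 C_nonneg)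
    also have "\<dots> = C * (K * norm u + (K * norm u)\<^sup>2) * ?E" by (simp add: algebra_simps)
    finally show ?thesis by simp
  qed
  then show "AE r in lborel. r \<in> {..t} \<longrightarrow> norm (lam (adj (G r) u)) \<le> norm (C * (K * norm u + (K * norm u)\<^sup>2) * exp (- \<omega> * (t - r)))"
    by (intro AE_I2) auto
qed

end

context levy_increments
begin

text \<open>The laws of the integrals over unit intervals are realised independently on a product space;
  geometric decay makes the series converge almost surely.\<close>

lemma ex_stationary_law:
  fixes G :: "real \<Rightarrow> 'h \<Rightarrow>\<^sub>L 'h"
  assumes G: "\<And>x. continuous_on {..t} (\<lambda>r. G r x)" and K: "\<And>r. r \<le> t \<Longrightarrow> norm (G r) \<le> K * exp (- \<omega> * (t - r))"
    and K0: "0 \<le> K" and \<omega>: "\<omega> > 0"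
  shows "\<exists>\<nu>. prob_space \<nu> \<and> sets \<nu> = sets borel \<and>
    (\<forall>u. char_functional \<nu> u = cis (inner u m) * exp (complex_of_real \<theta> * (lint {..t} G u)))"
proof -
  have Gs: "continuous_on {a..b} (\<lambda>r. G r x)" if "b \<le> t" for a b x
    using that by (intro continuous_on_subset[OF G]) auto
  have e1: "exp (- \<omega> * (t - r)) \<le> 1" if "r \<le> t" for r using that \<omega> by (simp add: mult_nonneg_nonneg)
  have K': "norm (G r) \<le> K" if "r \<le> t" for r
    using K[of r] mult_left_mono[OF e1[of r] K0] that by simp
  define A where "A j = t - real (Suc j)" for j
  define B where "B j = t - real j" for j
  have AB: "A j \<le> B j" "B j \<le> t" "B j - A j = 1" for j by (auto simp: A_def B_def)
  define W where "W j = stoch_int \<Omega> L G (A j) (B j)" for j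
  have W [measurable]: "W j \<in> borel_measurable \<Omega>" for j
    unfolding W_def by (rule stoch_int_measurable[OF AB(1) Gs[OF AB(2)], where K=K]) (use AB(2)[of j] K' in auto)
  have Wcf: "(\<integral>\<omega>. cis (inner u (W j \<omega>)) \<partial>\<Omega>) = exp (complex_of_real \<theta> * (lint {A j..B j} G u))" for j u
    unfolding W_def by (rule stoch_int_cf[OF AB(1) Gs[OF AB(2)], where K=K]) (use AB(2)[of j] K' in auto)
  define D where "D = 2 * \<theta> * C * (K + K\<^sup>2) + 1"
  define q where "q = exp (- \<omega> / 2)"
  have D: "D > 0" using \<theta>_nonneg C_nonneg K0 by (simp add: D_def add_nonneg_pos)
  have q: "0 < q" "q < 1" using \<omega> by (auto simp: q_def)
  have qj: "(q ^ j)\<^sup>2 = exp (- \<omega> * real j)" for j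
    by (simp add: q_def exp_of_nat_mult[symmetric] power2_eq_square exp_add[symmetric] mult.commute)
  have Wm: "mean1 \<Omega> (W j) \<le> ennreal (2 * (sqrt D * q ^ j))" for j
    unfolding W_def
  proof (rule stoch_int_mean1[OF AB(1) Gs[OF AB(2)], where K=K and g="K * exp (- \<omega> * real j)"])
    let ?E = "exp (- \<omega> * real j)"
    have E: "0 \<le> ?E" "?E \<le> 1" using \<omega> by auto
    show "norm (G r) \<le> K" if "r \<in> {A j..B j}" for r using that AB(2)[of j] K' by auto
    show "0 \<le> K * ?E" using K0 by simp
    show "0 < sqrt D * q ^ j" using D q by simp
    show "norm (G r) \<le> K * ?E" if r: "r \<in> {A j..B j}" for r
    proof -
      have "r \<le> t" "real j \<le> t - r" using r by (auto simp: B_def)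
      then have "exp (- \<omega> * (t - r)) \<le> ?E" using \<omega> by simp
      then show ?thesis using K[OF \<open>r \<le> t\<close>] mult_left_mono[of "exp (- \<omega> * (t - r))" ?E K] K0 by simp
    qed
    have "(K * ?E)\<^sup>2 = K\<^sup>2 * (?E * ?E)" by (simp add: power2_eq_square)
    also have "\<dots> \<le> K\<^sup>2 * (?E * 1)" using E by (intro mult_left_mono) auto
    finally have "K * ?E + (K * ?E)\<^sup>2 \<le> (K + K\<^sup>2) * ?E" by (simp add: algebra_simps)
    then have "2 * \<theta> * C * (K * ?E + (K * ?E)\<^sup>2) \<le> 2 * \<theta> * C * ((K + K\<^sup>2) * ?E)"
      using \<theta>_nonneg C_nonneg by (intro mult_left_mono) auto
    also have "\<dots> \<le> D * ?E" using E(1) by (simp add: D_def algebra_simps)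
    also have "\<dots> = (sqrt D * q ^ j)\<^sup>2" using D by (simp add: power_mult_distrib qj)
    finally show "2 * (\<theta> * (B j - A j) * (C * (K * ?E + (K * ?E)\<^sup>2))) \<le> (sqrt D * q ^ j)\<^sup>2"
      by (simp add: AB(3) mult.assoc)
  qed
  define \<rho> where "\<rho> j = distr \<Omega> borel (W j)" for j
  have P\<rho>: "prob_space (\<rho> j)" for j unfolding \<rho>_def by (rule prob_space_distr) (rule W)
  have s\<rho> [measurable_cong, simp]: "sets (\<rho> j) = sets borel" for j by (simp add: \<rho>_def)
  interpret \<rho>: product_prob_space \<rho> "UNIV :: nat set"
    by (intro product_prob_spaceI P\<rho>)
  let ?P = "PiM UNIV \<rho>"
  have PP: "prob_space ?P" by (rule prob_space_PiM) (rule P\<rho>)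
  have c [measurable]: "(\<lambda>p. p j) \<in> measurable ?P borel" for j
    using measurable_component_singleton[of j UNIV \<rho>] by simp
  define S where "S n p = (\<Sum>j<n. p j)" for n :: nat and p :: "nat \<Rightarrow> 'h"
  have Sm [measurable]: "S n \<in> borel_measurable ?P" for n unfolding S_def by measurable
  have pj: "mean1 ?P (\<lambda>p. p j) = mean1 \<Omega> (W j)" for j
  proof -
    have "mean1 ?P (\<lambda>p. p j) = (\<integral>\<^sup>+x. ennreal (min 1 (norm x)) \<partial>distr ?P (\<rho> j) (\<lambda>p. p j))"
      unfolding mean1_def
    proof (rule nn_integral_distr[symmetric])
      show "(\<lambda>p. p j) \<in> measurable ?P (\<rho> j)" by (rule measurable_component_singleton) simp
      show "(\<lambda>x. ennreal (min 1 (norm x))) \<in> borel_measurable (distr ?P (\<rho> j) (\<lambda>p. p j))"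
        unfolding measurable_cong_sets[OF trans[OF sets_distr s\<rho>] refl] by measurable
    qed
    also have "distr ?P (\<rho> j) (\<lambda>p. p j) = \<rho> j" by (rule \<rho>.PiM_component) simp
    also have "(\<integral>\<^sup>+x. ennreal (min 1 (norm x)) \<partial>\<rho> j) = mean1 \<Omega> (W j)"
      unfolding \<rho>_def mean1_def by (subst nn_integral_distr) auto
    finally show ?thesis .
  qed
  have "(\<Sum>j. mean1 ?P (\<lambda>p. S (Suc j) p - S j p)) \<le> (\<Sum>j. ennreal (2 * (sqrt D * q ^ j)))"
    by (intro suminf_le summableI) (simp add: S_def pj Wm)
  also have "\<dots> < \<infinity>"
    using D q by (subst suminf_ennreal2) (auto intro!: summable_mult summable_geometric)
  finally obtain Y where Y [measurable]: "Y \<in> borel_measurable ?P" and lim: "AE p in ?P. (\<lambda>n. S n p) \<longlonglongrightarrow> Y p"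
    using prob_space.AE_convergent_if_mean1_summable[OF PP, of S] Sm by blast
  define I where "I n u = (lint {B n..t} G u)" for n u
  have int: "set_integrable lborel {..t} (\<lambda>r. lam (adj (G r) u))" for u
    by (rule set_integrable_lam_adj[OF G K K0 \<omega>])
  have Scf: "(\<integral>p. cis (inner u (S n p)) \<partial>?P) = exp (complex_of_real \<theta> * I n u)" for n u
  proof -
    have "(\<integral>p. cis (inner u (S n p)) \<partial>?P) = (\<integral>p. (\<Prod>j\<in>{..<n}. cis (inner u (restrict p {..<n} j))) \<partial>?P)"
      by (simp add: S_def inner_sum_right cis_sum)
    also have "\<dots> = (\<integral>x. (\<Prod>j\<in>{..<n}. cis (inner u (x j))) \<partial>distr ?P (PiM {..<n} \<rho>) (\<lambda>p. restrict p {..<n}))"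
    proof (rule integral_distr[symmetric])
      have "(\<lambda>x. x j) \<in> measurable (PiM {..<n} \<rho>) borel" if "j \<in> {..<n}" for j
        using measurable_component_singleton[OF that, of \<rho>] unfolding measurable_cong_sets[OF refl s\<rho>] .
      then show "(\<lambda>x. \<Prod>j\<in>{..<n}. cis (inner u (x j))) \<in> borel_measurable (PiM {..<n} \<rho>)"
        by (intro borel_measurable_prod measurable_compose[OF _ measurable_compose[OF inner_measurable_borel cis_measurable]])
    qed (rule measurable_restrict_subset, simp)
    also have "distr ?P (PiM {..<n} \<rho>) (\<lambda>p. restrict p {..<n}) = PiM {..<n} \<rho>"
      by (rule \<rho>.distr_PiM_restrict_finite) auto
    also have "(\<integral>x. (\<Prod>j\<in>{..<n}. cis (inner u (x j))) \<partial>PiM {..<n} \<rho>) = (\<Prod>j\<in>{..<n}. \<integral>x. cis (inner u x) \<partial>\<rho> j)"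
    proof (rule \<rho>.product_integral_prod)
      fix j
      have "(\<lambda>x. cis (inner u x)) \<in> borel_measurable (\<rho> j)"
        unfolding measurable_cong_sets[OF s\<rho> refl] by measurable
      then show "integrable (\<rho> j) (\<lambda>x. cis (inner u x))"
        by (intro finite_measure.integrable_const_bound[OF prob_space.finite_measure[OF P\<rho>], where B=1]) auto
    qed simp
    also have "\<dots> = (\<Prod>j\<in>{..<n}. exp (complex_of_real \<theta> * (lint {A j..B j} G u)))"
      unfolding \<rho>_def by (intro prod.cong refl) (subst integral_distr, auto simp: Wcf)
    also have "\<dots> = exp (complex_of_real \<theta> * I n u)"
    proof (induction n)
      case 0
      have "I 0 u = 0" unfolding I_def set_lebesgue_integral_def
      proof (rule integral_eq_zero_AE)
        show "AE r in lborel. indicat_real {B 0..t} r *\<^sub>R lam (adj (G r) u) = 0"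
          using AE_lborel_singleton[of t] by eventually_elim (auto simp: B_def indicator_def)
      qed
      then show ?case by simp
    next
      case (Suc n)
      have "{B (Suc n)..t} = {A n..B n} \<union> {B n..t}" using AB[of n] by (auto simp: A_def B_def)
      moreover have "(\<integral>r\<in>{A n..B n} \<union> {B n..t}. lam (adj (G r) u) \<partial>lborel)
        = (lint {A n..B n} G u) + (lint {B n..t} G u)"
      proof (rule set_integral_Un_AE)
        show "AE x in lborel. \<not> (x \<in> {A n..B n} \<and> x \<in> {B n..t})"
          using AE_lborel_singleton[of "B n"] by eventually_elim auto
      qed (use AB(2)[of n] in \<open>auto intro!: set_integrable_subset[OF int]\<close>)
      ultimately have "I (Suc n) u = (lint {A n..B n} G u) + I n u" by (simp add: I_def)
      then show ?case using Suc by (simp add: exp_add distrib_left mult.commute)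
    qed
    finally show ?thesis .
  qed
  have Ilim: "(\<lambda>n. I n u) \<longlonglongrightarrow> (lint {..t} G u)" for u
  proof -
    have "((\<lambda>a. \<integral>r\<in>{a..t}. lam (adj (G r) u) \<partial>lborel) \<longlongrightarrow> (lint {..t} G u)) at_bot"
      by (rule tendsto_set_lebesgue_integral_at_bot[OF _ int]) simp
    moreover have "filterlim B at_bot sequentially"
      unfolding B_def by (rule filterlim_at_bot_mono[OF filterlim_uminus_at_top[THEN iffD1, OF filterlim_tendsto_add_at_top[OF tendsto_const[of "- t"] filterlim_real_sequentially]]]) auto
    ultimately show ?thesis unfolding I_def by (rule filterlim_compose)
  qed
  have Ycf: "(\<integral>p. cis (inner u (Y p)) \<partial>?P) = exp (complex_of_real \<theta> * (lint {..t} G u))" for u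
  proof (rule LIMSEQ_unique)
    show "(\<lambda>n. \<integral>p. cis (inner u (S n p)) \<partial>?P) \<longlonglongrightarrow> (\<integral>p. cis (inner u (Y p)) \<partial>?P)"
      by (rule prob_space.cf_tendsto_mean1[OF PP Sm Y prob_space.mean1_tendsto_if_AE[OF PP Sm Y lim]])
    show "(\<lambda>n. \<integral>p. cis (inner u (S n p)) \<partial>?P) \<longlonglongrightarrow> exp (complex_of_real \<theta> * (lint {..t} G u))"
      unfolding Scf by (intro tendsto_intros Ilim)
  qed
  define \<nu> where "\<nu> = distr ?P borel (\<lambda>p. m + Y p)"
  have "char_functional \<nu> u = cis (inner u m) * exp (complex_of_real \<theta> * (lint {..t} G u))" for u
  proof -
    have "char_functional \<nu> u = (\<integral>p. cis (inner u m) * cis (inner u (Y p)) \<partial>?P)"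
      unfolding char_functional_def \<nu>_def by (subst integral_distr) (auto simp: inner_add_right cis_mult)
    then show ?thesis by (simp add: Ycf)
  qed
  moreover have "prob_space \<nu>" unfolding \<nu>_def by (rule prob_space.prob_space_distr[OF PP]) measurable
  moreover have "sets \<nu> = sets borel" by (simp add: \<nu>_def)
  ultimately show ?thesis by blast
qed

end

section \<open>The periodic evolution system\<close>

lemma (in levy_increments) time_change:
  assumes "0 \<le> \<kappa>"
  shows "levy_increments e b R M v \<Omega> (\<lambda>t. L (\<kappa> * t)) (\<theta> * \<kappa>)"
proof
  show "indep_vars (\<lambda>_. borel) (\<lambda>i \<omega>. L (\<kappa> * ts (Suc i)) \<omega> - L (\<kappa> * ts i) \<omega>) {..<n}"
    if "\<And>i. i < n \<Longrightarrow> ts i \<le> ts (Suc i)" for ts :: "nat \<Rightarrow> real" and n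
    using L_indep[of n "\<lambda>i. \<kappa> * ts i"] that assms by (simp add: mult_left_mono)
  show "(\<integral>\<omega>. cis (inner u (L (\<kappa> * t) \<omega> - L (\<kappa> * s) \<omega>)) \<partial>\<Omega>) = exp (complex_of_real (\<theta> * \<kappa> * (t - s)) * lam u)"
    if "s \<le> t" for s t u
  proof -
    have "\<theta> * (\<kappa> * t - \<kappa> * s) = \<theta> * \<kappa> * (t - s)" by (simp add: algebra_simps)
    then show ?thesis using L_cf[of "\<kappa> * s" "\<kappa> * t" u] that assms by (simp only: mult_left_mono)
  qed
  show "0 \<le> \<theta> * \<kappa>" using assms \<theta>_nonneg by simp
qed measurable

lemma continuous_on_strong_apply:
  fixes H :: "real \<Rightarrow> 'a::real_normed_vector \<Rightarrow>\<^sub>L 'b::real_normed_vector"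
  assumes H: "\<And>x. continuous_on S (\<lambda>r. H r x)" and K: "\<And>r. r \<in> S \<Longrightarrow> norm (H r) \<le> K" and g: "continuous_on S g"
  shows "continuous_on S (\<lambda>r. H r (g r))"
  unfolding continuous_on_sequentially
proof (intro allI ballI impI, elim conjE)
  fix x a assume a: "a \<in> S" and x: "\<forall>n. x n \<in> S" and lim: "x \<longlonglongrightarrow> a"
  have "(g \<circ> x) \<longlonglongrightarrow> g a" using g a x lim unfolding continuous_on_sequentially by blast
  then have g0: "(\<lambda>n. K * norm (g (x n) - g a)) \<longlonglongrightarrow> 0"
    by (intro tendsto_mult_right_zero tendsto_norm_zero LIM_zero) (simp add: o_def)
  have "((\<lambda>r. H r (g a)) \<circ> x) \<longlonglongrightarrow> H a (g a)" using H[of "g a"] a x lim unfolding continuous_on_sequentially by blast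
  then have h0: "(\<lambda>n. norm (H (x n) (g a) - H a (g a))) \<longlonglongrightarrow> 0"
    by (intro tendsto_norm_zero LIM_zero) (simp add: o_def)
  have "(\<lambda>n. H (x n) (g (x n)) - H a (g a)) \<longlonglongrightarrow> 0"
  proof (rule Lim_null_comparison[OF always_eventually])
    show "(\<lambda>n. K * norm (g (x n) - g a) + norm (H (x n) (g a) - H a (g a))) \<longlonglongrightarrow> 0"
      using tendsto_add[OF g0 h0] by simp
    show "\<forall>n. norm (H (x n) (g (x n)) - H a (g a)) \<le> K * norm (g (x n) - g a) + norm (H (x n) (g a) - H a (g a))"
    proof
      fix n
      have "H (x n) (g (x n)) - H a (g a) = H (x n) (g (x n) - g a) + (H (x n) (g a) - H a (g a))"
        by (simp add: blinfun.diff_right)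
      also have "norm \<dots> \<le> norm (H (x n) (g (x n) - g a)) + norm (H (x n) (g a) - H a (g a))" by (rule norm_triangle_ineq)
      also have "norm (H (x n) (g (x n) - g a)) \<le> K * norm (g (x n) - g a)"
        using x by (intro order_trans[OF norm_blinfun mult_right_mono] K) auto
      finally show "norm (H (x n) (g (x n)) - H a (g a)) \<le> K * norm (g (x n) - g a) + norm (H (x n) (g a) - H a (g a))" by simp
    qed
  qed
  then show "((\<lambda>r. H r (g r)) \<circ> x) \<longlonglongrightarrow> H a (g a)" by (simp add: o_def LIM_zero_iff)
qed

lemma set_integral_atMost_shift:
  fixes g g' :: "real \<Rightarrow> 'a::{banach,second_countable_topology}"
  assumes "\<And>r. r \<le> t \<Longrightarrow> g' (r + T) = g r"
  shows "(\<integral>r\<in>{..t + T}. g' r \<partial>lborel) = (\<integral>r\<in>{..t}. g r \<partial>lborel)"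
proof -
  have "(\<integral>r\<in>{..t + T}. g' r \<partial>lborel) = (\<integral>r. indicator {..t + T} (T + 1 * r) *\<^sub>R g' (T + 1 * r) \<partial>lborel)"
    unfolding set_lebesgue_integral_def by (subst lborel_integral_real_affine[where c=1 and t=T]) auto
  also have "\<dots> = (\<integral>r\<in>{..t}. g r \<partial>lborel)"
    unfolding set_lebesgue_integral_def
    by (intro Bochner_Integration.integral_cong) (auto simp: indicator_def assms[symmetric] add.commute)
  finally show ?thesis .
qed

lemma bounded_if_continuous_periodic:
  fixes f :: "real \<Rightarrow> 'a::metric_space"
  assumes f: "continuous_on UNIV f" and T: "T > 0" and per: "\<And>t. f (t + T) = f t"
  shows "bounded (range f)"
proof -
  interpret periodic_fun_simple f T by standard (rule per)
  have "range f \<subseteq> f ` {0..T}"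
  proof safe
    fix r
    define k where "k = \<lfloor>r / T\<rfloor>"
    have "of_int k \<le> r / T" "r / T < of_int k + 1" unfolding k_def by linarith+
    then have "of_int k * T \<le> r" "r \<le> (of_int k + 1) * T" using T by (auto simp: field_simps)
    then have "r - of_int k * T \<in> {0..T}" by (auto simp: algebra_simps)
    moreover have "f r = f (r - of_int k * T)" using minus_of_int[of r k] by simp
    ultimately show "f r \<in> f ` {0..T}" by blast
  qed
  moreover have "compact (f ` {0..T})" by (intro compact_continuous_image continuous_on_subset[OF f]) auto
  ultimately show ?thesis using bounded_subset compact_imp_bounded by blast
qed

lemma char_functional_tendsto_1:
  assumes P: "prob_space \<mu>" and s [measurable_cong]: "sets \<mu> = sets borel" and y: "y \<longlonglongrightarrow> 0"
  shows "(\<lambda>n. char_functional \<mu> (y n)) \<longlonglongrightarrow> 1"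
proof -
  interpret prob_space \<mu> by fact
  have "(\<lambda>n. \<integral>x. cis (inner (y n) x) \<partial>\<mu>) \<longlonglongrightarrow> (\<integral>x. 1 \<partial>\<mu>)"
  proof (rule integral_dominated_convergence[where w="\<lambda>_. 1"])
    show "AE x in \<mu>. (\<lambda>n. cis (inner (y n) x)) \<longlonglongrightarrow> 1"
    proof (intro AE_I2)
      fix x :: 'a
      have "(\<lambda>n. inner (y n) x) \<longlonglongrightarrow> inner 0 x" by (intro tendsto_inner y tendsto_const)
      from tendsto_cis_real[OF this] show "(\<lambda>n. cis (inner (y n) x)) \<longlonglongrightarrow> 1" by simp
    qed
  qed auto
  then show ?thesis by (simp add: char_functional_def prob_space)
qed

locale mehler = levy_increments e b R M v \<Omega> L 1
  for e :: "nat \<Rightarrow> 'h::{real_inner,complete_space,second_countable_topology}" and b R M v and \<Omega> :: "'w measure" and L +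
  fixes f :: "real \<Rightarrow> 'h" and B :: "real \<Rightarrow> 'h \<Rightarrow>\<^sub>L 'h" and U :: "real \<Rightarrow> real \<Rightarrow> 'h \<Rightarrow>\<^sub>L 'h" and c \<omega> T :: real
  assumes f_cont: "continuous_on UNIV f"
    and B_strong: "\<And>x. continuous_on UNIV (\<lambda>r. B r x)"
    and B_bdd: "bounded (range (\<lambda>r. norm (B r)))"
    and U_comp: "\<And>t s r. r \<le> s \<Longrightarrow> s \<le> t \<Longrightarrow> U t s o\<^sub>L U s r = U t r"
    and U_strong: "\<And>x. continuous_on {(t, s). s \<le> t} (\<lambda>(t, s). U t s x)"
    and c_pos: "c > 0" and \<omega>_pos: "\<omega> > 0"
    and U_bound: "\<And>t s. s \<le> t \<Longrightarrow> norm (U t s) \<le> c * exp (- \<omega> * (t - s))"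
    and T_pos: "T > 0"
    and f_per: "\<And>t. f (t + T) = f t"
    and B_per: "\<And>t. B (t + T) = B t"
    and U_per: "\<And>t s. s \<le> t \<Longrightarrow> U (t + T) (s + T) = U t s"
begin

definition F :: "real \<Rightarrow> real \<Rightarrow> 'h" where "F t r = U t r (f r)"

abbreviation fint :: "real set \<Rightarrow> real \<Rightarrow> 'h \<Rightarrow> real" where
  "fint S t h \<equiv> (\<integral>r\<in>S. inner h (F t r) \<partial>lborel)"

definition G :: "real \<Rightarrow> real \<Rightarrow> 'h \<Rightarrow>\<^sub>L 'h" where "G t r = U t r o\<^sub>L B r"

lemma U_cont: "continuous_on {..t} (\<lambda>r. U t r x)"
proof -
  have "continuous_on {..t} (\<lambda>r. (\<lambda>(t, s). U t s x) (t, r))"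
    by (rule continuous_on_compose2[OF U_strong]) (auto intro!: continuous_intros)
  then show ?thesis by simp
qed

lemma U_bound': "r \<le> t \<Longrightarrow> norm (U t r) \<le> c"
proof -
  assume r: "r \<le> t"
  have "exp (- \<omega> * (t - r)) \<le> 1" using r \<omega>_pos by (simp add: mult_nonneg_nonneg)
  from mult_left_mono[OF this, of c] show ?thesis using U_bound[OF r] c_pos by linarith
qed

lemma U_decay: "s \<le> t \<Longrightarrow> norm (adj (U t s) h) \<le> c * exp (- \<omega> * (t - s)) * norm h"
  by (rule order_trans[OF norm_adj_le mult_right_mono[OF U_bound norm_ge_zero]])

lemma F_cont: "continuous_on {..t} (F t)"
  unfolding F_def[abs_def]
  by (rule continuous_on_strong_apply[where K=c, OF U_cont _ continuous_on_subset[OF f_cont]]) (auto intro: U_bound')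

lemma F_integrable: "S \<in> sets borel \<Longrightarrow> S \<subseteq> {..t} \<Longrightarrow> set_integrable lborel S (F t)"
proof -
  assume S [measurable]: "S \<in> sets borel" and St: "S \<subseteq> {..t}"
  obtain K where K: "\<And>r. norm (f r) \<le> K"
    using bounded_if_continuous_periodic[OF f_cont T_pos f_per] by (auto simp: bounded_iff)
  have K0: "0 \<le> K" using K[of 0] norm_ge_zero[of "f 0"] by linarith
  have [measurable]: "(\<lambda>r. indicator {..t} r *\<^sub>R F t r) \<in> borel_measurable borel"
    by (rule borel_measurable_continuous_on_indicator[OF _ F_cont]) simp
  have e: "(\<lambda>r. indicator S r *\<^sub>R F t r) = (\<lambda>r. indicator S r *\<^sub>R (indicator {..t} r *\<^sub>R F t r))"
    using St by (auto simp: fun_eq_iff indicator_def)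
  have m: "(\<lambda>r. indicator S r *\<^sub>R F t r) \<in> borel_measurable lborel"
    unfolding e by measurable
  have "norm (indicator S r *\<^sub>R F t r) \<le> (c * K) * (indicator {..t} r *\<^sub>R exp (- \<omega> * (t - r)))" for r
  proof (cases "r \<in> S")
    case True
    then have r: "r \<le> t" using St by auto
    have "norm (F t r) \<le> norm (U t r) * norm (f r)" unfolding F_def by (rule norm_blinfun)
    also have "\<dots> \<le> (c * exp (- \<omega> * (t - r))) * K" using c_pos by (intro mult_mono U_bound r K) auto
    finally show ?thesis using True r by (simp add: mult_ac)
  next
    case False
    then show ?thesis using c_pos K0 by (simp add: indicator_def)
  qed
  then have "(\<integral>\<^sup>+r. norm (indicator S r *\<^sub>R F t r) \<partial>lborel) \<le> (\<integral>\<^sup>+r. ennreal ((c * K) * (indicator {..t} r *\<^sub>R exp (- \<omega> * (t - r)))) \<partial>lborel)"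
    by (intro nn_integral_mono ennreal_leI)
  also have "\<dots> < \<infinity>"
  proof -
    have "integrable lborel (\<lambda>r. (c * K) * (indicator {..t} r *\<^sub>R exp (- \<omega> * (t - r))))"
      using set_integrable_exp_atMost[OF \<omega>_pos, of t] unfolding set_integrable_def by (rule integrable_mult_right)
    moreover have "0 \<le> (c * K) * (indicator {..t} r *\<^sub>R exp (- \<omega> * (t - r)))" for r
      using c_pos K0 by (auto simp: indicator_def)
    ultimately show ?thesis by (subst nn_integral_eq_integral) auto
  qed
  finally show ?thesis unfolding set_integrable_def by (intro integrableI_hilbert m)
qed

lemma F_inner_integrable: "S \<in> sets borel \<Longrightarrow> S \<subseteq> {..t} \<Longrightarrow> set_integrable lborel S (\<lambda>r. inner h (F t r))"
  using integrable_inner_right[of h, OF F_integrable[unfolded set_integrable_def]]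
  by (simp add: set_integrable_def)

lemma inner_F_integral:
  "S \<in> sets borel \<Longrightarrow> S \<subseteq> {..t} \<Longrightarrow> inner h (\<integral>r\<in>S. F t r \<partial>lborel) = (fint S t h)"
  unfolding set_lebesgue_integral_def
  using integral_inner_right[of h, OF F_integrable[unfolded set_integrable_def]] by simp

lemma ex_B_bound: "\<exists>K\<ge>0. \<forall>r. norm (B r) \<le> K"
proof -
  obtain K where "\<And>r. norm (norm (B r)) \<le> K" using B_bdd by (auto simp: bounded_iff)
  then have "norm (B r) \<le> K" for r by simp
  moreover from this[of 0] have "0 \<le> K" using norm_ge_zero order_trans by blast
  ultimately show ?thesis by blast
qed

definition K :: real where "K = c * (SOME K. 0 \<le> K \<and> (\<forall>r. norm (B r) \<le> K))"

lemma K: "0 \<le> K" "r \<le> t \<Longrightarrow> norm (G t r) \<le> K * exp (- \<omega> * (t - r))"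
proof -
  define q where "q = (SOME K. 0 \<le> K \<and> (\<forall>r. norm (B r) \<le> K))"
  have q: "0 \<le> q \<and> (\<forall>r. norm (B r) \<le> q)" unfolding q_def by (rule someI_ex) (use ex_B_bound in blast)
  show "0 \<le> K" using q c_pos by (simp add: K_def q_def[symmetric])
  assume r: "r \<le> t"
  have "norm (G t r) \<le> norm (U t r) * norm (B r)" unfolding G_def by (rule norm_blinfun_compose)
  also have "\<dots> \<le> (c * exp (- \<omega> * (t - r))) * q" using q c_pos by (intro mult_mono U_bound r) auto
  finally show "norm (G t r) \<le> K * exp (- \<omega> * (t - r))" by (simp add: K_def q_def[symmetric] mult_ac)
qed

lemma K': "r \<le> t \<Longrightarrow> norm (G t r) \<le> K"
proof -
  assume r: "r \<le> t"
  have "exp (- \<omega> * (t - r)) \<le> 1" using r \<omega>_pos by (simp add: mult_nonneg_nonneg)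
  from mult_left_mono[OF this K(1)] show ?thesis using K(2)[OF r] by linarith
qed

lemma G_cont: "continuous_on {..t} (\<lambda>r. G t r x)"
  unfolding G_def blinfun_apply_blinfun_compose
  by (rule continuous_on_strong_apply[where K=c, OF U_cont _ continuous_on_subset[OF B_strong]]) (auto intro: U_bound')

lemma G_lam_integrable: "S \<in> sets borel \<Longrightarrow> S \<subseteq> {..t} \<Longrightarrow> set_integrable lborel S (\<lambda>r. lam (adj (G t r) u))"
  by (rule set_integrable_subset[OF set_integrable_lam_adj[OF G_cont K(2) K(1) \<omega>_pos]]) auto

definition shift :: "real \<Rightarrow> 'h" where "shift t = (\<integral>r\<in>{..t}. F t r \<partial>lborel)"

definition expo :: "real \<Rightarrow> 'h \<Rightarrow> complex" where "expo t u = (lint {..t} (G t) u)"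

lemma ex_nu:
  "\<exists>\<nu>. prob_space \<nu> \<and> sets \<nu> = sets borel \<and> infinitely_divisible \<nu> \<and>
    (\<forall>u. char_functional \<nu> u = cis (inner u (shift t)) * exp (expo t u))"
proof -
  obtain \<nu> where \<nu>: "prob_space \<nu>" "sets \<nu> = sets borel" "\<And>u. char_functional \<nu> u = cis (inner u (shift t)) * exp (expo t u)"
    using ex_stationary_law[OF G_cont K(2) K(1) \<omega>_pos, of t "shift t"] by (auto simp: expo_def)
  have "infinitely_divisible \<nu>"
    unfolding infinitely_divisible_def
  proof (intro allI impI)
    fix n :: nat assume n: "n > 0"
    interpret N: levy_increments e b R M v \<Omega> "\<lambda>t. L (1 / real n * t)" "1 * (1 / real n)"
      by (rule time_change) simp
    obtain \<mu> where \<mu>: "prob_space \<mu>" "sets \<mu> = sets borel"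
      "\<And>u. char_functional \<mu> u = cis (inner u (shift t /\<^sub>R real n)) * exp (complex_of_real (1 * (1 / real n)) * expo t u)"
      using N.ex_stationary_law[OF G_cont K(2) K(1) \<omega>_pos, of t "shift t /\<^sub>R real n"] by (auto simp: expo_def)
    have "conv_pow \<mu> n = \<nu>"
    proof (rule char_functional_unique[OF conv_pow_props(1)[OF \<mu>(1,2)] \<nu>(1) conv_pow_props(2)[OF \<mu>(1,2)] \<nu>(2)])
      fix u
      have "char_functional (conv_pow \<mu> n) u = (cis (inner u (shift t /\<^sub>R real n)) * exp (complex_of_real (1 * (1 / real n)) * expo t u)) ^ n"
        using conv_pow_props(3)[OF \<mu>(1,2)] \<mu>(3) by simp
      also have "\<dots> = cis (real n * inner u (shift t /\<^sub>R real n)) * exp (of_nat n * (complex_of_real (1 * (1 / real n)) * expo t u))"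
        by (subst exp_of_nat_mult, subst power_mult_distrib, subst Complex.DeMoivre, rule refl)
      also have "real n * inner u (shift t /\<^sub>R real n) = inner u (shift t)" using n by (simp add: field_simps)
      also have "of_nat n * (complex_of_real (1 * (1 / real n)) * expo t u) = expo t u" using n by simp
      also have "cis (inner u (shift t)) * exp (expo t u) = char_functional \<nu> u" by (simp add: \<nu>(3))
      finally show "char_functional (conv_pow \<mu> n) u = char_functional \<nu> u" .
    qed
    then show "\<exists>\<mu>. prob_space \<mu> \<and> sets \<mu> = sets borel \<and> conv_pow \<mu> n = \<nu>" using \<mu> by blast
  qed
  then show ?thesis using \<nu> by blast
qed

definition nu :: "real \<Rightarrow> 'h measure" where
  "nu t = (SOME \<nu>. prob_space \<nu> \<and> sets \<nu> = sets borel \<and> infinitely_divisible \<nu> \<and>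
    (\<forall>u. char_functional \<nu> u = cis (inner u (shift t)) * exp (expo t u)))"

lemma nu: "prob_space (nu t)" "sets (nu t) = sets borel" "infinitely_divisible (nu t)"
    "char_functional (nu t) u = cis (inner u (shift t)) * exp (expo t u)"
  using someI_ex[OF ex_nu[of t]] unfolding nu_def[symmetric] by blast+

lemma nu_periodic: "nu (t + T) = nu t"
proof (rule char_functional_unique[OF nu(1) nu(1) nu(2) nu(2)])
  fix u
  have "inner u (shift (t + T)) = inner u (shift t)"
    unfolding shift_def inner_F_integral[OF borel_closed[OF closed_atMost] order_refl]
    by (rule set_integral_atMost_shift) (simp add: F_def U_per f_per)
  moreover have "expo (t + T) u = expo t u"
    unfolding expo_def by (rule set_integral_atMost_shift) (simp add: G_def U_per B_per)
  ultimately show "char_functional (nu (t + T)) u = char_functional (nu t) u" by (simp add: nu(4))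
qed

definition kernel :: "real \<Rightarrow> real \<Rightarrow> 'h measure \<Rightarrow> 'h measure" where
  "kernel s t \<mu> = distr (\<mu> \<Otimes>\<^sub>M \<Omega>) borel (\<lambda>p. mild_sol \<Omega> L U f B t s (fst p) (snd p))"

lemma mild_sol_eq: "mild_sol \<Omega> L U f B t s x \<xi> = U t s x + (\<integral>r\<in>{s..t}. F t r \<partial>lborel) + stoch_int \<Omega> L (G t) s t \<xi>"
  by (simp add: mild_sol_def F_def G_def[abs_def])

lemma stoch_int_G: assumes "s \<le> t"
  shows "stoch_int \<Omega> L (G t) s t \<in> borel_measurable \<Omega>"
    "(\<integral>\<xi>. cis (inner u (stoch_int \<Omega> L (G t) s t \<xi>)) \<partial>\<Omega>) = exp (lint {s..t} (G t) u)"
proof -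
  have c: "continuous_on {s..t} (\<lambda>r. G t r x)" for x by (rule continuous_on_subset[OF G_cont]) auto
  show "stoch_int \<Omega> L (G t) s t \<in> borel_measurable \<Omega>"
    by (rule stoch_int_measurable[where K=K, OF assms c]) (use K' in auto)
  show "(\<integral>\<xi>. cis (inner u (stoch_int \<Omega> L (G t) s t \<xi>)) \<partial>\<Omega>) = exp (lint {s..t} (G t) u)"
    using stoch_int_cf[where K=K, OF assms c] K' by simp
qed

context
  fixes s t :: real and \<mu> :: "'h measure"
  assumes st: "s \<le> t" and \<mu>: "prob_space \<mu>" "sets \<mu> = sets borel"
begin

lemma mild_sol_measurable: "(\<lambda>p. mild_sol \<Omega> L U f B t s (fst p) (snd p)) \<in> borel_measurable (\<mu> \<Otimes>\<^sub>M \<Omega>)"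
proof -
  note [measurable] = stoch_int_G(1)[OF st]
  note [measurable_cong] = \<mu>(2)
  show ?thesis unfolding mild_sol_eq by measurable
qed

lemma kernel_prob: "prob_space (kernel s t \<mu>)" "sets (kernel s t \<mu>) = sets borel"
proof -
  interpret \<mu>: prob_space \<mu> by (rule \<mu>)
  interpret pair_prob_space \<mu> \<Omega> ..
  show "prob_space (kernel s t \<mu>)" unfolding kernel_def by (rule prob_space_distr[OF mild_sol_measurable])
  show "sets (kernel s t \<mu>) = sets borel" by (simp add: kernel_def)
qed

lemma integral_kernel:
  assumes \<phi> [measurable]: "\<phi> \<in> borel_measurable borel" and bd: "bounded (range \<phi>)"
  shows "(\<integral>x. transition \<Omega> L U f B s t \<phi> x \<partial>\<mu>) = (\<integral>x. \<phi> x \<partial>kernel s t \<mu>)"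
proof -
  interpret \<mu>: prob_space \<mu> by (rule \<mu>)
  interpret PP: pair_prob_space \<mu> \<Omega> ..
  note [measurable] = mild_sol_measurable
  obtain K where K: "\<And>x. norm (\<phi> x) \<le> K" using bd by (auto simp: bounded_iff)
  have "(\<integral>x. \<phi> x \<partial>kernel s t \<mu>) = (\<integral>p. \<phi> (mild_sol \<Omega> L U f B t s (fst p) (snd p)) \<partial>(\<mu> \<Otimes>\<^sub>M \<Omega>))"
    unfolding kernel_def by (rule integral_distr) measurable
  also have "\<dots> = (\<integral>x. (\<integral>\<xi>. \<phi> (mild_sol \<Omega> L U f B t s x \<xi>) \<partial>\<Omega>) \<partial>\<mu>)"
    by (subst PP.integral_fst'[symmetric]) (auto intro!: PP.integrable_const_bound[where B=K] AE_I2 simp: K[simplified])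
  finally show ?thesis by (simp add: transition_def)
qed

lemma char_functional_kernel:
  "char_functional (kernel s t \<mu>) h = char_functional \<mu> (adj (U t s) h) *
    (cis (fint {s..t} t h) * exp (lint {s..t} (G t) h))"
proof -
  note [measurable] = mild_sol_measurable stoch_int_G(1)[OF st]
  note [measurable_cong] = \<mu>(2)
  let ?a = "\<integral>r\<in>{s..t}. F t r \<partial>lborel"
  have "char_functional (kernel s t \<mu>) h = (\<integral>p. cis (inner h (mild_sol \<Omega> L U f B t s (fst p) (snd p))) \<partial>(\<mu> \<Otimes>\<^sub>M \<Omega>))"
    unfolding kernel_def char_functional_def by (rule integral_distr) measurable
  also have "\<dots> = (\<integral>p. cis (inner h ?a) * (cis (inner (adj (U t s) h) (fst p)) * cis (inner h (stoch_int \<Omega> L (G t) s t (snd p)))) \<partial>(\<mu> \<Otimes>\<^sub>M \<Omega>))"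
    unfolding mild_sol_eq by (simp add: inner_add_right cis_mult inner_adj' algebra_simps)
  also have "\<dots> = cis (inner h ?a) * (\<integral>p. cis (inner (adj (U t s) h) (fst p)) * cis (inner h (stoch_int \<Omega> L (G t) s t (snd p))) \<partial>(\<mu> \<Otimes>\<^sub>M \<Omega>))"
    by simp
  also have "(\<integral>p. cis (inner (adj (U t s) h) (fst p)) * cis (inner h (stoch_int \<Omega> L (G t) s t (snd p))) \<partial>(\<mu> \<Otimes>\<^sub>M \<Omega>))
     = (\<integral>x. cis (inner (adj (U t s) h) x) \<partial>\<mu>) * (\<integral>\<xi>. cis (inner h (stoch_int \<Omega> L (G t) s t \<xi>)) \<partial>\<Omega>)"
    by (rule integral_pair_prod[OF \<mu>(1) prob_space_axioms]) auto
  also have "inner h ?a = (fint {s..t} t h)" by (rule inner_F_integral) auto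
  finally show ?thesis by (simp add: stoch_int_G(2)[OF st] char_functional_def mult_ac)
qed

end

lemma evolution_iff:
  "evolution_system_of_measures (transition \<Omega> L U f B) \<mu> \<longleftrightarrow>
    (\<forall>t. prob_space (\<mu> t) \<and> sets (\<mu> t) = sets borel) \<and> (\<forall>s t. s < t \<longrightarrow> kernel s t (\<mu> s) = \<mu> t)" (is "?l \<longleftrightarrow> ?r")
proof
  assume l: ?l
  then have P: "prob_space (\<mu> t)" "sets (\<mu> t) = sets borel" for t by (auto simp: evolution_system_of_measures_def)
  have "kernel s t (\<mu> s) = \<mu> t" if st: "s < t" for s t
  proof (rule measure_eqI)
    interpret K: prob_space "kernel s t (\<mu> s)" by (rule kernel_prob[OF less_imp_le[OF st] P])
    interpret M: prob_space "\<mu> t" by (rule P)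
    have sets: "sets (kernel s t (\<mu> s)) = sets borel" by (rule kernel_prob[OF less_imp_le[OF st] P])
    then show "sets (kernel s t (\<mu> s)) = sets (\<mu> t)" by (simp add: P)
    fix A assume "A \<in> sets (kernel s t (\<mu> s))"
    then have A: "A \<in> sets borel" using sets by simp
    have m: "indicat_real A \<in> borel_measurable borel" using A by measurable
    have bd: "bounded (range (indicat_real A))" by (rule bounded_subset[of "{0, 1}"]) (auto simp: indicator_def)
    have "(\<integral>x. transition \<Omega> L U f B s t (indicat_real A) x \<partial>\<mu> s) = (\<integral>x. indicat_real A x \<partial>\<mu> t)"
      using l st m bd unfolding evolution_system_of_measures_def by blast
    then have "(\<integral>x. indicat_real A x \<partial>kernel s t (\<mu> s)) = (\<integral>x. indicat_real A x \<partial>\<mu> t)"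
      by (simp only: integral_kernel[OF less_imp_le[OF st] P m bd])
    then have "measure (kernel s t (\<mu> s)) A = measure (\<mu> t) A"
      using A sets P by (simp add: sets_eq_imp_space_eq[of _ borel])
    then show "emeasure (kernel s t (\<mu> s)) A = emeasure (\<mu> t) A"
      by (simp add: K.emeasure_eq_measure M.emeasure_eq_measure)
  qed
  then show ?r using P by blast
next
  assume r: ?r
  then show ?l unfolding evolution_system_of_measures_def by (auto simp: integral_kernel)
qed

lemma nu_kernel: assumes st: "s < t" shows "kernel s t (nu s) = nu t"
proof (rule char_functional_unique)
  have le: "s \<le> t" using st by simp
  show "prob_space (kernel s t (nu s))" "sets (kernel s t (nu s)) = sets borel" by (rule kernel_prob[OF le nu(1,2)])+
  show "prob_space (nu t)" "sets (nu t) = sets borel" by (rule nu)+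
  fix h
  have split: "{..t} = {..s} \<union> {s..t}" using le by auto
  have AE: "AE x in lborel. \<not> (x \<in> {..s} \<and> x \<in> {s..t})"
    using AE_lborel_singleton[of s] by eventually_elim auto
  have 1: "inner (adj (U t s) h) (shift s) + (fint {s..t} t h) = inner h (shift t)"
  proof -
    have "inner (adj (U t s) h) (shift s) = (\<integral>r\<in>{..s}. inner (adj (U t s) h) (F s r) \<partial>lborel)"
      unfolding shift_def by (rule inner_F_integral) auto
    also have "\<dots> = (fint {..s} t h)"
    proof (rule set_lebesgue_integral_cong)
      show "\<forall>r. r \<in> {..s} \<longrightarrow> inner (adj (U t s) h) (F s r) = inner h (F t r)"
      proof (intro allI impI)
        fix r assume "r \<in> {..s}"
        then have "U t r = U t s o\<^sub>L U s r" using U_comp[of r s t] le by simp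
        then show "inner (adj (U t s) h) (F s r) = inner h (F t r)" by (simp add: F_def inner_adj')
      qed
    qed simp
    finally have "inner (adj (U t s) h) (shift s) + (fint {s..t} t h)
      = (fint {..s} t h) + (fint {s..t} t h)" by simp
    also have "\<dots> = (fint {..t} t h)"
      unfolding split by (rule set_integral_Un_AE[symmetric, OF AE]) (use le in \<open>auto intro!: F_inner_integrable\<close>)
    also have "\<dots> = inner h (shift t)" unfolding shift_def by (rule inner_F_integral[symmetric]) auto
    finally show ?thesis .
  qed
  have 2: "expo s (adj (U t s) h) + (lint {s..t} (G t) h) = expo t h"
  proof -
    have "expo s (adj (U t s) h) = (lint {..s} (G t) h)"
      unfolding expo_def
    proof (rule set_lebesgue_integral_cong)
      show "\<forall>r. r \<in> {..s} \<longrightarrow> lam (adj (G s r) (adj (U t s) h)) = lam (adj (G t r) h)"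
      proof (intro allI impI)
        fix r assume "r \<in> {..s}"
        then have "U t r = U t s o\<^sub>L U s r" using U_comp[of r s t] le by simp
        then have "G t r = U t s o\<^sub>L G s r" by (intro blinfun_eqI) (simp add: G_def)
        then show "lam (adj (G s r) (adj (U t s) h)) = lam (adj (G t r) h)" by (simp only: adj_compose)
      qed
    qed simp
    then have "expo s (adj (U t s) h) + (lint {s..t} (G t) h)
      = (lint {..s} (G t) h) + (lint {s..t} (G t) h)" by simp
    also have "\<dots> = expo t h"
      unfolding expo_def split by (rule set_integral_Un_AE[symmetric, OF AE]) (use le in \<open>auto intro!: G_lam_integrable\<close>)
    finally show ?thesis .
  qed
  show "char_functional (kernel s t (nu s)) h = char_functional (nu t) h"
    unfolding char_functional_kernel[OF le nu(1,2)] nu(4) 1[symmetric] 2[symmetric]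
    by (simp add: cis_mult[symmetric] exp_add mult_ac)
qed

lemma periodic_evolution_unique:
  assumes ev: "evolution_system_of_measures (transition \<Omega> L U f B) \<mu>" and per: "\<And>t. \<mu> (t + T) = \<mu> t"
  shows "\<mu> = nu"
proof
  fix t
  have P: "prob_space (\<mu> t)" "sets (\<mu> t) = sets borel" for t using ev by (auto simp: evolution_iff)
  have ker: "kernel s t (\<mu> s) = \<mu> t" if "s < t" for s t using ev that by (auto simp: evolution_iff)
  define S where "S n = t - real (Suc n) * T" for n
  have S: "S n < t" "t - S n = real (Suc n) * T" for n using T_pos by (auto simp: S_def)
  have per_n: "\<mu> (t - real n * T) = \<mu> t" for n
  proof (induction n)
    case (Suc n)
    have "t - real (Suc n) * T + T = t - real n * T" by (simp add: algebra_simps)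
    then show ?case using per[of "t - real (Suc n) * T"] Suc by (simp only:)
  qed simp
  have bot: "filterlim S at_bot sequentially"
  proof -
    have "filterlim (\<lambda>n. T * real n) at_top sequentially"
      by (rule filterlim_tendsto_pos_mult_at_top[OF tendsto_const T_pos filterlim_real_sequentially])
    then have "filterlim (\<lambda>n. (T - t) + T * real n) at_top sequentially"
      by (rule filterlim_tendsto_add_at_top[OF tendsto_const])
    moreover have "S = (\<lambda>n. - ((T - t) + T * real n))" by (auto simp: S_def fun_eq_iff algebra_simps)
    ultimately show ?thesis by (simp add: filterlim_uminus_at_top)
  qed
  show "\<mu> t = nu t"
  proof (rule char_functional_unique[OF P(1) nu(1) P(2) nu(2)])
    fix h
    let ?y = "\<lambda>n. adj (U t (S n)) h"
    have y: "?y \<longlonglongrightarrow> 0"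
    proof (rule Lim_null_comparison[OF always_eventually])
      show "\<forall>n. norm (?y n) \<le> c * exp (- \<omega> * (t - S n)) * norm h" using U_decay less_imp_le[OF S(1)] by blast
      have "(\<lambda>n. exp (- \<omega> * T) ^ Suc n) \<longlonglongrightarrow> 0"
        using \<omega>_pos T_pos by (intro LIMSEQ_Suc LIMSEQ_realpow_zero) auto
      moreover have "exp (- \<omega> * (t - S n)) = exp (- \<omega> * T) ^ Suc n" for n
        unfolding S(2) exp_of_nat_mult[symmetric] by (simp only: mult_ac)
      ultimately have "(\<lambda>n. exp (- \<omega> * (t - S n))) \<longlonglongrightarrow> 0" by (simp only:)
      from tendsto_mult_left_zero[OF tendsto_mult_right_zero[OF this, of c], of "norm h"]
      show "(\<lambda>n. c * exp (- \<omega> * (t - S n)) * norm h) \<longlonglongrightarrow> 0" .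
    qed
    have eq: "char_functional (\<mu> t) h = char_functional (\<mu> t) (?y n) *
      (cis (fint {S n..t} t h) * exp (lint {S n..t} (G t) h))" for n
    proof -
      have "\<mu> (S n) = \<mu> t" unfolding S_def by (rule per_n)
      then have "kernel (S n) t (\<mu> t) = \<mu> t" using ker[OF S(1)[of n]] by simp
      then show ?thesis using char_functional_kernel[OF less_imp_le[OF S(1)[of n]] P, of t h] by simp
    qed
    have l1: "(\<lambda>n. \<integral>r\<in>{S n..t}. inner h (F t r) \<partial>lborel) \<longlonglongrightarrow> inner h (shift t)"
    proof -
      have "((\<lambda>a. \<integral>r\<in>{a..t}. inner h (F t r) \<partial>lborel) \<longlongrightarrow> (fint {..t} t h)) at_bot"
        by (rule tendsto_set_lebesgue_integral_at_bot[OF _ F_inner_integrable]) auto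
      then have "((\<lambda>a. \<integral>r\<in>{a..t}. inner h (F t r) \<partial>lborel) \<longlongrightarrow> inner h (shift t)) at_bot"
        unfolding shift_def by (subst inner_F_integral) auto
      then show ?thesis using bot by (rule filterlim_compose)
    qed
    have l2: "(\<lambda>n. \<integral>r\<in>{S n..t}. lam (adj (G t r) h) \<partial>lborel) \<longlonglongrightarrow> expo t h"
    proof -
      have "((\<lambda>a. \<integral>r\<in>{a..t}. lam (adj (G t r) h) \<partial>lborel) \<longlongrightarrow> expo t h) at_bot"
        unfolding expo_def by (rule tendsto_set_lebesgue_integral_at_bot[OF _ G_lam_integrable]) auto
      then show ?thesis using bot by (rule filterlim_compose)
    qed
    have "(\<lambda>n. char_functional (\<mu> t) (?y n) *
      (cis (fint {S n..t} t h) * exp (lint {S n..t} (G t) h)))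
      \<longlonglongrightarrow> 1 * (cis (inner h (shift t)) * exp (expo t h))"
      by (intro tendsto_mult char_functional_tendsto_1 P y tendsto_cis_real l1 tendsto_exp l2)
    then have "(\<lambda>n::nat. char_functional (\<mu> t) h) \<longlonglongrightarrow> char_functional (nu t) h"
      unfolding eq[symmetric] nu(4) by simp
    then show "char_functional (\<mu> t) h = char_functional (nu t) h" by (simp add: LIMSEQ_const_iff)
  qed
qed

end

theorem mainTheorem5:
  fixes \<Omega> :: "'w measure"
    and L :: "real \<Rightarrow> 'w \<Rightarrow> 'h::{real_inner,complete_space,second_countable_topology}"
    and b :: 'h and R :: "'h \<Rightarrow>\<^sub>L 'h" and M :: "'h measure"
    and f :: "real \<Rightarrow> 'h" and B :: "real \<Rightarrow> 'h \<Rightarrow>\<^sub>L 'h"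
    and A :: "real \<Rightarrow> 'h \<Rightarrow> 'h" and D :: "'h set"
    and U :: "real \<Rightarrow> real \<Rightarrow> 'h \<Rightarrow>\<^sub>L 'h"
    and c \<omega> T :: real
  assumes levy: "levy_process \<Omega> L b R M"
    and f_cont: "continuous_on UNIV f"
    and B_strong: "\<And>x. continuous_on UNIV (\<lambda>r. B r x)"
    and B_bdd: "bounded (range (\<lambda>r. norm (B r)))"
    and D_sub: "subspace D"
    and A_lin: "\<And>t x y a. x \<in> D \<Longrightarrow> y \<in> D \<Longrightarrow> A t (x + y) = A t x + A t y \<and> A t (a *\<^sub>R x) = a *\<^sub>R A t x"
    and U_id: "\<And>s. U s s = id_blinfun"
    and U_comp: "\<And>t s r. r \<le> s \<Longrightarrow> s \<le> t \<Longrightarrow> U t s o\<^sub>L U s r = U t r"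
    and U_strong: "\<And>x. continuous_on {(t, s). s \<le> t} (\<lambda>(t, s). U t s x)"
    and c_pos: "c > 0" and \<omega>_pos: "\<omega> > 0"
    and U_bound: "\<And>t s. s \<le> t \<Longrightarrow> norm (U t s) \<le> c * exp (- \<omega> * (t - s))"
    and U_D: "\<And>t s x. s \<le> t \<Longrightarrow> x \<in> D \<Longrightarrow> U t s x \<in> D"
    and U_deriv: "\<And>t s x. s \<le> t \<Longrightarrow> x \<in> D \<Longrightarrow>
        ((\<lambda>\<tau>. U \<tau> s x) has_vector_derivative A t (U t s x)) (at t within {s..})"
    and T_pos: "T > 0"
    and A_per: "\<And>t. A (t + T) = A t"
    and f_per: "\<And>t. f (t + T) = f t"
    and B_per: "\<And>t. B (t + T) = B t"
    and U_per: "\<And>t s. s \<le> t \<Longrightarrow> U (t + T) (s + T) = U t s"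
    and M_moment: "(\<integral>\<^sup>+x\<in>{x. norm x > 1}. ennreal (norm x) \<partial>M) < \<infinity>"
  shows "(\<forall>t h. set_integrable lborel {..t} (\<lambda>r. U t r (f r))
            \<and> set_integrable lborel {..t} (\<lambda>r. levy_symbol b R M (adj (B r) (adj (U t r) h))))
       \<and> (\<exists>\<nu>::real \<Rightarrow> 'h measure.
            (\<forall>t. prob_space (\<nu> t) \<and> sets (\<nu> t) = sets borel \<and> infinitely_divisible (\<nu> t)
               \<and> (\<forall>h. char_functional (\<nu> t) h =
                      cis (inner h (\<integral>r\<in>{..t}. U t r (f r) \<partial>lborel))
                      * exp (\<integral>r\<in>{..t}. levy_symbol b R M (adj (B r) (adj (U t r) h)) \<partial>lborel)))
          \<and> evolution_system_of_measures (transition \<Omega> L U f B) \<nu>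
          \<and> (\<forall>t. \<nu> (t + T) = \<nu> t)
          \<and> (\<forall>\<mu>. evolution_system_of_measures (transition \<Omega> L U f B) \<mu> \<and> (\<forall>t. \<mu> (t + T) = \<mu> t)
                 \<longrightarrow> \<mu> = \<nu>))"
proof -
  have levy_parts: "prob_space \<Omega>" "levy_measure M" "sym_nonneg_trace_class R" "\<And>t. L t \<in> borel_measurable \<Omega>"
    "\<And>(ts::nat \<Rightarrow> real) n. (\<And>i. i < n \<Longrightarrow> ts i \<le> ts (Suc i)) \<Longrightarrow>
        prob_space.indep_vars \<Omega> (\<lambda>_. borel) (\<lambda>i \<omega>. L (ts (Suc i)) \<omega> - L (ts i) \<omega>) {..<n}"
    "\<And>s t u. s \<le> t \<Longrightarrow> (\<integral>\<omega>. cis (inner u (L t \<omega> - L s \<omega>)) \<partial>\<Omega>) = exp (complex_of_real (t - s) * levy_symbol b R M u)"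
    using levy unfolding levy_process_def by blast+
  obtain e v :: "nat \<Rightarrow> 'h" where ev: "onb_seq e" "\<And>u. (\<lambda>m. (inner (v m) u)\<^sup>2) sums inner u (R u)"
      "summable (\<lambda>m. (norm (v m))\<^sup>2)"
    by (rule trace_class_factorisation[OF levy_parts(3)]) (rule that)
  interpret prob_space \<Omega> by (rule levy_parts(1))
  interpret onb_seq e by (rule ev(1))
  interpret levy_triplet e b R M v
    by unfold_locales (fact ev levy_parts(2) M_moment)+
  interpret levy_increments e b R M v \<Omega> L 1
    by unfold_locales (simp_all add: levy_parts(4-6))
  interpret mehler e b R M v \<Omega> L f B U c \<omega> T
    by unfold_locales (fact f_cont B_strong B_bdd U_comp U_strong c_pos \<omega>_pos U_bound T_pos f_per B_per U_per)+
  have G: "levy_symbol b R M (adj (B r) (adj (U t r) h)) = levy_symbol b R M (adj (G t r) h)" for t r h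
    by (simp add: G_def adj_compose)
  have F: "U t r (f r) = F t r" for t r by (simp add: F_def)
  have ev: "evolution_system_of_measures (transition \<Omega> L U f B) nu"
    unfolding evolution_iff using nu(1,2) nu_kernel by blast
  show ?thesis unfolding G F
  proof (intro conjI allI exI[of _ nu])
    show "set_integrable lborel {..t} (F t)" for t by (rule F_integrable) auto
    show "set_integrable lborel {..t} (\<lambda>r. levy_symbol b R M (adj (G t r) h))" for t h
      by (rule G_lam_integrable) auto
    show "char_functional (nu t) h = cis (inner h (\<integral>r\<in>{..t}. F t r \<partial>lborel))
        * exp (\<integral>r\<in>{..t}. levy_symbol b R M (adj (G t r) h) \<partial>lborel)" for t h
      by (simp add: nu(4) shift_def expo_def)
    show "evolution_system_of_measures (transition \<Omega> L U f B) \<mu> \<and> (\<forall>t. \<mu> (t + T) = \<mu> t) \<longrightarrow> \<mu> = nu" for \<mu>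
      using periodic_evolution_unique by blast
  qed (use nu nu_periodic ev in auto)
qed

end
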